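(* Let $C\subseteq\mathbb R^d$ be a $p$-convex set ($p\in\mathbb N$) with $|C|=1$, let $\mathbf c_n=(c_{n,1},\dots,c_{n,d})$ be vectors with $0<c_{n,\ell}\to\infty$ for each $\ell$, and let $D_n=(\mathbf c_nC)\cap\mathbb Z^d$. Let $(\xi_v)_{v\in\mathbb Z^d}$ be a stationary real-valued random field satisfying condition $\mathcal D(x_n;K_n)$ for some real sequence $(x_n)_{n\in\mathbb N}$, with associated vectors $\boldsymbol\gamma_n$ and constants $\alpha_n$. Let $(k_n)$ be a sequence of integers satisfying $k_n\to\infty$, $k_n\alpha_n\to0$ and $k_n^{1/d}\boldsymbol\gamma_n=o(\mathbf c_n)$ as $n\to\infty$, such that condition $\mathcal D^\ell(x_n;k_n;\theta)$ is satisfied for some $\theta\in(0,1]$. If, for some $0<\tau<\infty$, $|D_n|\,\mathbb P(\xi_0>x_n)\to\tau$, then $\tilde N_n\stackrel{vd}{\to}N$, where $N$ is a homogeneous Poisson measure on $C$ with intensity $\theta\tau$.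
   Context: Notation: $d\in\mathbb N$; $|\cdot|$ denotes the Euclidean norm of a point, Lebesgue measure of a full-dimensional subset of $\mathbb R^d$, and cardinality of a subset of $\mathbb Z^d$ (or of a finite set of points). For vectors $\mathbf r=(r_1,\dots,r_d)$ and $A\subseteq\mathbb R^d$, $\mathbf rA=\{(r_1a_1,\dots,r_da_d):a\in A\}$; products and quotients of vectors are coordinate-wise. $A\oplus B$ is the Minkowski sum, $B(1)$ the closed Euclidean unit ball. $\mathbf r_n=o(\mathbf c_n)$ means $r_{n,\ell}/c_{n,\ell}\to0$ for each $\ell$. $M_\xi(A)=\max_{v\in A}\xi_v$, with $M_\xi(\emptyset)=-\infty$. A convex body is a compact convex subset of $\mathbb R^d$ with non-empty interior; a set is $p$-convex if it is a union of $p$ convex bodies. Write $C_n=\mathbf c_nC$. Boxes: every sequence $(k_n)$ considered consists of positive integers with $k_n\to\infty$ and $k_n^{1/d}=o(c_{n,\ell})$ for all $\ell$. Put $t_{n,k_n}^\ell=\lfloor c_{n,\ell}/k_n^{1/d}\rfloor$, $\mathbf t_{n,k_n}=(t_{n,k_n}^1,\dots,t_{n,k_n}^d)$, and for $z\in\mathbb Z^d$, $I_z^{n,k_n}=\mathbf t_{n,k_n}(z+[0,1)^d)$, $J_z^{n,k_n}=I_z^{n,k_n}\cap\mathbb Z^d$, and $D_{n,k_n}^+=\bigcup\{J_z^{n,k_n}: I_z^{n,k_n}\cap C_n\ne\emptyset\}$. $K_n=\mathbb Z^d\cap\mathbf c_n[-c,c]^d$, where $0<c<\infty$ is a fixed constant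 (which can be chosen independently of $(k_n)$) such that $D_{n,k_n}^+\subseteq K_n$ for all $n$. Condition $\mathcal D(x_n;K_n)$: sets $A,B\subseteq\mathbb Z^d$ are $\boldsymbol\gamma$-separated if $B\subseteq(A\oplus\boldsymbol\gamma B(1))^c$. The condition holds for $(\xi_v)$ if there is an increasing sequence of $d$-dimensional vectors $\boldsymbol\gamma_n$ with $\boldsymbol\gamma_n=o(\mathbf c_n)$ and constants $\alpha_n\to0$ such that for all $n$ and all $\boldsymbol\gamma_n$-separated $A,B\subseteq K_n$, at least one of which is a box, $|\mathbb P(M_\xi(A\cup B)\le x_n)-\mathbb P(M_\xi(A)\le x_n)\mathbb P(M_\xi(B)\le x_n)|\le\alpha_n$. Order: $\preceq$ is an arbitrary fixed translation invariant total order on $\mathbb Z^d$, and $A_v^{n,k_n}=\{z\in(v+\mathbf t_{n,k_n}[-1,1]^d)\cap\mathbb Z^d: v\prec z\}$. Condition $\mathcal D^\ell(x_n;k_n;\theta)$: $\mathbb P(M_\xi(A_0^{n,k_n})\le x_n\mid\xi_0>x_n)\to\theta$ as $n\to\infty$. Cluster counting process $\tilde N_n$: let $Q_{n,k_n}^-=\{z\in\mathbb Z^d: z\,\mathbf t_{n,k_n}/\mathbf c_n\in C\}$, $\tilde D_{n,k_n}=\bigcup_{z\in Q_{n,k_n}^-}J_z^{n,k_n}$ and $\Phi_n=\{v/\mathbf c_n: v\in\tilde D_{n,k_n},\ \xi_v>x_n\}$. Two points $u,u'\in\Phi_n$ are in the same cluster if there is a sequence of distinct elements $u=u_0,u_1,\dots,u_R=u'$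 of that cluster (i.e. of $\Phi_n$) with $|u_i-u_{i-1}|\le\sqrt d/k_n^{1/d}$ for $i=1,\dots,R$. This divides $\Phi_n$ uniquely into $X_{n,k_n}$ disjoint clusters $\mathcal C_1^{n,k_n},\dots,\mathcal C_{X_{n,k_n}}^{n,k_n}$ (in arbitrary order). The cluster point of $\mathcal C_i^{n,k_n}$ is $x_i^{n,k_n}=\arg\min_{x\in\mathcal C_i^{n,k_n}}\sum_{x'\in\mathcal C_i^{n,k_n}}|x-x'|^2$. The random measure $\tilde N_n$ on $C$ is $\tilde N_n(A)=\sum_{i=1}^{X_{n,k_n}}\mathbf 1_A(x_i^{n,k_n})$ for Borel $A\subseteq C$ (equal to $0$ if $X_{n,k_n}=0$). Convergence: $\tilde N_n\stackrel{vd}{\to}N$ (convergence in distribution with respect to the vague topology) means that $\int_Cf\,d\tilde N_n\to\int_Cf\,dN$ in distribution for all bounded continuous functions $f:C\to[0,\infty)$ with compact support. *)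

theory Defs
  imports "HOL-Probability.Probability"
begin

text \<open>
  The dimension \<open>d\<close> is \<open>CARD('d)\<close>: points of \<open>\<real>\<^sup>d\<close> have type \<open>real ^ 'd\<close> and lattice points
  have type \<open>int ^ 'd\<close>.  The library product \<open>*\<close> and order \<open>\<le>\<close> on these types are coordinate-wise.
\<close>

definition of_int_vec :: "int ^ 'd \<Rightarrow> real ^ 'd" where
  "of_int_vec v = (\<chi> i. of_int (v $ i))"

definition scale_set :: "real ^ 'd \<Rightarrow> (real ^ 'd) set \<Rightarrow> (real ^ 'd) set" where
  "scale_set r A = (\<lambda>a. r * a) ` A"

definition vec_quot :: "real ^ 'd \<Rightarrow> real ^ 'd \<Rightarrow> real ^ 'd" where
  "vec_quot a b = (\<chi> i. a $ i / b $ i)"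

definition minkowski_sum :: "(real ^ 'd) set \<Rightarrow> (real ^ 'd) set \<Rightarrow> (real ^ 'd) set" where
  "minkowski_sum A B = {a + b | a b. a \<in> A \<and> b \<in> B}"

definition lattice_points :: "(real ^ 'd) set \<Rightarrow> (int ^ 'd) set" where
  "lattice_points A = {v. of_int_vec v \<in> A}"

definition vec_small_o :: "(nat \<Rightarrow> real ^ 'd) \<Rightarrow> (nat \<Rightarrow> real ^ 'd) \<Rightarrow> bool" where
  "vec_small_o r c \<longleftrightarrow> (\<forall>i. (\<lambda>n. r n $ i / c n $ i) \<longlonglongrightarrow> 0)"

definition convex_body :: "(real ^ 'd) set \<Rightarrow> bool" where
  "convex_body K \<longleftrightarrow> compact K \<and> convex K \<and> interior K \<noteq> {}"

definition p_convex :: "nat \<Rightarrow> (real ^ 'd) set \<Rightarrow> bool" where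
  "p_convex p C \<longleftrightarrow> (\<exists>K. (\<forall>i<p. convex_body (K i)) \<and> C = (\<Union>i<p. K i))"


subsection \<open>Blocks\<close>

text \<open>The arguments \<open>cn\<close>, \<open>kn\<close> are the \<open>n\<close>-th members of the sequences \<open>c\<close>, \<open>k\<close>.\<close>

definition block_side :: "real ^ 'd \<Rightarrow> nat \<Rightarrow> real ^ 'd" where
  "block_side cn kn = (\<chi> i. of_int \<lfloor>cn $ i / root CARD('d) (real kn)\<rfloor>)"

definition block_I :: "real ^ 'd \<Rightarrow> nat \<Rightarrow> int ^ 'd \<Rightarrow> (real ^ 'd) set" where
  "block_I cn kn z =
     scale_set (block_side cn kn) ((\<lambda>u. of_int_vec z + u) ` {u. \<forall>i. 0 \<le> u $ i \<and> u $ i < 1})"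

definition block_J :: "real ^ 'd \<Rightarrow> nat \<Rightarrow> int ^ 'd \<Rightarrow> (int ^ 'd) set" where
  "block_J cn kn z = lattice_points (block_I cn kn z)"

definition D_plus :: "(real ^ 'd) set \<Rightarrow> real ^ 'd \<Rightarrow> nat \<Rightarrow> (int ^ 'd) set" where
  "D_plus C cn kn = \<Union>{block_J cn kn z | z. block_I cn kn z \<inter> scale_set cn C \<noteq> {}}"

definition K_box :: "real \<Rightarrow> real ^ 'd \<Rightarrow> (int ^ 'd) set" where
  "K_box \<kappa> cn = lattice_points (scale_set cn {u. \<forall>i. - \<kappa> \<le> u $ i \<and> u $ i \<le> \<kappa>})"


subsection \<open>Stationary fields and the mixing conditions\<close>

definition stationary_field :: "'w measure \<Rightarrow> (int ^ 'd \<Rightarrow> 'w \<Rightarrow> real) \<Rightarrow> bool" where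
  "stationary_field M \<xi> \<longleftrightarrow>
     (\<forall>v. \<xi> v \<in> borel_measurable M) \<and>
     (\<forall>h. distr M (\<Pi>\<^sub>M v\<in>UNIV. borel) (\<lambda>\<omega> v. \<xi> (v + h) \<omega>)
        = distr M (\<Pi>\<^sub>M v\<in>UNIV. borel) (\<lambda>\<omega> v. \<xi> v \<omega>))"

text \<open>Only used for finite \<open>A\<close>, where the supremum is a maximum; it is \<open>-\<infinity>\<close> for \<open>A = {}\<close>.\<close>

definition field_max :: "(int ^ 'd \<Rightarrow> 'w \<Rightarrow> real) \<Rightarrow> (int ^ 'd) set \<Rightarrow> 'w \<Rightarrow> ereal" where
  "field_max \<xi> A \<omega> = (SUP v\<in>A. ereal (\<xi> v \<omega>))"

definition separated :: "real ^ 'd \<Rightarrow> (int ^ 'd) set \<Rightarrow> (int ^ 'd) set \<Rightarrow> bool" where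
  "separated \<gamma> A B \<longleftrightarrow>
     of_int_vec ` B \<subseteq> - minkowski_sum (of_int_vec ` A) (scale_set \<gamma> (cball 0 1))"

text \<open>A box is a lattice box, i.e. an interval \<open>{a..b}\<close> of the coordinate-wise order.\<close>

definition cond_D ::
  "'w measure \<Rightarrow> (int ^ 'd \<Rightarrow> 'w \<Rightarrow> real) \<Rightarrow> (nat \<Rightarrow> real ^ 'd) \<Rightarrow> (nat \<Rightarrow> real) \<Rightarrow>
   (nat \<Rightarrow> (int ^ 'd) set) \<Rightarrow> (nat \<Rightarrow> real ^ 'd) \<Rightarrow> (nat \<Rightarrow> real) \<Rightarrow> bool" where
  "cond_D M \<xi> c x K \<gamma> \<alpha> \<longleftrightarrow>
     incseq \<gamma> \<and> vec_small_o \<gamma> c \<and> \<alpha> \<longlonglongrightarrow> 0 \<and>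
     (\<forall>n A B. A \<subseteq> K n \<and> B \<subseteq> K n \<and> separated (\<gamma> n) A B \<and>
        (\<exists>a b. A = {a..b} \<or> B = {a..b}) \<longrightarrow>
        \<bar>\<P>(\<omega> in M. field_max \<xi> (A \<union> B) \<omega> \<le> ereal (x n))
          - \<P>(\<omega> in M. field_max \<xi> A \<omega> \<le> ereal (x n))
            * \<P>(\<omega> in M. field_max \<xi> B \<omega> \<le> ereal (x n))\<bar> \<le> \<alpha> n)"

definition translation_invariant_total_order :: "(int ^ 'd) rel \<Rightarrow> bool" where
  "translation_invariant_total_order R \<longleftrightarrow>
     linear_order R \<and> (\<forall>u v h. (u, v) \<in> R \<longrightarrow> (u + h, v + h) \<in> R)"

definition later_block ::
  "(int ^ 'd) rel \<Rightarrow> real ^ 'd \<Rightarrow> nat \<Rightarrow> int ^ 'd \<Rightarrow> (int ^ 'd) set" where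
  "later_block R cn kn v =
     {z \<in> lattice_points ((\<lambda>a. of_int_vec v + a) `
             scale_set (block_side cn kn) {u. \<forall>i. - 1 \<le> u $ i \<and> u $ i \<le> 1}).
        (v, z) \<in> R \<and> v \<noteq> z}"

definition cond_D_local ::
  "'w measure \<Rightarrow> (int ^ 'd \<Rightarrow> 'w \<Rightarrow> real) \<Rightarrow> (nat \<Rightarrow> real ^ 'd) \<Rightarrow> (int ^ 'd) rel \<Rightarrow>
   (nat \<Rightarrow> real) \<Rightarrow> (nat \<Rightarrow> nat) \<Rightarrow> real \<Rightarrow> bool" where
  "cond_D_local M \<xi> c R x k \<theta> \<longleftrightarrow>
     (\<lambda>n. \<P>(\<omega> in M. field_max \<xi> (later_block R (c n) (k n) 0) \<omega> \<le> ereal (x n) \<bar> \<xi> 0 \<omega> > x n))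
       \<longlonglongrightarrow> \<theta>"


subsection \<open>The cluster counting process\<close>

definition Q_minus :: "(real ^ 'd) set \<Rightarrow> real ^ 'd \<Rightarrow> nat \<Rightarrow> (int ^ 'd) set" where
  "Q_minus C cn kn = {z. vec_quot (of_int_vec z * block_side cn kn) cn \<in> C}"

definition D_tilde :: "(real ^ 'd) set \<Rightarrow> real ^ 'd \<Rightarrow> nat \<Rightarrow> (int ^ 'd) set" where
  "D_tilde C cn kn = (\<Union>z\<in>Q_minus C cn kn. block_J cn kn z)"

definition exceedance_points ::
  "(real ^ 'd) set \<Rightarrow> (int ^ 'd \<Rightarrow> 'w \<Rightarrow> real) \<Rightarrow> real ^ 'd \<Rightarrow> nat \<Rightarrow> real \<Rightarrow> 'w \<Rightarrow> (real ^ 'd) set" where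
  "exceedance_points C \<xi> cn kn xn \<omega> =
     {vec_quot (of_int_vec v) cn | v. v \<in> D_tilde C cn kn \<and> \<xi> v \<omega> > xn}"

definition same_cluster :: "real \<Rightarrow> (real ^ 'd) set \<Rightarrow> real ^ 'd \<Rightarrow> real ^ 'd \<Rightarrow> bool" where
  "same_cluster \<delta> \<Phi> u u' \<longleftrightarrow>
     (\<exists>us. us \<noteq> [] \<and> distinct us \<and> set us \<subseteq> \<Phi> \<and> hd us = u \<and> last us = u' \<and>
           successively (\<lambda>a b. norm (b - a) \<le> \<delta>) us)"

definition clusters :: "real \<Rightarrow> (real ^ 'd) set \<Rightarrow> (real ^ 'd) set set" where
  "clusters \<delta> \<Phi> = \<Phi> // {(u, u'). same_cluster \<delta> \<Phi> u u'}"

text \<open>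
  The minimiser defining the cluster point of a finite set need not be unique, so the
  tie-breaking rule \<open>ctr\<close> is left arbitrary.
\<close>

definition cluster_point_rule :: "((real ^ 'd) set \<Rightarrow> real ^ 'd) \<Rightarrow> bool" where
  "cluster_point_rule ctr \<longleftrightarrow>
     (\<forall>S. finite S \<and> S \<noteq> {} \<longrightarrow>
        is_arg_min (\<lambda>x. \<Sum>x'\<in>S. (norm (x - x'))\<^sup>2) (\<lambda>x. x \<in> S) (ctr S))"

text \<open>
  A cluster point may lie outside \<open>C\<close> (blocks can stick out of \<open>C\<close>); as a measure on \<open>C\<close>,
  \<open>cluster_process\<close> does not count such points.
\<close>

definition cluster_process ::
  "(real ^ 'd) set \<Rightarrow> (int ^ 'd \<Rightarrow> 'w \<Rightarrow> real) \<Rightarrow> ((real ^ 'd) set \<Rightarrow> real ^ 'd) \<Rightarrow>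
   real ^ 'd \<Rightarrow> nat \<Rightarrow> real \<Rightarrow> 'w \<Rightarrow> (real ^ 'd) measure" where
  "cluster_process C \<xi> ctr cn kn xn \<omega> =
     measure_of C (sets (restrict_space borel C))
       (\<lambda>A. \<Sum>S\<in>clusters (sqrt (real CARD('d)) / root CARD('d) (real kn))
                        (exceedance_points C \<xi> cn kn xn \<omega>).
              indicator A (ctr S))"


subsection \<open>Poisson measures and convergence\<close>

definition random_measure_on ::
  "'w measure \<Rightarrow> (real ^ 'd) set \<Rightarrow> ('w \<Rightarrow> (real ^ 'd) measure) \<Rightarrow> bool" where
  "random_measure_on M C N \<longleftrightarrow>
     (\<forall>\<omega>\<in>space M. sets (N \<omega>) = sets (restrict_space borel C)) \<and>
     (\<forall>A\<in>sets borel. A \<subseteq> C \<longrightarrow> (\<lambda>\<omega>. emeasure (N \<omega>) A) \<in> borel_measurable M)"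

definition homogeneous_poisson_measure ::
  "'w measure \<Rightarrow> (real ^ 'd) set \<Rightarrow> real \<Rightarrow> ('w \<Rightarrow> (real ^ 'd) measure) \<Rightarrow> bool" where
  "homogeneous_poisson_measure M C \<rho> N \<longleftrightarrow>
     random_measure_on M C N \<and>
     (\<forall>A\<in>sets borel. A \<subseteq> C \<longrightarrow>
        (\<forall>j::nat. \<P>(\<omega> in M. emeasure (N \<omega>) A = of_nat j)
           = (\<rho> * measure lborel A) ^ j / fact j * exp (- (\<rho> * measure lborel A)))) \<and>
     (\<forall>(I::nat set) A. finite I \<and> (\<forall>i\<in>I. A i \<in> sets borel \<and> A i \<subseteq> C) \<and> disjoint_family_on A I \<longrightarrow>
        prob_space.indep_vars M (\<lambda>_. borel) (\<lambda>i \<omega>. emeasure (N \<omega>) (A i)) I)"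

definition conv_in_distr ::
  "'w measure \<Rightarrow> (nat \<Rightarrow> 'w \<Rightarrow> real) \<Rightarrow> 'v measure \<Rightarrow> ('v \<Rightarrow> real) \<Rightarrow> bool" where
  "conv_in_distr M X M' Y \<longleftrightarrow>
     (\<forall>n. X n \<in> borel_measurable M) \<and> Y \<in> borel_measurable M' \<and>
     weak_conv_m (\<lambda>n. distr M borel (X n)) (distr M' borel Y)"

text \<open>The support of \<open>f\<close> is taken in the space \<open>C\<close>.\<close>

definition conv_vd ::
  "(real ^ 'd) set \<Rightarrow> 'w measure \<Rightarrow> (nat \<Rightarrow> 'w \<Rightarrow> (real ^ 'd) measure) \<Rightarrow>
   'v measure \<Rightarrow> ('v \<Rightarrow> (real ^ 'd) measure) \<Rightarrow> bool" where
  "conv_vd C M X M' N \<longleftrightarrow>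
     (\<forall>f :: real ^ 'd \<Rightarrow> real.
        continuous_on C f \<and> bounded (f ` C) \<and> (\<forall>x\<in>C. 0 \<le> f x) \<and>
        compact (C \<inter> closure {x \<in> C. f x \<noteq> 0}) \<longrightarrow>
        conv_in_distr M (\<lambda>n \<omega>. \<integral>x. f x \<partial>X n \<omega>) M' (\<lambda>\<omega>. \<integral>x. f x \<partial>N \<omega>))"

end

theory Submission
  imports Defs
begin

text \<open>
  Call a block hit if it contains an exceedance.  Removing from every block a strip of width
  \<open>\<gamma>\<^sub>n\<close>, which is hit with probability \<open>o(1/k\<^sub>n)\<close>, makes distinct blocks separated, so the mixing
  condition shows that two given blocks are both hit with probability \<open>o(1/k\<^sub>n)\<close>, and that the
  probability that none of \<open>O(k\<^sub>n)\<close> blocks is hit is asymptotically the product.  Decomposing the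
  event that a block is hit according to its last exceedance in the order \<open>R\<close>, the local condition
  yields \<open>k\<^sub>n P(block hit) \<longlonglongrightarrow> \<theta>\<tau>\<close>; hence void probabilities converge to those of the Poisson measure.
  With high probability no two nearby blocks and no block at the boundary of \<open>C\<close> are hit, and then the
  clusters are exactly the contents of the hit blocks.

  A Renyi--Kallenberg type argument finishes the proof: partition \<open>C\<close> into cells of small
  volume and diameter.  Up to a small error in the characteristic function of the integral of \<open>f\<close>,
  both the cluster process and the Poisson measure may be replaced by the indicators that the cells
  are charged, and the joint law of these indicators is a function of the void probabilities.
\<close>

subsection \<open>Lattice boxes and counting of lattice points\<close>

text \<open>For a single n everything is an explicit inequality in \<open>q\<close>,
  \<open>gap_err\<close> and \<open>pair_err\<close>; limits are taken afterwards and only for large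
  n, since block sides may vanish before. Condition D compares two sets, one of them a box, so a
  product over blocks arises by peeling off one core at a time at cost \<alpha>; with O(k_n) blocks
  the total is O(k_n \<alpha>_n). There is a threat of circularity: \<open>pair_err\<close> contains
  q^2, while the sharp asymptotics of q rest on \<open>pair_err\<close>. The union bound q =
  O(1/k_n) breaks the circle. For a fixed f, both characteristic functions are compared with finite
  sums over void probabilities that have the same coefficients. Replacing a count K by its indicator
  costs E K - P(K \<noteq> 0), in the limit at most \<mu>^2 for a cell of mean \<mu>, so all cells
  together cost at most a constant times the largest cell volume. On the cluster side K counts hit
  blocks, whose mean is explicit, rather than clusters, which are understood only off an exceptional
  event. Volumes enter through counts of blocks, hence every set considered must have a null
  boundary.\<close>

lemma finite_int_vec_interval: "finite {a..b::int^'d}"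
  and card_int_vec_interval: "card {a..b::int^'d} = (\<Prod>i\<in>UNIV. nat (b $ i - a $ i + 1))"
proof -
  have "bij_betw vec_nth {a..b} (PiE UNIV (\<lambda>i. {a $ i..b $ i}))"
    by (rule bij_betwI[where g = vec_lambda]) (auto simp: less_eq_vec_def PiE_def Pi_def)
  moreover have "finite (PiE UNIV (\<lambda>i. {a $ i..b $ i}))"
    by (intro finite_PiE) auto
  moreover have "card (PiE UNIV (\<lambda>i. {a $ i..b $ i})) = (\<Prod>i\<in>UNIV. nat (b $ i - a $ i + 1))"
    by (simp add: card_PiE)
  ultimately show "finite {a..b}" "card {a..b} = (\<Prod>i\<in>UNIV. nat (b $ i - a $ i + 1))"
    by (auto simp: bij_betw_finite bij_betw_same_card)
qed

text \<open>Index of the half-open cell h(z + [0,1)^d) containing y. It serves for three grids: the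
  rescaled lattice (h = 1/c_n), the rescaled blocks (h = t_n/c_n), and a fixed grid that cuts C into
  cells.\<close>

definition lattice_floor :: "real ^ 'd \<Rightarrow> real ^ 'd \<Rightarrow> int ^ 'd" where
  "lattice_floor h y = (\<chi> i. \<lfloor>y $ i / h $ i\<rfloor>)"

lemma lattice_floor_eq_iff:
  assumes "\<And>i. 0 < h $ i"
  shows "lattice_floor h y = z \<longleftrightarrow>
    (\<forall>i. h $ i * of_int (z $ i) \<le> y $ i \<and> y $ i < h $ i * (of_int (z $ i) + 1))"
  using assms by (simp add: lattice_floor_def vec_eq_iff floor_eq_iff field_simps)

lemma lattice_floor_measurable [measurable]: "lattice_floor (h :: real ^ 'd) \<in> borel \<rightarrow>\<^sub>M count_space UNIV"
proof -
  have "(\<lambda>y. \<lfloor>y $ i / h $ i\<rfloor>) \<in> borel \<rightarrow>\<^sub>M count_space UNIV" for i :: 'd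
    by measurable
  then have "{y. \<lfloor>y $ i / h $ i\<rfloor> = z} \<in> sets borel" for i :: 'd and z
    by (auto intro!: pred_sets1 simp: pred_def)
  then have "(\<Inter>i\<in>UNIV. {y. \<lfloor>y $ i / h $ i\<rfloor> = z $ i}) \<in> sets borel" for z :: "int ^ 'd"
    by (intro sets.finite_INT) auto
  moreover have "lattice_floor h -` {z} = (\<Inter>i\<in>UNIV. {y. \<lfloor>y $ i / h $ i\<rfloor> = z $ i})" for z :: "int ^ 'd"
    by (auto simp: lattice_floor_def vec_eq_iff)
  ultimately show ?thesis
    by (subst measurable_count_space_eq_countable) auto
qed

text \<open>The half-open cell is squeezed between an open and a closed box of equal volume.\<close>

lemma emeasure_lattice_floor_vimage:
  assumes h: "\<And>i. 0 < h $ i"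
  shows "emeasure lborel (lattice_floor h -` {z}) = ennreal (\<Prod>i\<in>UNIV. h $ i)"
proof -
  define a b :: "real ^ 'a" where "a = (\<chi> i. h $ i * of_int (z $ i))"
    and "b = (\<chi> i. h $ i * (of_int (z $ i) + 1))"
  have le: "a \<bullet> e \<le> b \<bullet> e" if "e \<in> Basis" for e
    using that h by (auto simp: a_def b_def Basis_vec_def inner_axis algebra_simps less_imp_le)
  have Basis: "(Basis :: (real^'a) set) = (\<lambda>i. axis i 1) ` UNIV"
    by (auto simp: Basis_vec_def)
  have "(\<Prod>e\<in>Basis. (b - a) \<bullet> e) = (\<Prod>i\<in>UNIV. h $ i)"
    unfolding Basis
    by (subst prod.reindex)
       (auto simp: inj_on_def axis_eq_axis a_def b_def inner_axis algebra_simps)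
  then have meas: "emeasure lborel (box a b) = ennreal (\<Prod>i\<in>UNIV. h $ i)"
    "emeasure lborel (cbox a b) = ennreal (\<Prod>i\<in>UNIV. h $ i)"
    using le by auto
  have "box a b \<subseteq> lattice_floor h -` {z}" "lattice_floor h -` {z} \<subseteq> cbox a b"
    unfolding subset_iff vimage_singleton_eq lattice_floor_eq_iff[OF h]
    by (auto simp: less_imp_le mem_box_cart a_def b_def)
  moreover have "lattice_floor h -` {z} \<in> sets lborel"
    using measurable_sets[OF lattice_floor_measurable, of "{z}" h] by simp
  ultimately show ?thesis
    using meas emeasure_mono[of "box a b" "lattice_floor h -` {z}" lborel]
      emeasure_mono[of "lattice_floor h -` {z}" "cbox a b" lborel] by simp
qed

lemma measure_lattice_floor_vimage:
  assumes h: "\<And>i. 0 < h $ i" and "finite S"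
  shows "lattice_floor h -` S \<in> sets borel"
    "emeasure lborel (lattice_floor h -` S) = ennreal (real (card S) * (\<Prod>i\<in>UNIV. h $ i))"
proof -
  have S: "lattice_floor h -` S = (\<Union>z\<in>S. lattice_floor h -` {z})" by auto
  have sets: "lattice_floor h -` {z} \<in> sets lborel" for z :: "int^'a"
    using measurable_sets[OF lattice_floor_measurable, of "{z}" h] by simp
  show "lattice_floor h -` S \<in> sets borel"
    using measurable_sets[OF lattice_floor_measurable, of S h] by simp
  have "emeasure lborel (lattice_floor h -` S) = (\<Sum>z\<in>S. emeasure lborel (lattice_floor h -` {z}))"
    unfolding S using \<open>finite S\<close> sets
    by (subst sum_emeasure) (auto simp: disjoint_family_on_def)
  also have "\<dots> = ennreal (real (card S) * (\<Prod>i\<in>UNIV. h $ i))"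
    by (simp add: emeasure_lattice_floor_vimage[OF h] ennreal_mult prod_nonneg less_imp_le[OF h] ennreal_of_nat_eq_real_of_nat)
  finally show "emeasure lborel (lattice_floor h -` S) = \<dots>" .
qed

text \<open>Passing from lattice sets to the union of their cells turns the rescaled cardinality into an
  integral, to which dominated convergence applies.\<close>

lemma card_lattice_tendsto_measure_aux:
  fixes h :: "nat \<Rightarrow> real ^ 'd"
  assumes h: "\<And>n i. 0 < h n $ i" "\<And>n i. h n $ i \<le> 1"
    and S: "\<And>n z i. z \<in> S n \<Longrightarrow> \<bar>h n $ i * of_int (z $ i)\<bar> \<le> r"
    and A: "A \<in> sets borel"
    and lim: "AE y in lborel. \<forall>\<^sub>F n in sequentially. lattice_floor (h n) y \<in> S n \<longleftrightarrow> y \<in> A"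
  shows "finite (S n)"
    "(\<lambda>n. (\<Prod>i\<in>UNIV. h n $ i) * real (card (S n))) \<longlonglongrightarrow> measure lborel A"
proof -
  show fin: "finite (S n)" for n
  proof (rule finite_subset)
    show "S n \<subseteq> {(\<chi> i. - \<lceil>r / h n $ i\<rceil>)..(\<chi> i. \<lceil>r / h n $ i\<rceil>)}"
    proof
      fix z assume "z \<in> S n"
      have "- \<lceil>r / h n $ i\<rceil> \<le> z $ i \<and> z $ i \<le> \<lceil>r / h n $ i\<rceil>" for i
      proof -
        have "\<bar>of_int (z $ i)\<bar> \<le> r / h n $ i"
          using S[OF \<open>z \<in> S n\<close>, of i] h(1)[of n i] by (simp add: abs_mult field_simps)
        then have "\<bar>z $ i\<bar> \<le> \<lceil>r / h n $ i\<rceil>" by linarith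
        then show ?thesis by linarith
      qed
      then show "z \<in> {(\<chi> i. - \<lceil>r / h n $ i\<rceil>)..(\<chi> i. \<lceil>r / h n $ i\<rceil>)}"
        by (simp add: less_eq_vec_def)
    qed
  qed (rule finite_int_vec_interval)
  define U where "U n = lattice_floor (h n) -` S n" for n
  \<comment> \<open>Dominating cube: corners of the selected cells have coordinates at most r in
    modulus and sides are at most 1, so the cells stay within r + 1.\<close>
  define Q :: "(real ^ 'd) set" where "Q = cbox (\<chi> i. - (r + 1)) (\<chi> i. r + 1)"
  have U: "U n \<in> sets borel"
    "emeasure lborel (U n) = ennreal (real (card (S n)) * (\<Prod>i\<in>UNIV. h n $ i))" for n
    using measure_lattice_floor_vimage[OF h(1) fin] by (auto simp: U_def)
  have UQ: "U n \<subseteq> Q" for n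
  proof
    fix y assume "y \<in> U n"
    then have "lattice_floor (h n) y \<in> S n" by (simp add: U_def)
    have "\<bar>y $ i\<bar> \<le> r + 1" for i
      using S[OF \<open>lattice_floor (h n) y \<in> S n\<close>, of i] h(2)[of n i]
        lattice_floor_eq_iff[OF h(1), of n y "lattice_floor (h n) y"]
      by (auto simp: distrib_left dest!: spec[of _ i])
    then have "- (r + 1) \<le> y $ i \<and> y $ i \<le> r + 1" for i
      by (metis abs_le_D1 abs_le_D2 minus_le_iff)
    then show "y \<in> Q" by (auto simp: Q_def mem_box_cart)
  qed
  have meas: "measure lborel (U n) = (\<Prod>i\<in>UNIV. h n $ i) * real (card (S n))" for n
    using U(2)[of n] h(1)
    by (simp add: measure_def mult.commute prod_nonneg less_imp_le)
  have "(\<lambda>n. \<integral>y. indicator (U n) y \<partial>lborel) \<longlonglongrightarrow> (\<integral>y. (indicator A y :: real) \<partial>lborel)"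
  proof (rule integral_dominated_convergence[where w = "indicator Q"])
    show "indicator A \<in> borel_measurable lborel" using A by simp
    show "indicator (U n) \<in> borel_measurable lborel" for n using U(1)[of n] by simp
    show "integrable lborel (indicator Q :: _ \<Rightarrow> real)"
      using emeasure_lborel_cbox_finite by (auto simp: Q_def integrable_indicator_iff)
    show "AE y in lborel. (\<lambda>n. indicator (U n) y) \<longlonglongrightarrow> (indicator A y :: real)"
      using lim
    proof eventually_elim
      case (elim y)
      then have "\<forall>\<^sub>F n in sequentially. indicator (U n) y = (indicator A y :: real)"
        by eventually_elim (auto simp: U_def indicator_def)
      then show ?case by (rule tendsto_eventually)
    qed
    show "AE y in lborel. norm (indicator (U n) y :: real) \<le> indicator Q y" for n
      using UQ[of n] by (auto simp: indicator_def)
  qed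
  then show "(\<lambda>n. (\<Prod>i\<in>UNIV. h n $ i) * real (card (S n))) \<longlonglongrightarrow> measure lborel A"
    by (simp add: meas)
qed

text \<open>The sides may be zero for small n, so the previous lemma is applied to the sequences
  shifted by \<open>n0\<close>.\<close>

lemma card_lattice_tendsto_measure:
  fixes h :: "nat \<Rightarrow> real ^ 'd"
  assumes h: "\<forall>\<^sub>F n in sequentially. \<forall>i. 0 < h n $ i \<and> h n $ i \<le> 1"
    and S: "\<And>n z i. z \<in> S n \<Longrightarrow> \<bar>h n $ i * of_int (z $ i)\<bar> \<le> r"
    and A: "A \<in> sets borel"
    and lim: "AE y in lborel. \<forall>\<^sub>F n in sequentially. lattice_floor (h n) y \<in> S n \<longleftrightarrow> y \<in> A"
  shows "\<forall>\<^sub>F n in sequentially. finite (S n)"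
    "(\<lambda>n. (\<Prod>i\<in>UNIV. h n $ i) * real (card (S n))) \<longlonglongrightarrow> measure lborel A"
proof -
  obtain n0 where n0: "\<And>n i. n0 \<le> n \<Longrightarrow> 0 < h n $ i \<and> h n $ i \<le> 1"
    using h by (auto simp: eventually_sequentially)
  have "AE y in lborel. \<forall>\<^sub>F n in sequentially. lattice_floor (h (n + n0)) y \<in> S (n + n0) \<longleftrightarrow> y \<in> A"
    using lim by eventually_elim (rule eventually_sequentially_seg[THEN iffD2])
  note * = card_lattice_tendsto_measure_aux[of "\<lambda>n. h (n + n0)" "\<lambda>n. S (n + n0)" r, OF _ _ S A this]
  show "(\<lambda>n. (\<Prod>i\<in>UNIV. h n $ i) * real (card (S n))) \<longlonglongrightarrow> measure lborel A"
    by (rule LIMSEQ_offset[where k = n0], rule *(2)) (use n0 in auto)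
  have "finite (S (n + n0))" for n by (rule *(1)) (use n0 in auto)
  then show "\<forall>\<^sub>F n in sequentially. finite (S n)"
    by (subst eventually_sequentially_seg[symmetric, where k = n0]) simp
qed

lemma lattice_floor_dist:
  assumes "\<And>i. 0 < h $ i" "lattice_floor h y = lattice_floor h y'"
  shows "dist y y' \<le> (\<Sum>i\<in>UNIV. h $ i)"
proof -
  have "\<bar>(y - y') $ i\<bar> \<le> h $ i" for i
    using lattice_floor_eq_iff[OF assms(1), of y "lattice_floor h y'"]
      lattice_floor_eq_iff[OF assms(1), of y' "lattice_floor h y'"] assms(2)
    by (auto simp: distrib_left abs_le_iff dest!: spec[of _ i])
  then have "(\<Sum>i\<in>UNIV. \<bar>(y - y') $ i\<bar>) \<le> (\<Sum>i\<in>UNIV. h $ i)"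
    by (intro sum_mono)
  then show ?thesis
    using norm_le_l1_cart[of "y - y'"] by (simp add: dist_norm)
qed

lemma lattice_floor_of_int_vec:
  assumes "\<And>i. 0 < h $ i"
  shows "lattice_floor h (h * of_int_vec z) = z"
  using assms by (simp add: lattice_floor_eq_iff of_int_vec_def distrib_left)

text \<open>\<open>negligible\<close> refers to the completed measure; a frontier is closed, hence
  Borel, so it is also null for \<open>lborel\<close>.\<close>

lemma AE_not_in_frontier:
  fixes A :: "'a::euclidean_space set"
  assumes "negligible (frontier A)"
  shows "AE y in lborel. y \<notin> frontier A"
proof -
  have "frontier A \<in> null_sets lborel"
    using assms by (simp add: negligible_iff_null_sets null_sets_completion_iff)
  then show ?thesis by (rule AE_not_in)
qed

section \<open>Counting the cells of a shrinking grid\<close>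

context
  fixes h :: "nat \<Rightarrow> real ^ 'd"
  assumes h_pos: "\<forall>\<^sub>F n in sequentially. \<forall>i. 0 < h n $ i"
    and h_lim: "\<And>i. (\<lambda>n. h n $ i) \<longlonglongrightarrow> 0"
begin

lemma cells_eventually_small:
  assumes "0 < e"
  shows "\<forall>\<^sub>F n in sequentially. \<forall>y y'. lattice_floor (h n) y = lattice_floor (h n) y' \<longrightarrow> dist y y' < e"
proof -
  have "(\<lambda>n. \<Sum>i\<in>UNIV. h n $ i) \<longlonglongrightarrow> (\<Sum>i\<in>(UNIV::'d set). 0)"
    by (intro tendsto_sum h_lim)
  then have "\<forall>\<^sub>F n in sequentially. (\<Sum>i\<in>UNIV. h n $ i) < e"
    using \<open>0 < e\<close> by (auto dest: order_tendstoD(2))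
  then show ?thesis
    using h_pos by eventually_elim (use lattice_floor_dist le_less_trans in blast)
qed

text \<open>Applied with U the interior of A or the complement of its closure: off the frontier, the
  cell of a point ends up on one side of A.\<close>

lemma cells_eventually_inside:
  assumes "open U" "y \<in> U"
  shows "\<forall>\<^sub>F n in sequentially. \<forall>y'. lattice_floor (h n) y' = lattice_floor (h n) y \<longrightarrow> y' \<in> U"
proof -
  obtain e where e: "0 < e" "\<And>y'. dist y' y < e \<Longrightarrow> y' \<in> U"
    using assms open_dist by metis
  show ?thesis
    using cells_eventually_small[OF \<open>0 < e\<close>] by eventually_elim (use e in blast)
qed

lemma h_eventually_unit: "\<forall>\<^sub>F n in sequentially. \<forall>i. 0 < h n $ i \<and> h n $ i \<le> 1"
proof -
  have "\<forall>\<^sub>F n in sequentially. \<forall>i. h n $ i < 1"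
    by (intro eventually_all_finite order_tendstoD(2)[OF h_lim]) auto
  then show ?thesis using h_pos by eventually_elim (simp add: less_imp_le)
qed

context
  fixes A :: "(real ^ 'd) set"
  assumes A_bounded: "bounded A" and A_Jordan: "negligible (frontier A)"
begin

lemma scaled_index_bound:
  "\<exists>r. \<forall>n z i. h n * of_int_vec z \<in> A \<longrightarrow> \<bar>h n $ i * of_int (z $ i)\<bar> \<le> r"
proof -
  obtain r where r: "\<And>y. y \<in> A \<Longrightarrow> norm y \<le> r"
    using A_bounded by (auto simp: bounded_iff)
  have "\<bar>h n $ i * of_int (z $ i)\<bar> \<le> r" if "h n * of_int_vec z \<in> A" for n z i
    using component_le_norm_cart[of "h n * of_int_vec z" i] r[OF that] by (simp add: of_int_vec_def)
  then show ?thesis by blast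
qed

text \<open>A cell is selected by its lower corner, as in \<open>Q_minus\<close>. For y off the
  frontier, the corner of the cell of y is eventually on the same side of A as y, which is the
  almost everywhere convergence required.\<close>

lemma card_lattice_in_Jordan_set:
  assumes "A \<in> sets borel"
  shows "\<forall>\<^sub>F n in sequentially. finite {z. h n * of_int_vec z \<in> A}"
    "(\<lambda>n. (\<Prod>i\<in>UNIV. h n $ i) * real (card {z. h n * of_int_vec z \<in> A})) \<longlonglongrightarrow> measure lborel A"
proof -
  obtain r where r: "\<And>n z i. h n * of_int_vec z \<in> A \<Longrightarrow> \<bar>h n $ i * of_int (z $ i)\<bar> \<le> r"
    using scaled_index_bound by blast
  have "AE y in lborel. \<forall>\<^sub>F n in sequentially.
      lattice_floor (h n) y \<in> {z. h n * of_int_vec z \<in> A} \<longleftrightarrow> y \<in> A"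
    using AE_not_in_frontier[OF A_Jordan]
  proof eventually_elim
    case (elim y)
    show ?case
    proof (cases "y \<in> A")
      case True
      then have "y \<in> interior A" using elim closure_subset by (auto simp: frontier_def)
      from cells_eventually_inside[OF open_interior this] h_pos show ?thesis
      proof eventually_elim
        case (elim n)
        then have "h n * of_int_vec (lattice_floor (h n) y) \<in> interior A"
          by (simp add: lattice_floor_of_int_vec)
        then show ?case using True interior_subset by auto
      qed
    next
      case False
      then have "y \<in> - closure A" using elim interior_subset by (auto simp: frontier_def)
      from cells_eventually_inside[OF open_Compl[OF closed_closure] this] h_pos show ?thesis
      proof eventually_elim
        case (elim n)
        then have "h n * of_int_vec (lattice_floor (h n) y) \<notin> closure A"
          by (simp add: lattice_floor_of_int_vec)
        then show ?case using False closure_subset by auto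
      qed
    qed
  qed
  from card_lattice_tendsto_measure[OF h_eventually_unit _ assms this, of r] r
  show "\<forall>\<^sub>F n in sequentially. finite {z. h n * of_int_vec z \<in> A}"
    "(\<lambda>n. (\<Prod>i\<in>UNIV. h n $ i) * real (card {z. h n * of_int_vec z \<in> A})) \<longlonglongrightarrow> measure lborel A"
    by auto
qed

text \<open>The same convergence with the empty set as limit: a point off the null frontier
  eventually lies in no cell that meets both A and its complement.\<close>

lemma card_boundary_cells:
  "(\<lambda>n. (\<Prod>i\<in>UNIV. h n $ i) * real (card {z. h n * of_int_vec z \<in> A \<and>
      (\<exists>y. lattice_floor (h n) y = z \<and> y \<notin> A)})) \<longlonglongrightarrow> 0"
proof -
  let ?S = "\<lambda>n. {z. h n * of_int_vec z \<in> A \<and> (\<exists>y. lattice_floor (h n) y = z \<and> y \<notin> A)}"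
  obtain r where r: "\<And>n z i. h n * of_int_vec z \<in> A \<Longrightarrow> \<bar>h n $ i * of_int (z $ i)\<bar> \<le> r"
    using scaled_index_bound by blast
  have "AE y in lborel. \<forall>\<^sub>F n in sequentially. lattice_floor (h n) y \<in> ?S n \<longleftrightarrow> y \<in> {}"
    using AE_not_in_frontier[OF A_Jordan]
  proof eventually_elim
    case (elim y)
    then consider "y \<in> interior A" | "y \<in> - closure A" by (auto simp: frontier_def)
    then show ?case
    proof cases
      case 1
      from cells_eventually_inside[OF open_interior this] show ?thesis
        by eventually_elim (use interior_subset in auto)
    next
      case 2
      from cells_eventually_inside[OF open_Compl[OF closed_closure] this] h_pos show ?thesis
      proof eventually_elim
        case (elim n)
        then have "h n * of_int_vec (lattice_floor (h n) y) \<notin> closure A"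
          by (simp add: lattice_floor_of_int_vec)
        then show ?case using closure_subset by auto
      qed
    qed
  qed
  from card_lattice_tendsto_measure(2)[OF h_eventually_unit _ _ this, of r] r
  show ?thesis by auto
qed

end

end

lemma finite_lattice_floor_image:
  assumes "bounded C" "\<And>i. 0 < h $ i"
  shows "finite (lattice_floor h ` C)"
proof -
  obtain r where r: "\<And>y. y \<in> C \<Longrightarrow> norm y \<le> r"
    using assms by (auto simp: bounded_iff)
  have "lattice_floor h ` C \<subseteq> {(\<chi> i. \<lfloor>- r / h $ i\<rfloor>)..(\<chi> i. \<lfloor>r / h $ i\<rfloor>)}"
  proof
    fix z assume "z \<in> lattice_floor h ` C"
    then obtain y where y: "y \<in> C" "z = lattice_floor h y" by auto
    have "- r \<le> y $ i \<and> y $ i \<le> r" for i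
      using r[OF y(1)] component_le_norm_cart[of y i] by linarith
    then have "- r / h $ i \<le> y $ i / h $ i \<and> y $ i / h $ i \<le> r / h $ i" for i
      by (intro conjI divide_right_mono less_imp_le[OF assms(2)]) auto
    then show "z \<in> {(\<chi> i. \<lfloor>- r / h $ i\<rfloor>)..(\<chi> i. \<lfloor>r / h $ i\<rfloor>)}"
      by (auto simp: less_eq_vec_def y lattice_floor_def intro!: floor_mono)
  qed
  then show ?thesis using finite_int_vec_interval finite_subset by blast
qed

text \<open>A cell is an intersection of half-spaces, so its frontier is null by convexity. This
  makes the counting results applicable to the part of C in finitely many cells.\<close>

lemma Jordan_Int_cells:
  assumes "negligible (frontier C)" "\<And>i. 0 < h $ i" "finite S"
  shows "negligible (frontier (C \<inter> lattice_floor h -` S))"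
proof -
  have "convex (lattice_floor h -` {z})" for z
  proof -
    have "lattice_floor h -` {z} = (\<Inter>i. {y. h $ i * of_int (z $ i) \<le> y $ i} \<inter> {y. y $ i < h $ i * (of_int (z $ i) + 1)})"
      by (auto simp: vimage_singleton_eq lattice_floor_eq_iff[OF assms(2)] set_eq_iff)
    also have "convex \<dots>"
    proof (intro convex_INT convex_Int)
      fix i and a :: real
      have "{y::real^'a. a \<le> y $ i} = {y. inner (axis i 1) y \<ge> a}"
        "{y::real^'a. y $ i < a} = {y. inner (axis i 1) y < a}"
        by (auto simp: inner_axis')
      then show "convex {y::real^'a. a \<le> y $ i}" "convex {y::real^'a. y $ i < a}"
        by (simp_all add: convex_halfspace_ge convex_halfspace_lt)
    qed
    finally show ?thesis .
  qed
  then have "negligible (\<Union>z\<in>S. frontier (lattice_floor h -` {z}))"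
    using \<open>finite S\<close> by (intro negligible_Union) (auto intro: negligible_convex_frontier)
  moreover have "frontier (\<Union>z\<in>S. lattice_floor h -` {z}) \<subseteq> (\<Union>z\<in>S. frontier (lattice_floor h -` {z}))"
    using frontier_Union_subset[of "(\<lambda>z. lattice_floor h -` {z}) ` S"] \<open>finite S\<close> by auto
  moreover have "lattice_floor h -` S = (\<Union>z\<in>S. lattice_floor h -` {z})" by auto
  ultimately have "negligible (frontier (lattice_floor h -` S))"
    using negligible_subset by metis
  then have "negligible (frontier C \<union> frontier (lattice_floor h -` S))"
    using assms(1) by (rule negligible_Un[rotated])
  then show ?thesis
    using frontier_Int_subset negligible_subset by metis
qed

text \<open>The two consequences of p-convexity on which the later arguments rest; convex sets have
  null frontier.\<close>

lemma p_convex_Jordan: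
  assumes "p_convex p C"
  shows "compact C" "negligible (frontier C)"
proof -
  obtain K where K: "\<And>i. i < p \<Longrightarrow> convex_body (K i)" "C = (\<Union>i<p. K i)"
    using assms by (auto simp: p_convex_def)
  then show "compact C" by (auto simp: convex_body_def)
  have "negligible (\<Union>i<p. frontier (K i))"
    using K(1) by (intro negligible_Union) (auto simp: convex_body_def intro: negligible_convex_frontier)
  moreover have "frontier C \<subseteq> (\<Union>i<p. frontier (K i))"
    using frontier_Union_subset[of "K ` {..<p}"] by (auto simp: K(2))
  ultimately show "negligible (frontier C)" using negligible_subset by metis
qed

lemma fine_cells_exist:
  fixes f :: "real ^ 'd \<Rightarrow> real"
  assumes "compact C" "continuous_on C f" "0 < \<epsilon>"
  obtains g :: "real ^ 'd" where "\<And>i. 0 < g $ i" "(\<Prod>i\<in>UNIV. g $ i) \<le> \<epsilon>"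
    "\<And>y y'. y \<in> C \<Longrightarrow> y' \<in> C \<Longrightarrow> lattice_floor g y = lattice_floor g y' \<Longrightarrow> \<bar>f y - f y'\<bar> \<le> \<epsilon>"
proof -
  obtain \<delta> where \<delta>: "0 < \<delta>" "\<And>y y'. y \<in> C \<Longrightarrow> y' \<in> C \<Longrightarrow> dist y' y < \<delta> \<Longrightarrow> dist (f y') (f y) < \<epsilon>"
    using compact_uniformly_continuous[OF assms(2,1)] \<open>0 < \<epsilon>\<close>
    unfolding uniformly_continuous_on_def by metis
  \<comment> \<open>The bound 1 gives s^d \<le> s, so that \<epsilon> bounds the cell volume; the
    third bound keeps the sum d s of the sides, which dominates the diameter, below
    \<delta>.\<close>
  define s where "s = Min {1, \<epsilon>, \<delta> / (2 * CARD('d))}"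
  define g :: "real ^ 'd" where "g = (\<chi> i. s)"
  have s: "0 < s" "s \<le> 1" "s \<le> \<epsilon>" "s \<le> \<delta> / (2 * CARD('d))"
    using \<delta>(1) \<open>0 < \<epsilon>\<close> by (auto simp: s_def)
  have "s ^ CARD('d) \<le> s ^ 1"
    using s by (intro power_decreasing) (auto simp: Suc_le_eq)
  then have "(\<Prod>i\<in>UNIV. g $ i) \<le> \<epsilon>" using s by (simp add: g_def)
  moreover have "(\<Sum>i\<in>UNIV. g $ i) < \<delta>"
    using s(4) \<delta>(1) by (simp add: g_def field_simps)
  then have "\<bar>f y - f y'\<bar> \<le> \<epsilon>"
    if "y \<in> C" "y' \<in> C" "lattice_floor g y = lattice_floor g y'" for y y'
    using \<delta>(2)[of y' y] lattice_floor_dist[of g y y'] that s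
    by (auto simp: g_def dist_real_def)
  ultimately show thesis using s that[of g] by (simp add: g_def)
qed

subsection \<open>Exceedances in lattice blocks\<close>

definition lattice_block :: "int ^ 'd \<Rightarrow> int ^ 'd \<Rightarrow> (int ^ 'd) set" where
  "lattice_block T z = {T * z..T * z + T - 1}"

text \<open>The strip is removed at the upper faces only; this already leaves a gap between any two
  blocks.\<close>

definition shrunk_block :: "int ^ 'd \<Rightarrow> int ^ 'd \<Rightarrow> int ^ 'd \<Rightarrow> (int ^ 'd) set" where
  "shrunk_block T g z = {T * z..T * z + T - 1 - g}"

lemma in_lattice_block_iff:
  "v \<in> lattice_block T z \<longleftrightarrow> (\<forall>i. T $ i * z $ i \<le> v $ i \<and> v $ i < T $ i * z $ i + T $ i)"
  by (auto simp: lattice_block_def less_eq_vec_def)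

lemma in_lattice_block_iff_div:
  assumes "\<And>i. 0 < T $ i"
  shows "v \<in> lattice_block T z \<longleftrightarrow> z = (\<chi> i. v $ i div T $ i)"
proof -
  have "T $ i * z $ i \<le> v $ i \<and> v $ i < T $ i * z $ i + T $ i \<longleftrightarrow> z $ i = v $ i div T $ i" for i
  proof
    assume *: "T $ i * z $ i \<le> v $ i \<and> v $ i < T $ i * z $ i + T $ i"
    then have "v $ i div T $ i = (v $ i - T $ i * z $ i + T $ i * z $ i) div T $ i" by simp
    also have "\<dots> = z $ i + (v $ i - T $ i * z $ i) div T $ i"
      using assms[of i] by (subst div_mult_self2) auto
    also have "\<dots> = z $ i" using * by (simp add: div_pos_pos_trivial)
    finally show "z $ i = v $ i div T $ i" by simp
  next
    assume z: "z $ i = v $ i div T $ i"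
    then show "T $ i * z $ i \<le> v $ i \<and> v $ i < T $ i * z $ i + T $ i"
      unfolding z
      using pos_mod_bound[OF assms, of "v $ i" i] pos_mod_sign[OF assms, of "v $ i" i]
        mult_div_mod_eq[of "T $ i" "v $ i"]
      by linarith
  qed
  then show ?thesis by (simp add: in_lattice_block_iff vec_eq_iff)
qed

lemma finite_lattice_block: "finite (lattice_block T z)"
  and finite_shrunk_block: "finite (shrunk_block T g z)"
  by (simp_all add: lattice_block_def shrunk_block_def finite_int_vec_interval)

lemma card_lattice_block:
  assumes "\<And>i. 0 < T $ i"
  shows "real (card (lattice_block T z)) = (\<Prod>i\<in>UNIV. real_of_int (T $ i))"
  using assms by (simp add: lattice_block_def card_int_vec_interval less_imp_le)

lemma card_shrunk_block:
  assumes "\<And>i. g $ i \<le> T $ i"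
  shows "real (card (shrunk_block T g z)) = (\<Prod>i\<in>UNIV. real_of_int (T $ i - g $ i))"
  using assms by (simp add: shrunk_block_def card_int_vec_interval algebra_simps)

lemma translate_int_vec_interval: "(+) h ` {a..b::int^'d} = {h + a..h + b}"
proof -
  have "v \<in> (+) h ` {a..b}" if "v \<in> {h + a..h + b}" for v
  proof (rule image_eqI)
    show "v = h + (v - h)" by simp
    have "a $ i \<le> (v - h) $ i \<and> (v - h) $ i \<le> b $ i" for i
      using that by (auto simp: less_eq_vec_def dest!: spec[of _ i])
    then show "v - h \<in> {a..b}" by (simp add: less_eq_vec_def)
  qed
  then show ?thesis
    by (auto simp: less_eq_vec_def)
qed

lemma lattice_block_translate: "lattice_block T z = (+) (T * z) ` lattice_block T 0"
  and shrunk_block_translate: "shrunk_block T g z = (+) (T * z) ` shrunk_block T g 0"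
  unfolding lattice_block_def shrunk_block_def translate_int_vec_interval
  by (simp_all add: algebra_simps)

lemma shrunk_block_subset:
  assumes "\<And>i. 0 \<le> g $ i"
  shows "shrunk_block T g z \<subseteq> lattice_block T z"
proof
  fix v assume v: "v \<in> shrunk_block T g z"
  have "T $ i * z $ i \<le> v $ i \<and> v $ i < T $ i * z $ i + T $ i" for i
    using v assms[of i] by (auto simp: shrunk_block_def less_eq_vec_def dest!: spec[of _ i])
  then show "v \<in> lattice_block T z" by (simp add: in_lattice_block_iff)
qed

text \<open>The ellipsoid \<gamma>B(1) lies in the box with half-sides |\<gamma>_i|, so a large
  difference in a single coordinate is enough.\<close>

lemma separatedI:
  assumes "\<And>a b. a \<in> A \<Longrightarrow> b \<in> B \<Longrightarrow> \<exists>i. \<bar>\<gamma> $ i\<bar> < of_int \<bar>b $ i - a $ i\<bar>"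
  shows "separated \<gamma> A B"
  unfolding separated_def
proof safe
  fix b assume b: "b \<in> B" "of_int_vec b \<in> minkowski_sum (of_int_vec ` A) (scale_set \<gamma> (cball 0 1))"
  then obtain a u where a: "a \<in> A" "norm u \<le> 1" "of_int_vec b = of_int_vec a + \<gamma> * u"
    by (auto simp: minkowski_sum_def scale_set_def)
  obtain i where i: "\<bar>\<gamma> $ i\<bar> < of_int \<bar>b $ i - a $ i\<bar>"
    using assms a(1) b(1) by blast
  have "of_int (b $ i) = of_int (a $ i) + \<gamma> $ i * u $ i"
    using a(3) by (simp add: vec_eq_iff of_int_vec_def)
  then have "of_int \<bar>b $ i - a $ i\<bar> = \<bar>\<gamma> $ i\<bar> * \<bar>u $ i\<bar>"
    by (simp flip: abs_mult)
  also have "\<dots> \<le> \<bar>\<gamma> $ i\<bar> * 1"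
    using component_le_norm_cart[of u i] a(2) by (intro mult_left_mono) auto
  finally show False using i by simp
qed

text \<open>In a coordinate where the indices differ, the lower core ends at or below Tw + T - 1 - g
  and the upper one starts at or above Tw + T. The difference is at least g + 1, hence strictly
  larger than |\<gamma>|.\<close>

lemma shrunk_blocks_separated:
  assumes T: "\<And>i. 0 < T $ i" and g: "\<And>i. \<bar>\<gamma> $ i\<bar> \<le> of_int (g $ i)"
    and z: "z \<notin> S"
  shows "separated \<gamma> (shrunk_block T g z) (\<Union>z'\<in>S. shrunk_block T g z')"
proof (rule separatedI)
  fix a b assume a: "a \<in> shrunk_block T g z" and "b \<in> (\<Union>z'\<in>S. shrunk_block T g z')"
  then obtain z' where z': "z' \<in> S" and b: "b \<in> shrunk_block T g z'" by auto
  have far: "T $ i * w + T $ i \<le> T $ i * w'" if "w < w'" for i w w'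
    using mult_left_mono[of "w + 1" w' "T $ i"] that T[of i] by (simp add: algebra_simps)
  have "z \<noteq> z'" using z z' by auto
  then obtain i where i: "z $ i \<noteq> z' $ i" by (auto simp: vec_eq_iff)
  have "g $ i < \<bar>b $ i - a $ i\<bar>"
    using i far[of "z $ i" "z' $ i" i] far[of "z' $ i" "z $ i" i] a b
    by (auto simp: shrunk_block_def less_eq_vec_def neq_iff dest!: spec[of _ i])
  then have "\<bar>\<gamma> $ i\<bar> < of_int \<bar>b $ i - a $ i\<bar>"
    using g[of i] by linarith
  then show "\<exists>i. \<bar>\<gamma> $ i\<bar> < of_int \<bar>b $ i - a $ i\<bar>" ..
qed

lemma linear_order_finite_max:
  assumes "linear_order R" "finite A" "A \<noteq> {}"
  shows "\<exists>m\<in>A. \<forall>w\<in>A. (w, m) \<in> R"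
  using assms(2,3)
proof (induction rule: finite_ne_induct)
  case (singleton v)
  then show ?case
    using assms(1) by (auto simp: order_on_defs refl_on_def)
next
  case (insert v A)
  then obtain m where m: "m \<in> A" "\<forall>w\<in>A. (w, m) \<in> R" by auto
  have refl: "(v, v) \<in> R" and "trans R"
    using assms(1) by (auto simp: order_on_defs refl_on_def)
  have "(v, m) \<in> R \<or> (m, v) \<in> R"
    using assms(1) refl by (cases "v = m") (auto simp: order_on_defs total_on_def)
  then show ?case
  proof
    assume "(v, m) \<in> R"
    then show ?thesis using m by (intro bexI[of _ m]) auto
  next
    assume "(m, v) \<in> R"
    then have "(w, v) \<in> R" if "w \<in> A" for w
      using m(2) that \<open>trans R\<close> by (blast dest: transD)
    then show ?thesis using refl by (intro bexI[of _ v]) auto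
  qed
qed

section \<open>Exceedance events of a stationary field at a fixed level\<close>

locale random_field = prob_space M for M :: "'w measure" +
  fixes \<xi> :: "int ^ 'd \<Rightarrow> 'w \<Rightarrow> real" and x :: real
  assumes stationary: "stationary_field M \<xi>"
begin

text \<open>Complement of the event that the maximum over A is at most x; in this form unions of
  index sets become unions of events.\<close>

definition hit :: "(int ^ 'd) set \<Rightarrow> 'w set" where
  "hit A = {\<omega> \<in> space M. \<exists>v\<in>A. x < \<xi> v \<omega>}"

lemma \<xi>_measurable [measurable]: "\<xi> v \<in> borel_measurable M"
  using stationary by (simp add: stationary_field_def)

lemma hit_sets [measurable, simp]: "hit A \<in> events"
proof -
  have "hit A = (\<Union>v\<in>A. {\<omega> \<in> space M. x < \<xi> v \<omega>})" by (auto simp: hit_def)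
  also have "\<dots> \<in> events" by (intro sets.countable_UN') auto
  finally show ?thesis .
qed

lemma hit_mono: "A \<subseteq> B \<Longrightarrow> hit A \<subseteq> hit B"
  by (auto simp: hit_def)

lemma hit_Un: "hit (A \<union> B) = hit A \<union> hit B"
  by (auto simp: hit_def)

lemma hit_UN: "hit (\<Union>z\<in>S. A z) = (\<Union>z\<in>S. hit (A z))"
  by (auto simp: hit_def)

text \<open>Stationarity is an equality of laws on the product space, so the event is written as the
  preimage of a set \<open>B\<close> of configurations, measurable as a countable union of
  coordinate events.\<close>

lemma prob_hit_translate: "prob (hit ((+) h ` A)) = prob (hit A)"
proof -
  let ?P = "\<Pi>\<^sub>M v\<in>(UNIV :: (int ^ 'd) set). (borel :: real measure)"
  define B where "B = {y \<in> space ?P. \<exists>v\<in>A. x < y v}"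
  have "B = (\<Union>v\<in>A. {y \<in> space ?P. x < y v})" by (auto simp: B_def)
  also have "\<dots> \<in> sets ?P" by (intro sets.countable_UN') auto
  finally have B: "B \<in> sets ?P" .
  have meas: "(\<lambda>\<omega> v. \<xi> (v + k) \<omega>) \<in> M \<rightarrow>\<^sub>M ?P" for k
    by (intro measurable_PiM_single') (auto simp: space_PiM)
  have eq: "measure (distr M ?P (\<lambda>\<omega> v. \<xi> (v + k) \<omega>)) B = prob (hit ((+) k ` A))" for k
  proof -
    have "(\<lambda>\<omega> v. \<xi> (v + k) \<omega>) -` B \<inter> space M = hit ((+) k ` A)"
      by (auto simp: B_def hit_def space_PiM add.commute)
    then show ?thesis by (simp add: measure_distr[OF meas B])
  qed
  have "distr M ?P (\<lambda>\<omega> v. \<xi> (v + h) \<omega>) = distr M ?P (\<lambda>\<omega> v. \<xi> (v + 0) \<omega>)"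
    using stationary by (simp add: stationary_field_def)
  then have "prob (hit ((+) h ` A)) = prob (hit ((+) 0 ` A))"
    using eq[of h] eq[of 0] by simp
  then show ?thesis by simp
qed

lemma prob_hit_Diff: "prob (hit A - hit B) = prob (hit (A \<union> B)) - prob (hit B)"
proof -
  have "hit (A \<union> B) = (hit A - hit B) \<union> hit B" by (auto simp: hit_Un)
  also have "prob \<dots> = prob (hit A - hit B) + prob (hit B)"
    by (intro finite_measure_Union) auto
  finally show ?thesis by simp
qed

lemma prob_hit_le_card:
  assumes "finite A"
  shows "prob (hit A) \<le> real (card A) * prob (hit {0})"
proof -
  have singleton: "prob (hit {v}) = prob (hit {0})" for v
    using prob_hit_translate[of v "{0}"] by simp
  have "hit A = (\<Union>v\<in>A. hit {v})" by (auto simp: hit_def)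
  then have "prob (hit A) \<le> (\<Sum>v\<in>A. prob (hit {v}))"
    using assms by (simp add: finite_measure_subadditive_finite image_subset_iff)
  also have "\<dots> = (\<Sum>v\<in>A. prob (hit {0}))" by (intro sum.cong refl singleton)
  finally show ?thesis by simp
qed

lemma prob_no_exceedance: "\<P>(\<omega> in M. field_max \<xi> A \<omega> \<le> ereal x) = 1 - prob (hit A)"
proof -
  have "{\<omega> \<in> space M. field_max \<xi> A \<omega> \<le> ereal x} = space M - hit A"
    by (auto simp: field_max_def hit_def SUP_le_iff not_less)
  then show ?thesis by (simp add: prob_compl)
qed

text \<open>Two events and their complements have the same covariance, so the mixing condition
  carries over to hits.\<close>

lemma prob_cov_no_exceedance:
  "\<P>(\<omega> in M. field_max \<xi> (A \<union> B) \<omega> \<le> ereal x)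
    - \<P>(\<omega> in M. field_max \<xi> A \<omega> \<le> ereal x) * \<P>(\<omega> in M. field_max \<xi> B \<omega> \<le> ereal x)
   = prob (hit A \<inter> hit B) - prob (hit A) * prob (hit B)"
proof -
  have "prob (hit A \<union> hit B) = prob (hit A) + prob (hit B) - prob (hit A \<inter> hit B)"
    by (rule measure_Un3) (simp_all add: fmeasurable_eq_sets)
  then show ?thesis
    by (simp add: prob_no_exceedance hit_Un algebra_simps)
qed

end

text \<open>The set A_v of the local condition in integer coordinates; see
  \<open>later_block_eq\<close>.\<close>

definition later_points :: "(int ^ 'd) rel \<Rightarrow> int ^ 'd \<Rightarrow> int ^ 'd \<Rightarrow> (int ^ 'd) set" where
  "later_points R T v = {w. (\<forall>i. \<bar>w $ i - v $ i\<bar> \<le> T $ i) \<and> (v, w) \<in> R \<and> v \<noteq> w}"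

section \<open>Mixing estimates for blocks at a fixed level\<close>

locale mixing_blocks = random_field M \<xi> x
  for M :: "'w measure" and \<xi> :: "int ^ 'd \<Rightarrow> 'w \<Rightarrow> real" and x +
  fixes K :: "(int ^ 'd) set" and \<gamma> :: "real ^ 'd" and \<alpha> :: real and T g :: "int ^ 'd"
  assumes mixing: "\<And>A B. A \<subseteq> K \<Longrightarrow> B \<subseteq> K \<Longrightarrow> separated \<gamma> A B \<Longrightarrow> \<exists>a b. A = {a..b} \<Longrightarrow>
      \<bar>prob (hit A \<inter> hit B) - prob (hit A) * prob (hit B)\<bar> \<le> \<alpha>"
    and T_pos: "\<And>i. 0 < T $ i"
    and g_\<gamma>: "\<And>i. \<bar>\<gamma> $ i\<bar> \<le> of_int (g $ i)"
begin

abbreviation "block \<equiv> lattice_block T"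
abbreviation "core \<equiv> shrunk_block T g"

definition "q = prob (hit (block 0))"
text \<open>Union bound over the lattice points of the strip that is cut off a block.\<close>

definition "gap_err = (real (card (block 0)) - real (card (core 0))) * prob (hit {0})"
text \<open>Price for two blocks both being hit: q^2 as if independent, \<alpha> for the mixing
  error, and one \<open>gap_err\<close> for each of the two strips.\<close>

definition "pair_err = q\<^sup>2 + \<alpha> + 2 * gap_err"

lemma prob_block: "prob (hit (block z)) = q"
  using prob_hit_translate[of "T * z" "block 0"] by (simp add: q_def flip: lattice_block_translate)

lemma prob_core: "prob (hit (core z)) = prob (hit (core 0))"
  using prob_hit_translate[of "T * z" "core 0"] by (simp flip: shrunk_block_translate)

lemma g_nonneg: "0 \<le> g $ i"
  using g_\<gamma>[of i] by linarith

lemma core_subset: "core z \<subseteq> block z"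
  by (rule shrunk_block_subset) (rule g_nonneg)

text \<open>The empty set is the box \<open>{1..0}\<close>, so mixing applies with A = B =
  {}.\<close>

lemma \<alpha>_nonneg: "0 \<le> \<alpha>"
proof -
  have "{1..0 :: int ^ 'd} = {}" by (auto simp: less_eq_vec_def intro: order_trans)
  then have "\<exists>a b. {} = {a..b :: int ^ 'd}" by metis
  then have "\<bar>prob (hit {} \<inter> hit {}) - prob (hit {}) * prob (hit {})\<bar> \<le> \<alpha>"
    by (intro mixing) (auto simp: separated_def)
  then show ?thesis by linarith
qed

lemma gap_err_nonneg: "0 \<le> gap_err"
  using card_mono[OF finite_lattice_block core_subset, of 0] by (simp add: gap_err_def)

lemma pair_err_nonneg: "0 \<le> pair_err"
  using \<alpha>_nonneg gap_err_nonneg by (simp add: pair_err_def)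

lemma prob_block_Diff_core: "prob (hit (block z) - hit (core z)) \<le> gap_err"
proof -
  have "card (block z) = card (block 0)" "card (core z) = card (core 0)"
    using lattice_block_translate[of T z] shrunk_block_translate[of T g z]
    by (simp_all add: card_image)
  then have "real (card (block z - core z)) = real (card (block 0)) - real (card (core 0))"
    using core_subset[of z] card_mono[OF finite_lattice_block core_subset, of 0]
    by (simp add: card_Diff_subset finite_shrunk_block of_nat_diff)
  moreover have "prob (hit (block z) - hit (core z)) \<le> prob (hit (block z - core z))"
    by (intro finite_measure_mono) (auto simp: hit_def)
  ultimately show ?thesis
    using prob_hit_le_card[of "block z - core z"] by (simp add: gap_err_def finite_lattice_block)
qed

lemma prob_core_bounds: "prob (hit (core z)) \<le> q" "q \<le> prob (hit (core z)) + gap_err"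
proof -
  show "prob (hit (core z)) \<le> q"
    unfolding prob_block[of z, symmetric] by (intro finite_measure_mono hit_mono core_subset) auto
  have "q \<le> prob (hit (core z) \<union> (hit (block z) - hit (core z)))"
    unfolding prob_block[of z, symmetric] by (intro finite_measure_mono) auto
  also have "\<dots> \<le> prob (hit (core z)) + prob (hit (block z) - hit (core z))"
    by (intro measure_Un_le) auto
  finally show "q \<le> prob (hit (core z)) + gap_err"
    using prob_block_Diff_core[of z] by simp
qed

text \<open>A single core plays the box; the other set may be any union of cores, which is what
  peeling off blocks one by one requires.\<close>

lemma core_mixing:
  assumes "z \<notin> S" "block z \<subseteq> K" "\<And>z'. z' \<in> S \<Longrightarrow> block z' \<subseteq> K"
  shows "\<bar>prob (hit (core z) \<inter> hit (\<Union>z'\<in>S. core z')) - prob (hit (core z)) * prob (hit (\<Union>z'\<in>S. core z'))\<bar> \<le> \<alpha>"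
proof (rule mixing)
  show "core z \<subseteq> K" "(\<Union>z'\<in>S. core z') \<subseteq> K"
    using assms(2,3) core_subset by blast+
  show "separated \<gamma> (core z) (\<Union>z'\<in>S. core z')"
    by (intro shrunk_blocks_separated T_pos g_\<gamma> assms(1))
  show "\<exists>a b. core z = {a..b}" by (auto simp: shrunk_block_def)
qed

text \<open>Adjacent blocks are not separated. Either both cores are hit, where mixing applies, or
  one of the strips is hit.\<close>

lemma prob_two_blocks:
  assumes "z \<noteq> z'" "block z \<subseteq> K" "block z' \<subseteq> K"
  shows "prob (hit (block z) \<inter> hit (block z')) \<le> pair_err"
proof -
  have "prob (hit (block z) \<inter> hit (block z'))
      \<le> prob ((hit (core z) \<inter> hit (core z')) \<union> (hit (block z) - hit (core z)) \<union> (hit (block z') - hit (core z')))"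
    by (intro finite_measure_mono) auto
  also have "\<dots> \<le> prob (hit (core z) \<inter> hit (core z')) + prob (hit (block z) - hit (core z))
      + prob (hit (block z') - hit (core z'))"
    by (intro order_trans[OF measure_Un_le] add_right_mono measure_Un_le) auto
  also have "prob (hit (core z) \<inter> hit (core z')) \<le> prob (hit (core z)) * prob (hit (core z')) + \<alpha>"
    using core_mixing[of z "{z'}"] assms by (simp add: abs_le_iff)
  also have "prob (hit (core z)) * prob (hit (core z')) \<le> q * q"
    by (intro mult_mono prob_core_bounds) (auto simp: q_def)
  finally show ?thesis
    using prob_block_Diff_core[of z] prob_block_Diff_core[of z'] by (simp add: pair_err_def power2_eq_square)
qed

text \<open>Peeling off one core costs \<alpha>; the error accumulated before is multiplied by 1 - r
  \<le> 1, so errors only add up.\<close>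

lemma prob_no_hit_cores:
  assumes "finite S" "\<And>z. z \<in> S \<Longrightarrow> block z \<subseteq> K"
  shows "\<bar>(1 - prob (hit (\<Union>z\<in>S. core z))) - (1 - prob (hit (core 0))) ^ card S\<bar> \<le> real (card S) * \<alpha>"
  using assms
proof (induction S rule: finite_induct)
  case empty
  then show ?case by (simp add: hit_def)
next
  case (insert z S)
  define r u u' i where "r = prob (hit (core 0))" and "u = prob (hit (\<Union>z\<in>S. core z))"
    and "u' = prob (hit (\<Union>z\<in>insert z S. core z))"
    and "i = prob (hit (core z) \<inter> hit (\<Union>z'\<in>S. core z'))"
  have "u' = prob (hit (core z)) + u - i"
    unfolding u'_def u_def i_def UN_insert hit_Un by (rule measure_Un3) (simp_all add: fmeasurable_eq_sets)
  moreover have "\<bar>i - r * u\<bar> \<le> \<alpha>"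
    using core_mixing[of z S] insert by (simp add: i_def r_def u_def prob_core[of z])
  ultimately have 1: "\<bar>(1 - u') - (1 - r) * (1 - u)\<bar> \<le> \<alpha>"
    by (simp add: r_def prob_core[of z] algebra_simps abs_minus_commute)
  have "\<bar>(1 - r) * (1 - u) - (1 - r) * (1 - r) ^ card S\<bar> = (1 - r) * \<bar>(1 - u) - (1 - r) ^ card S\<bar>"
    by (simp add: abs_mult r_def flip: right_diff_distrib)
  also have "\<dots> \<le> 1 * (real (card S) * \<alpha>)"
    using insert by (intro mult_mono) (auto simp: r_def u_def)
  finally have "\<bar>(1 - u') - (1 - r) * (1 - r) ^ card S\<bar> \<le> \<alpha> + real (card S) * \<alpha>"
    using 1 by linarith
  then show ?case
    using insert by (simp add: r_def u'_def algebra_simps)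
qed

lemma power_diff_le:
  fixes a b :: real
  assumes "0 \<le> a" "a \<le> 1" "0 \<le> b" "b \<le> 1"
  shows "\<bar>a ^ n - b ^ n\<bar> \<le> real n * \<bar>a - b\<bar>"
  using norm_power_diff[of a b n] assms by simp

text \<open>One \<open>gap_err\<close> per block pays for passing from blocks to cores in the union,
  the other for replacing the hitting probability of a core by q in the power.\<close>

lemma prob_no_hit_blocks:
  assumes "finite S" "\<And>z. z \<in> S \<Longrightarrow> block z \<subseteq> K"
  shows "\<bar>(1 - prob (hit (\<Union>z\<in>S. block z))) - (1 - q) ^ card S\<bar> \<le> real (card S) * (\<alpha> + 2 * gap_err)"
proof -
  have "prob (hit (\<Union>z\<in>S. block z)) \<le> prob (hit (\<Union>z\<in>S. core z) \<union> (\<Union>z\<in>S. hit (block z) - hit (core z)))"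
    using \<open>finite S\<close> by (intro finite_measure_mono) (auto simp: hit_UN)
  also have "\<dots> \<le> prob (hit (\<Union>z\<in>S. core z)) + prob (\<Union>z\<in>S. hit (block z) - hit (core z))"
    using \<open>finite S\<close> by (intro measure_Un_le) auto
  also have "prob (\<Union>z\<in>S. hit (block z) - hit (core z)) \<le> (\<Sum>z\<in>S. prob (hit (block z) - hit (core z)))"
    using \<open>finite S\<close> by (intro finite_measure_subadditive_finite) auto
  also have "\<dots> \<le> (\<Sum>z\<in>S. gap_err)"
    by (intro sum_mono prob_block_Diff_core)
  finally have 1: "prob (hit (\<Union>z\<in>S. block z)) \<le> prob (hit (\<Union>z\<in>S. core z)) + real (card S) * gap_err"
    by simp
  have 2: "prob (hit (\<Union>z\<in>S. core z)) \<le> prob (hit (\<Union>z\<in>S. block z))"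
    using core_subset by (intro finite_measure_mono hit_mono) auto
  have "\<bar>(1 - prob (hit (core 0))) ^ card S - (1 - q) ^ card S\<bar>
      \<le> real (card S) * \<bar>(1 - prob (hit (core 0))) - (1 - q)\<bar>"
    by (rule power_diff_le) (auto simp: q_def)
  also have "\<dots> \<le> real (card S) * gap_err"
    using prob_core_bounds[of 0] by (intro mult_left_mono) auto
  finally show ?thesis
    using prob_no_hit_cores[OF assms] 1 2 by (simp add: algebra_simps)
qed

section \<open>Hitting probability of one block through its last exceedance\<close>

context
  fixes R :: "(int ^ 'd) rel" and z0 :: "int ^ 'd"
  assumes R: "translation_invariant_total_order R"
    and z0: "\<And>e. (\<forall>i. \<bar>e $ i\<bar> \<le> 1) \<Longrightarrow> block (z0 + e) \<subseteq> K"
begin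

definition "last_hit v = hit {v} - hit {w \<in> block z0. (v, w) \<in> R \<and> v \<noteq> w}"

text \<open>Totality of the order makes the events disjoint; a finite non-empty set of exceedances
  has a last element, so they cover.\<close>

lemma last_hit_partition:
  "disjoint_family_on last_hit (block z0)" "hit (block z0) = (\<Union>v\<in>block z0. last_hit v)"
proof -
  have lin: "linear_order R" using R by (simp add: translation_invariant_total_order_def)
  show "disjoint_family_on last_hit (block z0)"
    unfolding disjoint_family_on_def
  proof (intro ballI impI)
    fix v w assume vw: "v \<in> block z0" "w \<in> block z0" "v \<noteq> w"
    then have "(v, w) \<in> R \<or> (w, v) \<in> R" using lin by (auto simp: order_on_defs total_on_def)
    then show "last_hit v \<inter> last_hit w = {}" using vw by (auto simp: last_hit_def hit_def)
  qed
  show "hit (block z0) = (\<Union>v\<in>block z0. last_hit v)"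
  proof
    show "hit (block z0) \<subseteq> (\<Union>v\<in>block z0. last_hit v)"
    proof
      fix \<omega> assume \<omega>: "\<omega> \<in> hit (block z0)"
      have "finite {v \<in> block z0. x < \<xi> v \<omega>}" "{v \<in> block z0. x < \<xi> v \<omega>} \<noteq> {}"
        using \<omega> by (auto simp: hit_def finite_lattice_block)
      from linear_order_finite_max[OF lin this] obtain m where
        m: "m \<in> block z0" "x < \<xi> m \<omega>" "\<And>w. w \<in> block z0 \<Longrightarrow> x < \<xi> w \<omega> \<Longrightarrow> (w, m) \<in> R" by auto
      have "antisym R" using lin by (simp add: order_on_defs)
      then have "\<omega> \<in> last_hit m"
        using m \<omega> by (auto simp: last_hit_def hit_def dest: antisymD)
      then show "\<omega> \<in> (\<Union>v\<in>block z0. last_hit v)" using m(1) by blast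
    qed
  qed (auto simp: last_hit_def hit_def)
qed

lemma last_hit_sets [simp]: "last_hit v \<in> events"
  by (simp add: last_hit_def)

lemma q_eq_sum_last_hit: "q = (\<Sum>v\<in>block z0. prob (last_hit v))"
  using last_hit_partition prob_block[of z0]
  by (subst finite_measure_finite_Union[symmetric]) (auto simp: finite_lattice_block)

lemma later_points_translate: "later_points R T v = (+) v ` later_points R T 0"
proof -
  have tr: "(u, w) \<in> R \<Longrightarrow> (u + h, w + h) \<in> R" for u w h
    using R by (auto simp: translation_invariant_total_order_def)
  have R_iff: "(v, w) \<in> R \<longleftrightarrow> (0, w - v) \<in> R" for w
    using tr[of v w "- v"] tr[of 0 "w - v" v] by auto
  have "w \<in> later_points R T v \<longleftrightarrow> w - v \<in> later_points R T 0" for w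
    by (auto simp: later_points_def R_iff)
  moreover have "w \<in> (+) v ` later_points R T 0 \<longleftrightarrow> w - v \<in> later_points R T 0" for w
    by (auto simp: image_iff intro!: bexI[of _ "w - v"])
  ultimately show ?thesis by blast
qed

text \<open>By \<open>prob_hit_Diff\<close> the probability is a difference of two hitting
  probabilities, and each of them is translation invariant.\<close>

lemma prob_isolated: "prob (hit {v} - hit (later_points R T v)) = prob (hit {0} - hit (later_points R T 0))"
proof -
  have "{v} \<union> later_points R T v = (+) v ` ({0} \<union> later_points R T 0)"
    using later_points_translate[of v] by auto
  then show ?thesis
    using prob_hit_translate[of v "{0} \<union> later_points R T 0"]
      prob_hit_translate[of v "later_points R T 0"]
    by (simp add: prob_hit_Diff flip: later_points_translate)
qed

definition "neighbours = {-1..1} - {0 :: int ^ 'd}"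

lemma neighbours: "finite neighbours" "card neighbours \<le> 3 ^ CARD('d)"
proof -
  show "finite neighbours" by (simp add: neighbours_def finite_int_vec_interval)
  have "card neighbours \<le> card {-1..1 :: int ^ 'd}"
    unfolding neighbours_def by (intro card_mono) (auto simp: finite_int_vec_interval)
  then show "card neighbours \<le> 3 ^ CARD('d)" by (simp add: card_int_vec_interval)
qed

text \<open>Points within T of a point of the block \<open>z0\<close> lie in blocks whose index
  differs from \<open>z0\<close> by at most 1 in each coordinate.\<close>

lemma later_points_subset:
  assumes "v \<in> block z0"
  shows "later_points R T v \<subseteq> {w \<in> block z0. (v, w) \<in> R \<and> v \<noteq> w} \<union> (\<Union>e\<in>neighbours. block (z0 + e))"
proof
  fix w assume w: "w \<in> later_points R T v"
  define z where "z = (\<chi> i. w $ i div T $ i)"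
  have wz: "w \<in> block z" by (simp add: in_lattice_block_iff_div T_pos z_def)
  have "\<bar>z $ i - z0 $ i\<bar> \<le> 1" for i
  proof -
    have w': "\<bar>w $ i - v $ i\<bar> \<le> T $ i" using w by (simp add: later_points_def)
    have z: "T $ i * z $ i \<le> w $ i" "w $ i < T $ i * z $ i + T $ i"
      "T $ i * z0 $ i \<le> v $ i" "v $ i < T $ i * z0 $ i + T $ i"
      using wz assms by (auto simp: in_lattice_block_iff)
    have "T $ i * (z $ i - z0 $ i) < T $ i * 2" "T $ i * (z0 $ i - z $ i) < T $ i * 2"
      using w' z by (simp_all add: algebra_simps)
    then have "z $ i - z0 $ i < 2" "z0 $ i - z $ i < 2"
      using T_pos[of i] by (simp_all only: mult_less_cancel_left_pos)
    then show ?thesis by simp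
  qed
  then have "- 1 \<le> z $ i - z0 $ i \<and> z $ i - z0 $ i \<le> 1" for i
    by (metis abs_le_D1 abs_le_D2 minus_le_iff)
  then have "z - z0 \<in> {-1..1}" by (simp add: less_eq_vec_def)
  then consider "z = z0" | "z - z0 \<in> neighbours" by (auto simp: neighbours_def)
  then show "w \<in> {w \<in> block z0. (v, w) \<in> R \<and> v \<noteq> w} \<union> (\<Union>e\<in>neighbours. block (z0 + e))"
  proof cases
    case 1
    then show ?thesis using w wz by (auto simp: later_points_def)
  next
    case 2
    then show ?thesis using wz by (intro UnI2 UN_I[of "z - z0"]) auto
  qed
qed

text \<open>The box of half-sides T around v covers the block of v, so an isolated exceedance at v
  is the last one of its block. Conversely, if a last exceedance is not isolated, one of the at most
  3^d neighbouring blocks is hit as well.\<close>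

lemma q_bounds:
  defines "s \<equiv> prob (hit {0} - hit (later_points R T 0))"
  shows "real (card (block 0)) * s \<le> q" "q \<le> real (card (block 0)) * s + 3 ^ CARD('d) * pair_err"
proof -
  define N where "N = hit (\<Union>e\<in>neighbours. block (z0 + e))"
  have [simp]: "N \<in> events" by (simp add: N_def)
  have card: "card (block 0) = card (block z0)"
    using lattice_block_translate[of T z0] by (simp add: card_image)
  have sum_s: "real (card (block 0)) * s = (\<Sum>v\<in>block z0. prob (hit {v} - hit (later_points R T v)))"
    unfolding s_def card by (subst sum.cong[OF refl prob_isolated]) simp
  have "prob (hit {v} - hit (later_points R T v)) \<le> prob (last_hit v)" if "v \<in> block z0" for v
  proof (intro finite_measure_mono)
    have "{w \<in> block z0. (v, w) \<in> R \<and> v \<noteq> w} \<subseteq> later_points R T v"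
    proof clarify
      fix w assume w: "w \<in> block z0" "(v, w) \<in> R" "v \<noteq> w"
      have "\<bar>w $ i - v $ i\<bar> \<le> T $ i" for i
        using w(1) that by (auto simp: in_lattice_block_iff dest!: spec[of _ i])
      then show "w \<in> later_points R T v" using w by (simp add: later_points_def)
    qed
    then show "hit {v} - hit (later_points R T v) \<subseteq> last_hit v"
      using hit_mono unfolding last_hit_def by blast
  qed simp
  then show "real (card (block 0)) * s \<le> q"
    unfolding sum_s q_eq_sum_last_hit by (intro sum_mono)
  have "prob (last_hit v) \<le> prob (hit {v} - hit (later_points R T v)) + prob (last_hit v \<inter> N)"
    if "v \<in> block z0" for v
  proof -
    have "hit (later_points R T v) \<subseteq> hit {w \<in> block z0. (v, w) \<in> R \<and> v \<noteq> w} \<union> N"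
      using hit_mono[OF later_points_subset[OF that]] by (simp add: hit_Un N_def)
    then have "last_hit v \<subseteq> (hit {v} - hit (later_points R T v)) \<union> (last_hit v \<inter> N)"
      by (auto simp: last_hit_def)
    then have "prob (last_hit v) \<le> prob ((hit {v} - hit (later_points R T v)) \<union> (last_hit v \<inter> N))"
      by (intro finite_measure_mono sets.Un sets.Diff sets.Int) simp_all
    also have "\<dots> \<le> prob (hit {v} - hit (later_points R T v)) + prob (last_hit v \<inter> N)"
      by (intro measure_Un_le sets.Diff sets.Int) simp_all
    finally show ?thesis .
  qed
  then have "q \<le> (\<Sum>v\<in>block z0. prob (hit {v} - hit (later_points R T v)) + prob (last_hit v \<inter> N))"
    unfolding q_eq_sum_last_hit by (intro sum_mono)
  also have "\<dots> = real (card (block 0)) * s + (\<Sum>v\<in>block z0. prob (last_hit v \<inter> N))"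
    by (simp add: sum.distrib sum_s)
  \<comment> \<open>Since the events \<open>last_hit v\<close> are disjoint, the error is paid once
    per neighbouring block and not once per lattice point.\<close>
  also have "(\<Sum>v\<in>block z0. prob (last_hit v \<inter> N)) = prob (\<Union>v\<in>block z0. last_hit v \<inter> N)"
    using last_hit_partition(1)
    by (subst finite_measure_finite_Union) (auto simp: finite_lattice_block disjoint_family_on_def)
  also have "(\<Union>v\<in>block z0. last_hit v \<inter> N) = (\<Union>e\<in>neighbours. hit (block z0) \<inter> hit (block (z0 + e)))"
    unfolding N_def hit_UN last_hit_partition(2) by auto
  also have "prob \<dots> \<le> (\<Sum>e\<in>neighbours. prob (hit (block z0) \<inter> hit (block (z0 + e))))"
    by (intro finite_measure_subadditive_finite) (auto simp: neighbours)
  also have "\<dots> \<le> (\<Sum>e\<in>neighbours. pair_err)"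
  proof (intro sum_mono prob_two_blocks)
    fix e assume e: "e \<in> neighbours"
    then have "\<bar>e $ i\<bar> \<le> 1" for i
      by (auto simp: neighbours_def less_eq_vec_def abs_le_iff minus_le_iff)
    then show "block (z0 + e) \<subseteq> K" using z0 by simp
    show "z0 \<noteq> z0 + e" using e by (simp add: neighbours_def)
    show "block z0 \<subseteq> K" using z0[of 0] by simp
  qed
  also have "\<dots> \<le> 3 ^ CARD('d) * pair_err"
    using neighbours(2) pair_err_nonneg by (simp add: mult_right_mono flip: of_nat_le_iff)
  finally show "q \<le> real (card (block 0)) * s + 3 ^ CARD('d) * pair_err" by simp
qed

end

end

subsection \<open>Characteristic functions and void probabilities\<close>

lemma cmod_iexp_diff_le: "cmod (iexp a - iexp b) \<le> \<bar>a - b\<bar>" "cmod (iexp a - iexp b) \<le> 2"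
proof -
  have "iexp a - iexp b = iexp b * (iexp (a - b) - 1)"
    by (simp add: algebra_simps flip: exp_add)
  then have "cmod (iexp a - iexp b) = cmod (iexp (a - b) - 1)"
    by (simp add: norm_mult)
  also have "\<dots> \<le> \<bar>a - b\<bar>" using iexp_approx1[of "a - b" 0] by simp
  finally show "cmod (iexp a - iexp b) \<le> \<bar>a - b\<bar>" .
  show "cmod (iexp a - iexp b) \<le> 2"
    using norm_triangle_ineq4[of "iexp a" "iexp b"] by simp
qed

text \<open>Coefficient of the indicator that all cells in J are void, after multiplying out over I.
  It depends only on the weights, so the cluster process and the Poisson measure share it.\<close>

definition occupancy_coeff :: "'i set \<Rightarrow> ('i \<Rightarrow> real) \<Rightarrow> real \<Rightarrow> 'i set \<Rightarrow> complex" where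
  "occupancy_coeff I b s J = (\<Prod>i\<in>J. 1 - iexp (s * b i)) * (\<Prod>i\<in>I - J. iexp (s * b i))"

context prob_space
begin

lemma integrable_bounded_measurable:
  fixes f :: "'a \<Rightarrow> 'b::{banach,second_countable_topology}"
  assumes "f \<in> borel_measurable M" "\<And>\<omega>. norm (f \<omega>) \<le> B"
  shows "integrable M f"
  by (rule integrable_const_bound[where B = B]) (use assms in auto)

text \<open>With \<open>V\<close> the indicator of the complement of \<open>Z\<close>, the identity
  \<open>exp (\<i> s b V) = exp (\<i> s b) + (1 - exp (\<i> s b)) 1\<^sub>Z\<close> gives, after multiplying out over \<open>i\<close>,
  the characteristic function in terms of intersections of the \<open>Z i\<close> only.\<close>

lemma char_fn_indicator_sum:
  assumes "finite I" and Z: "\<And>i. i \<in> I \<Longrightarrow> Z i \<in> events"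
  shows "(CLINT \<omega>|M. iexp (s * (\<Sum>i\<in>I. b i * indicator (space M - Z i) \<omega>)))
    = (\<Sum>J\<in>Pow I. occupancy_coeff I b s J * prob (space M \<inter> (\<Inter>i\<in>J. Z i)))"
proof -
  have "iexp (s * (\<Sum>i\<in>I. b i * indicator (space M - Z i) \<omega>))
      = (\<Sum>J\<in>Pow I. occupancy_coeff I b s J * indicator (space M \<inter> (\<Inter>i\<in>J. Z i)) \<omega>)"
    if "\<omega> \<in> space M" for \<omega>
  proof -
    have "iexp (s * (\<Sum>i\<in>I. b i * indicator (space M - Z i) \<omega>))
        = (\<Prod>i\<in>I. iexp (s * (b i * indicator (space M - Z i) \<omega>)))"
      by (simp only: sum_distrib_left of_real_sum exp_sum[OF \<open>finite I\<close>])
    also have "\<dots> = (\<Prod>i\<in>I. (1 - iexp (s * b i)) * indicator (Z i) \<omega> + iexp (s * b i))"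
      using that by (intro prod.cong) (auto simp: indicator_def)
    also have "\<dots> = (\<Sum>J\<in>Pow I. (\<Prod>i\<in>J. (1 - iexp (s * b i)) * indicator (Z i) \<omega>) * (\<Prod>i\<in>I - J. iexp (s * b i)))"
      using \<open>finite I\<close> by (rule prod_add)
    also have "\<dots> = (\<Sum>J\<in>Pow I. occupancy_coeff I b s J * indicator (space M \<inter> (\<Inter>i\<in>J. Z i)) \<omega>)"
    proof (intro sum.cong refl)
      fix J assume "J \<in> Pow I"
      then have "finite J" using \<open>finite I\<close> finite_subset by auto
      then have "(\<Prod>i\<in>J. indicator (Z i) \<omega> :: complex) = indicator (space M \<inter> (\<Inter>i\<in>J. Z i)) \<omega>"
        using that by (auto simp: indicator_def)
      then show "(\<Prod>i\<in>J. (1 - iexp (s * b i)) * indicator (Z i) \<omega>) * (\<Prod>i\<in>I - J. iexp (s * b i))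
          = occupancy_coeff I b s J * indicator (space M \<inter> (\<Inter>i\<in>J. Z i)) \<omega>"
        by (simp add: occupancy_coeff_def prod.distrib)
    qed
    finally show ?thesis .
  qed
  then have "(CLINT \<omega>|M. iexp (s * (\<Sum>i\<in>I. b i * indicator (space M - Z i) \<omega>)))
      = (CLINT \<omega>|M. (\<Sum>J\<in>Pow I. occupancy_coeff I b s J * indicator (space M \<inter> (\<Inter>i\<in>J. Z i)) \<omega>))"
    by (intro Bochner_Integration.integral_cong) auto
  also have "\<dots> = (\<Sum>J\<in>Pow I. occupancy_coeff I b s J * prob (space M \<inter> (\<Inter>i\<in>J. Z i)))"
  proof -
    \<comment> \<open>The factor \<open>space M\<close> matters for empty J, where the bare
      intersection would be \<open>UNIV\<close>.\<close>
    have J: "space M \<inter> (\<Inter>i\<in>J. Z i) \<in> events" if "J \<in> Pow I" for J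
    proof (cases "J = {}")
      case False
      then show ?thesis using that Z \<open>finite I\<close> finite_subset
        by (intro sets.Int sets.finite_INT) auto
    qed simp
    have "integrable M (\<lambda>\<omega>. indicator (space M \<inter> (\<Inter>i\<in>J. Z i)) \<omega> :: complex)" if "J \<in> Pow I" for J
      by (rule integrable_bounded_measurable[where B = 1, OF borel_measurable_indicator[OF J[OF that]]])
        (simp add: indicator_def)
    moreover have "(CLINT \<omega>|M. indicator (space M \<inter> (\<Inter>i\<in>J. Z i)) \<omega>) = complex_of_real (prob (space M \<inter> (\<Inter>i\<in>J. Z i)))"
      if "J \<in> Pow I" for J
    proof -
      have "(CLINT \<omega>|M. indicator (space M \<inter> (\<Inter>i\<in>J. Z i)) \<omega>)
          = (CLINT \<omega>|M. complex_of_real (indicator (space M \<inter> (\<Inter>i\<in>J. Z i)) \<omega>))"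
        by (intro Bochner_Integration.integral_cong) (auto simp: indicator_def)
      then show ?thesis using J[OF that] by simp
    qed
    ultimately show ?thesis by simp
  qed
  finally show ?thesis .
qed

text \<open>The integrands differ by at most 2 on the exceptional event E and by at most |s| |X - Y|
  elsewhere.\<close>

lemma char_fn_diff_le:
  assumes X: "X \<in> borel_measurable M" and Y: "Y \<in> borel_measurable M"
    and D: "integrable M D" "AE \<omega> in M. 0 \<le> D \<omega>" and E: "E \<in> events"
    and close: "AE \<omega> in M. \<omega> \<notin> E \<longrightarrow> \<bar>X \<omega> - Y \<omega>\<bar> \<le> D \<omega>"
  shows "cmod ((CLINT \<omega>|M. iexp (s * X \<omega>)) - (CLINT \<omega>|M. iexp (s * Y \<omega>)))
    \<le> 2 * prob E + \<bar>s\<bar> * expectation D"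
proof -
  have int: "integrable M (\<lambda>\<omega>. iexp (s * X \<omega>))" "integrable M (\<lambda>\<omega>. iexp (s * Y \<omega>))"
    by (rule integrable_bounded_measurable[where B = 1]; use X Y in simp)+
  have int': "integrable M (\<lambda>\<omega>. 2 * indicator E \<omega> + \<bar>s\<bar> * D \<omega>)"
    using D E by (intro Bochner_Integration.integrable_add integrable_mult_right) (auto simp: less_top[symmetric])
  have "cmod ((CLINT \<omega>|M. iexp (s * X \<omega>)) - (CLINT \<omega>|M. iexp (s * Y \<omega>)))
      = cmod (CLINT \<omega>|M. iexp (s * X \<omega>) - iexp (s * Y \<omega>))"
    using int by simp
  also have "\<dots> \<le> (\<integral>\<omega>. cmod (iexp (s * X \<omega>) - iexp (s * Y \<omega>)) \<partial>M)"
    by (rule integral_norm_bound)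
  also have "\<dots> \<le> (\<integral>\<omega>. 2 * indicator E \<omega> + \<bar>s\<bar> * D \<omega> \<partial>M)"
  proof (rule integral_mono_AE)
    show "integrable M (\<lambda>\<omega>. cmod (iexp (s * X \<omega>) - iexp (s * Y \<omega>)))"
      using int by (intro integrable_norm Bochner_Integration.integrable_diff)
    show "AE \<omega> in M. cmod (iexp (s * X \<omega>) - iexp (s * Y \<omega>)) \<le> 2 * indicator E \<omega> + \<bar>s\<bar> * D \<omega>"
      using close D(2)
    proof eventually_elim
      case (elim \<omega>)
      show ?case
      proof (cases "\<omega> \<in> E")
        case True
        have "0 \<le> \<bar>s\<bar> * D \<omega>" using elim by simp
        then show ?thesis
          using True cmod_iexp_diff_le(2)[of "s * X \<omega>" "s * Y \<omega>"] by simp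
      next
        case False
        have "\<bar>s * X \<omega> - s * Y \<omega>\<bar> = \<bar>s\<bar> * \<bar>X \<omega> - Y \<omega>\<bar>"
          by (simp add: abs_mult flip: right_diff_distrib)
        also have "\<dots> \<le> \<bar>s\<bar> * D \<omega>" using elim False by (intro mult_left_mono) auto
        finally show ?thesis
          using False cmod_iexp_diff_le(1)[of "s * X \<omega>" "s * Y \<omega>"] by simp
      qed
    qed
  qed (rule int')
  also have "\<dots> = 2 * prob E + \<bar>s\<bar> * expectation D"
    using D E by (subst Bochner_Integration.integral_add) (auto simp: less_top[symmetric])
  finally show ?thesis .
qed

text \<open>Renyi's observation in quantitative form: replacing a count \<open>K\<close> by the indicator of
  \<open>K \<noteq> 0\<close> costs \<open>E K - P(K \<noteq> 0)\<close>, and the joint law of the indicators is determined by the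
  void probabilities.\<close>

lemma char_fn_occupancy:
  fixes Kc :: "'i \<Rightarrow> 'a \<Rightarrow> real"
  assumes "finite I" and X: "X \<in> borel_measurable M" and E: "E \<in> events"
    and Kc: "\<And>i. i \<in> I \<Longrightarrow> integrable M (Kc i)"
    and Kc01: "\<And>i. i \<in> I \<Longrightarrow> AE \<omega> in M. Kc i \<omega> = 0 \<or> 1 \<le> Kc i \<omega>"
    and b: "\<And>i. i \<in> I \<Longrightarrow> \<bar>b i\<bar> \<le> B" and "0 \<le> \<epsilon>"
    and close: "AE \<omega> in M. \<omega> \<notin> E \<longrightarrow> \<bar>X \<omega> - (\<Sum>i\<in>I. b i * Kc i \<omega>)\<bar> \<le> \<epsilon> * (\<Sum>i\<in>I. Kc i \<omega>)"
  shows "cmod ((CLINT \<omega>|M. iexp (s * X \<omega>))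
      - (\<Sum>J\<in>Pow I. occupancy_coeff I b s J * \<P>(\<omega> in M. \<forall>i\<in>J. Kc i \<omega> = 0)))
    \<le> 2 * prob E + \<bar>s\<bar> * (\<epsilon> * (\<Sum>i\<in>I. expectation (Kc i))
        + B * (\<Sum>i\<in>I. expectation (Kc i) - 1 + \<P>(\<omega> in M. Kc i \<omega> = 0)))"
proof -
  define Z where "Z i = {\<omega> \<in> space M. Kc i \<omega> = 0}" for i
  have [measurable]: "Kc i \<in> borel_measurable M" if "i \<in> I" for i using Kc[OF that] by simp
  have Z: "Z i \<in> events" if "i \<in> I" for i
    using that unfolding Z_def by measurable
  define Y where "Y \<omega> = (\<Sum>i\<in>I. b i * indicator (space M - Z i) \<omega>)" for \<omega>
  \<comment> \<open>The first term pays for approximating X by weighted counts. The second pays for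
    replacing counts by indicators, because K - 1 + 1_Z = K - 1_{K \<noteq> 0}.\<close>
  define D where "D \<omega> = \<epsilon> * (\<Sum>i\<in>I. Kc i \<omega>) + B * (\<Sum>i\<in>I. Kc i \<omega> - 1 + indicator (Z i) \<omega>)" for \<omega>
  have AE_Kc: "AE \<omega> in M. \<omega> \<in> space M \<and> (\<forall>i\<in>I. Kc i \<omega> = 0 \<or> 1 \<le> Kc i \<omega>)"
  proof -
    have "AE \<omega> in M. \<forall>i\<in>I. Kc i \<omega> = 0 \<or> 1 \<le> Kc i \<omega>"
      by (rule AE_finite_allI[OF \<open>finite I\<close> Kc01])
    then show ?thesis using AE_space[of M] by eventually_elim auto
  qed
  have Z_int: "integrable M (\<lambda>\<omega>. indicator (Z i) \<omega> :: real)" if "i \<in> I" for i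
    using Z[OF that] by (simp add: less_top[symmetric])
  have bound: "\<bar>(\<Sum>i\<in>I. b i * Kc i \<omega>) - Y \<omega>\<bar> \<le> B * (\<Sum>i\<in>I. Kc i \<omega> - 1 + indicator (Z i) \<omega>)"
    "0 \<le> B * (\<Sum>i\<in>I. Kc i \<omega> - 1 + indicator (Z i) \<omega>)" "0 \<le> (\<Sum>i\<in>I. Kc i \<omega>)"
    if \<omega>: "\<omega> \<in> space M \<and> (\<forall>i\<in>I. Kc i \<omega> = 0 \<or> 1 \<le> Kc i \<omega>)" for \<omega>
  proof -
    have weighted: "\<bar>b i * Kc i \<omega> - b i * indicator (space M - Z i) \<omega>\<bar> \<le> B * (Kc i \<omega> - 1 + indicator (Z i) \<omega>)"
      if "i \<in> I" for i
    proof (cases "Kc i \<omega> = 0")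
      case True
      then show ?thesis using \<omega> by (simp add: Z_def indicator_def)
    next
      case False
      then have 1: "1 \<le> Kc i \<omega>" using \<omega> that by auto
      have "\<bar>b i * Kc i \<omega> - b i * 1\<bar> = \<bar>b i\<bar> * (Kc i \<omega> - 1)"
        unfolding right_diff_distrib[symmetric] abs_mult using 1 by simp
      also have "\<dots> \<le> B * (Kc i \<omega> - 1)" using b[OF that] 1 by (intro mult_right_mono) auto
      finally show ?thesis using False \<omega> by (simp add: Z_def indicator_def)
    qed
    have "\<bar>(\<Sum>i\<in>I. b i * Kc i \<omega>) - Y \<omega>\<bar> \<le> (\<Sum>i\<in>I. \<bar>b i * Kc i \<omega> - b i * indicator (space M - Z i) \<omega>\<bar>)"
      unfolding Y_def sum_subtractf[symmetric] by (rule sum_abs)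
    also have "\<dots> \<le> (\<Sum>i\<in>I. B * (Kc i \<omega> - 1 + indicator (Z i) \<omega>))"
      by (intro sum_mono weighted)
    finally show 1: "\<bar>(\<Sum>i\<in>I. b i * Kc i \<omega>) - Y \<omega>\<bar> \<le> B * (\<Sum>i\<in>I. Kc i \<omega> - 1 + indicator (Z i) \<omega>)"
      by (simp add: sum_distrib_left)
    then show "0 \<le> B * (\<Sum>i\<in>I. Kc i \<omega> - 1 + indicator (Z i) \<omega>)" by linarith
    show "0 \<le> (\<Sum>i\<in>I. Kc i \<omega>)" using \<omega> by (intro sum_nonneg) force
  qed
  have D_int: "integrable M D" unfolding D_def using Kc Z_int
    by (intro Bochner_Integration.integrable_add integrable_mult_right Bochner_Integration.integrable_sum
        Bochner_Integration.integrable_diff) auto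
  have D_nonneg: "AE \<omega> in M. 0 \<le> D \<omega>"
    using AE_Kc by eventually_elim (use bound \<open>0 \<le> \<epsilon>\<close> in \<open>auto simp: D_def\<close>)
  have "AE \<omega> in M. \<omega> \<notin> E \<longrightarrow> \<bar>X \<omega> - Y \<omega>\<bar> \<le> D \<omega>"
    using AE_Kc close by eventually_elim (use bound(1) in \<open>fastforce simp: D_def\<close>)
  moreover have "Y \<in> borel_measurable M" unfolding Y_def
    using Z by (intro borel_measurable_sum borel_measurable_times borel_measurable_indicator) auto
  ultimately have "cmod ((CLINT \<omega>|M. iexp (s * X \<omega>)) - (CLINT \<omega>|M. iexp (s * Y \<omega>)))
    \<le> 2 * prob E + \<bar>s\<bar> * expectation D"
    by (intro char_fn_diff_le X E D_int D_nonneg)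
  moreover have "expectation D = \<epsilon> * (\<Sum>i\<in>I. expectation (Kc i))
        + B * (\<Sum>i\<in>I. expectation (Kc i) - 1 + \<P>(\<omega> in M. Kc i \<omega> = 0))"
  proof -
    have "expectation (\<lambda>\<omega>. Kc i \<omega> - 1 + indicator (Z i) \<omega>) = expectation (Kc i) - 1 + prob (Z i)"
      if "i \<in> I" for i
      using Kc[OF that] Z_int[OF that] Z[OF that] prob_space by simp
    then show ?thesis
      unfolding D_def using Kc Z_int by (simp add: Z_def)
  qed
  moreover have "space M \<inter> (\<Inter>i\<in>J. Z i) = {\<omega> \<in> space M. \<forall>i\<in>J. Kc i \<omega> = 0}" for J
    by (auto simp: Z_def)
  then have "(CLINT \<omega>|M. iexp (s * Y \<omega>))
      = (\<Sum>J\<in>Pow I. occupancy_coeff I b s J * \<P>(\<omega> in M. \<forall>i\<in>J. Kc i \<omega> = 0))"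
    unfolding Y_def using char_fn_indicator_sum[OF \<open>finite I\<close> Z] by simp
  ultimately show ?thesis by simp
qed

end

subsection \<open>Poisson measures\<close>

lemma poisson_weights_sums: "(\<lambda>j. (\<mu>::real) ^ j / fact j * exp (- \<mu>)) sums 1"
proof -
  have "(\<lambda>j. \<mu> ^ j /\<^sub>R fact j * exp (- \<mu>)) sums (exp \<mu> * exp (- \<mu>))"
    by (intro sums_mult2 exp_converges)
  then show ?thesis by (simp add: exp_minus divide_inverse mult.commute)
qed

lemma poisson_mean_sums: "(\<lambda>j. real j * ((\<mu>::real) ^ j / fact j * exp (- \<mu>))) sums \<mu>"
proof -
  have "real (Suc j) * (\<mu> ^ Suc j / fact (Suc j) * exp (- \<mu>)) = \<mu> * (\<mu> ^ j / fact j * exp (- \<mu>))" for j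
    by (simp add: field_simps del: of_nat_Suc)
  then have "(\<lambda>j. real (Suc j) * (\<mu> ^ Suc j / fact (Suc j) * exp (- \<mu>))) sums (\<mu> * 1)"
    using sums_mult[OF poisson_weights_sums, of \<mu> \<mu>] by (simp only:)
  from sums_Suc[of "\<lambda>j. real j * (\<mu> ^ j / fact j * exp (- \<mu>))", OF this] show ?thesis by simp
qed

locale poisson_measure = prob_space M for M :: "'v measure" +
  fixes C :: "(real ^ 'd) set" and \<rho> :: real and N :: "'v \<Rightarrow> (real ^ 'd) measure"
  assumes poisson: "homogeneous_poisson_measure M C \<rho> N"
    and C_compact: "compact C" and \<rho>_nonneg: "0 \<le> \<rho>"
begin

lemma C_borel [measurable]: "C \<in> sets borel"
  using C_compact by (simp add: borel_compact)

lemma sets_N: "\<omega> \<in> space M \<Longrightarrow> sets (N \<omega>) = sets (restrict_space borel C)"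
  using poisson by (simp add: homogeneous_poisson_measure_def random_measure_on_def)

lemma space_N: "\<omega> \<in> space M \<Longrightarrow> space (N \<omega>) = C"
  using sets_eq_imp_space_eq[OF sets_N] by (simp add: space_restrict_space)

lemma sets_restrict_C: "A \<in> sets (restrict_space borel C) \<longleftrightarrow> A \<in> sets borel \<and> A \<subseteq> C"
  by (subst sets_restrict_space_iff) auto

lemma emeasure_N_measurable: "A \<in> sets borel \<Longrightarrow> A \<subseteq> C \<Longrightarrow> (\<lambda>\<omega>. emeasure (N \<omega>) A) \<in> borel_measurable M"
  using poisson by (simp add: homogeneous_poisson_measure_def random_measure_on_def)

lemma prob_N:
  assumes "A \<in> sets borel" "A \<subseteq> C"
  shows "\<P>(\<omega> in M. emeasure (N \<omega>) A = of_nat j)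
    = (\<rho> * measure lborel A) ^ j / fact j * exp (- (\<rho> * measure lborel A))"
  using poisson assms unfolding homogeneous_poisson_measure_def by blast

text \<open>The definition prescribes only the probabilities of the values 0, 1, 2, ...; they add up
  to 1, so almost surely the value is one of these.\<close>

lemma N_finite_count:
  assumes A: "A \<in> sets borel" "A \<subseteq> C"
  shows "AE \<omega> in M. \<exists>j. emeasure (N \<omega>) A = of_nat j"
proof -
  note [measurable] = emeasure_N_measurable[OF A]
  define E where "E j = {\<omega> \<in> space M. emeasure (N \<omega>) A = of_nat j}" for j
  have E: "range E \<subseteq> events" unfolding E_def by auto
  have "disjoint_family E" by (auto simp: disjoint_family_on_def E_def)
  then have "(\<lambda>j. prob (E j)) sums prob (\<Union>j. E j)"
    using E by (intro finite_measure_UNION)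
  moreover have "(\<lambda>j. prob (E j)) sums 1"
    using poisson_weights_sums prob_N[OF A] by (simp add: E_def)
  ultimately have "prob (\<Union>j. E j) = 1" by (rule sums_unique2)
  then have "AE \<omega> in M. \<omega> \<in> (\<Union>j. E j)" using E by (intro AE_prob_1) auto
  then show ?thesis by eventually_elim (auto simp: E_def)
qed

text \<open>Almost surely the count is the sum of j times the indicator of \<open>E j\<close>;
  integrating termwise gives the Poisson mean series.\<close>

lemma N_expectation:
  assumes A: "A \<in> sets borel" "A \<subseteq> C"
  shows "has_bochner_integral M (\<lambda>\<omega>. measure (N \<omega>) A) (\<rho> * measure lborel A)"
proof (rule has_bochner_integral_nn_integral)
  note [measurable] = emeasure_N_measurable[OF A]
  let ?\<mu> = "\<rho> * measure lborel A"
  define E where "E j = {\<omega> \<in> space M. emeasure (N \<omega>) A = of_nat j}" for j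
  have E [measurable]: "E j \<in> events" for j unfolding E_def by measurable
  show "(\<lambda>\<omega>. measure (N \<omega>) A) \<in> borel_measurable M" unfolding measure_def by measurable
  show "0 \<le> ?\<mu>" using \<rho>_nonneg by simp
  have "(\<integral>\<^sup>+\<omega>. ennreal (measure (N \<omega>) A) \<partial>M) = (\<integral>\<^sup>+\<omega>. (\<Sum>j. ennreal (real j) * indicator (E j) \<omega>) \<partial>M)"
  proof (rule nn_integral_cong_AE)
    show "AE \<omega> in M. ennreal (measure (N \<omega>) A) = (\<Sum>j. ennreal (real j) * indicator (E j) \<omega>)"
      using N_finite_count[OF A] AE_space
    proof eventually_elim
      case (elim \<omega>)
      then obtain j where j: "emeasure (N \<omega>) A = of_nat j" by auto
      then have "(\<Sum>i. ennreal (real i) * indicator (E i) \<omega>) = (\<Sum>i\<in>{j}. ennreal (real i) * indicator (E i) \<omega>)"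
        by (intro suminf_finite) (auto simp: E_def indicator_def)
      then show ?case using j elim by (simp add: E_def measure_def ennreal_of_nat_eq_real_of_nat)
    qed
  qed
  also have "\<dots> = (\<Sum>j. \<integral>\<^sup>+\<omega>. ennreal (real j) * indicator (E j) \<omega> \<partial>M)"
    by (rule nn_integral_suminf) measurable
  also have "\<dots> = (\<Sum>j. ennreal (real j * (?\<mu> ^ j / fact j * exp (- ?\<mu>))))"
  proof (intro suminf_cong)
    fix j
    have "(\<integral>\<^sup>+\<omega>. ennreal (real j) * indicator (E j) \<omega> \<partial>M) = ennreal (real j) * ennreal (prob (E j))"
      by (simp add: nn_integral_cmult_indicator emeasure_eq_measure)
    also have "\<dots> = ennreal (real j * prob (E j))" by (simp add: ennreal_mult)
    finally show "(\<integral>\<^sup>+\<omega>. ennreal (real j) * indicator (E j) \<omega> \<partial>M)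
        = ennreal (real j * (?\<mu> ^ j / fact j * exp (- ?\<mu>)))"
      by (simp only: E_def prob_N[OF A])
  qed
  also have "\<dots> = ennreal ?\<mu>"
    using \<rho>_nonneg by (intro suminf_ennreal_eq poisson_mean_sums) auto
  finally show "(\<integral>\<^sup>+\<omega>. ennreal (measure (N \<omega>) A) \<partial>M) = ennreal ?\<mu>" .
qed auto

lemma measurable_N:
  assumes "\<omega> \<in> space M" "u \<in> restrict_space borel C \<rightarrow>\<^sub>M L"
  shows "u \<in> N \<omega> \<rightarrow>\<^sub>M L"
  using assms(2) by (simp only: measurable_cong_sets[OF sets_N[OF assms(1)] refl])

text \<open>Measurability in \<omega> is given for the masses of sets and extends to integrals
  through simple functions and monotone limits.\<close>

lemma nn_integral_N_measurable:
  fixes f :: "real ^ 'd \<Rightarrow> ennreal"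
  assumes "f \<in> borel_measurable (restrict_space borel C)"
  shows "(\<lambda>\<omega>. \<integral>\<^sup>+y. f y \<partial>N \<omega>) \<in> borel_measurable M"
  using assms
proof (induction rule: borel_measurable_induct)
  case (cong f g)
  have "(\<integral>\<^sup>+y. f y \<partial>N \<omega>) = (\<integral>\<^sup>+y. g y \<partial>N \<omega>)" if "\<omega> \<in> space M" for \<omega>
    using cong(3) by (intro nn_integral_cong) (simp add: space_N[OF that] space_restrict_space)
  then show ?case using cong(4) by (simp cong: measurable_cong)
next
  case (set A)
  have "(\<integral>\<^sup>+y. indicator A y \<partial>N \<omega>) = emeasure (N \<omega>) A" if "\<omega> \<in> space M" for \<omega>
    using set sets_N[OF that] by simp
  then show ?case
    using set emeasure_N_measurable[of A] by (simp add: sets_restrict_C cong: measurable_cong)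
next
  case (mult u c)
  have "(\<integral>\<^sup>+y. c * u y \<partial>N \<omega>) = c * (\<integral>\<^sup>+y. u y \<partial>N \<omega>)" if "\<omega> \<in> space M" for \<omega>
    using mult(2) measurable_N[OF that] by (intro nn_integral_cmult) auto
  then show ?case using mult(3,4) by (simp cong: measurable_cong)
next
  case (add u v)
  have "(\<integral>\<^sup>+y. v y + u y \<partial>N \<omega>) = (\<integral>\<^sup>+y. v y \<partial>N \<omega>) + (\<integral>\<^sup>+y. u y \<partial>N \<omega>)" if "\<omega> \<in> space M" for \<omega>
    using add measurable_N[OF that] by (intro nn_integral_add) auto
  then show ?case using add by (simp cong: measurable_cong)
next
  case (seq U)
  have "(\<integral>\<^sup>+y. (SUP i. U i) y \<partial>N \<omega>) = (SUP i. \<integral>\<^sup>+y. U i y \<partial>N \<omega>)" if "\<omega> \<in> space M" for \<omega>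
    unfolding SUP_apply using seq(3) measurable_N[OF that seq(1)]
    by (intro nn_integral_monotone_convergence_SUP) auto
  then show ?case using seq by (simp cong: measurable_cong)
qed

lemma f_measurable_N:
  fixes f :: "real ^ 'd \<Rightarrow> real"
  assumes "continuous_on C f" "\<omega> \<in> space M"
  shows "f \<in> borel_measurable (N \<omega>)"
  using borel_measurable_continuous_on_restrict[OF assms(1)] measurable_N[OF assms(2)] by auto

lemma integral_N_measurable:
  fixes f :: "real ^ 'd \<Rightarrow> real"
  assumes f: "continuous_on C f" "\<And>y. y \<in> C \<Longrightarrow> 0 \<le> f y"
  shows "(\<lambda>\<omega>. \<integral>y. f y \<partial>N \<omega>) \<in> borel_measurable M"
proof -
  have "(\<integral>y. f y \<partial>N \<omega>) = enn2real (\<integral>\<^sup>+y. ennreal (f y) \<partial>N \<omega>)" if "\<omega> \<in> space M" for \<omega>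
    using f f_measurable_N[OF f(1) that] by (intro integral_eq_nn_integral) (auto simp: space_N[OF that])
  moreover have "(\<lambda>\<omega>. \<integral>\<^sup>+y. ennreal (f y) \<partial>N \<omega>) \<in> borel_measurable M"
    using borel_measurable_continuous_on_restrict[OF f(1)] by (intro nn_integral_N_measurable) simp
  ultimately show ?thesis by (simp cong: measurable_cong)
qed

text \<open>Pathwise estimate: f is within \<epsilon> of the step function with value
  \<open>b i\<close> on the cell i, and the total mass is the sum of the cell masses.\<close>

lemma integral_N_approx:
  fixes f :: "real ^ 'd \<Rightarrow> real"
  assumes f: "continuous_on C f" and I: "finite I" "\<phi> ` C \<subseteq> I"
    and \<phi>: "\<And>i. i \<in> I \<Longrightarrow> C \<inter> \<phi> -` {i} \<in> sets borel"
    and b: "\<And>y. y \<in> C \<Longrightarrow> \<bar>f y - b (\<phi> y)\<bar> \<le> \<epsilon>"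
    and \<omega>: "\<omega> \<in> space M" "emeasure (N \<omega>) C < \<infinity>"
  shows "\<bar>(\<integral>y. f y \<partial>N \<omega>) - (\<Sum>i\<in>I. b i * measure (N \<omega>) (C \<inter> \<phi> -` {i}))\<bar>
    \<le> \<epsilon> * (\<Sum>i\<in>I. measure (N \<omega>) (C \<inter> \<phi> -` {i}))"
proof -
  interpret N: finite_measure "N \<omega>"
    using \<omega> by (intro finite_measureI) (simp add: space_N)
  have sets: "C \<inter> \<phi> -` {i} \<in> sets (N \<omega>)" if "i \<in> I" for i
    using \<phi>[OF that] by (simp add: sets_N[OF \<omega>(1)] sets_restrict_C)
  define g where "g y = (\<Sum>i\<in>I. b i * indicator (C \<inter> \<phi> -` {i}) y)" for y
  have g: "g y = b (\<phi> y)" if "y \<in> C" for y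
  proof -
    have "g y = (\<Sum>i\<in>{\<phi> y}. b i * indicator (C \<inter> \<phi> -` {i}) y)"
      unfolding g_def using I that by (intro sum.mono_neutral_right) auto
    then show ?thesis using that by simp
  qed
  have ind_int: "integrable (N \<omega>) (\<lambda>y. indicator (C \<inter> \<phi> -` {i}) y :: real)" if "i \<in> I" for i
    using sets[OF that] by (simp add: less_top[symmetric])
  have g_int: "integrable (N \<omega>) g"
    unfolding g_def using ind_int by (intro Bochner_Integration.integrable_sum integrable_mult_right)
  have f_int: "integrable (N \<omega>) f"
  proof -
    have "bounded (f ` C)" using compact_continuous_image[OF f C_compact] compact_imp_bounded by blast
    then obtain B where "\<And>y. y \<in> C \<Longrightarrow> norm (f y) \<le> B" by (auto simp: bounded_iff)
    then show ?thesis
      using f_measurable_N[OF f \<omega>(1)] by (intro N.integrable_const_bound[where B = B]) (auto simp: space_N[OF \<omega>(1)])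
  qed
  have "(\<integral>y. g y \<partial>N \<omega>) = (\<Sum>i\<in>I. b i * measure (N \<omega>) (C \<inter> \<phi> -` {i}))"
    unfolding g_def using ind_int sets by simp
  moreover have "\<bar>(\<integral>y. f y \<partial>N \<omega>) - (\<integral>y. g y \<partial>N \<omega>)\<bar> \<le> \<epsilon> * measure (N \<omega>) C"
  proof -
    have "\<bar>(\<integral>y. f y \<partial>N \<omega>) - (\<integral>y. g y \<partial>N \<omega>)\<bar> = norm (\<integral>y. f y - g y \<partial>N \<omega>)"
      using f_int g_int by simp
    also have "\<dots> \<le> (\<integral>y. norm (f y - g y) \<partial>N \<omega>)" by (rule integral_norm_bound)
    also have "\<dots> \<le> (\<integral>y. \<epsilon> \<partial>N \<omega>)"
      using f_int g_int b g by (intro integral_mono integrable_norm) (auto simp: space_N[OF \<omega>(1)])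
    also have "\<dots> = \<epsilon> * measure (N \<omega>) C" by (simp add: space_N[OF \<omega>(1)])
    finally show ?thesis .
  qed
  moreover have "measure (N \<omega>) C = (\<Sum>i\<in>I. measure (N \<omega>) (C \<inter> \<phi> -` {i}))"
  proof -
    have "C = (\<Union>i\<in>I. C \<inter> \<phi> -` {i})" using I by auto
    also have "measure (N \<omega>) \<dots> = (\<Sum>i\<in>I. measure (N \<omega>) (C \<inter> \<phi> -` {i}))"
      using I sets by (intro N.finite_measure_finite_Union) (auto simp: disjoint_family_on_def)
    finally show ?thesis .
  qed
  ultimately show ?thesis by simp
qed

text \<open>Follows from (1 - u + u^2)(1 + u) = 1 + u^3 \<ge> 1 and 1 + u \<le> exp u. The left-hand
  side is E K - P(K \<noteq> 0) for a Poisson variable K of mean u.\<close>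

lemma exp_minus_le_quadratic:
  assumes "0 \<le> (u::real)"
  shows "u - 1 + exp (- u) \<le> u\<^sup>2"
proof -
  have "1 \<le> (1 - u + u\<^sup>2) * (1 + u)"
    using assms by (simp add: algebra_simps power2_eq_square)
  also have "\<dots> \<le> (1 - u + u\<^sup>2) * exp u"
    using sum_power2_ge_zero[of "1 - u" u] assms
    by (intro mult_left_mono exp_ge_add_one_self) (auto simp: power2_eq_square algebra_simps intro!: add_nonneg_nonneg)
  finally show ?thesis by (simp add: exp_minus field_simps)
qed

lemma measure_Jordan_cells:
  assumes "finite I" "\<phi> ` C \<subseteq> I" "\<And>i. i \<in> I \<Longrightarrow> C \<inter> \<phi> -` {i} \<in> sets borel" "J \<subseteq> I"
  shows "C \<inter> \<phi> -` J \<in> sets borel"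
    "measure lborel (C \<inter> \<phi> -` J) = (\<Sum>i\<in>J. measure lborel (C \<inter> \<phi> -` {i}))"
    "(\<Sum>i\<in>I. measure lborel (C \<inter> \<phi> -` {i})) = measure lborel C"
proof -
  have *: "C \<inter> \<phi> -` J \<in> sets borel \<and> measure lborel (C \<inter> \<phi> -` J) = (\<Sum>i\<in>J. measure lborel (C \<inter> \<phi> -` {i}))"
    if "J \<subseteq> I" for J
  proof
    have J: "C \<inter> \<phi> -` J = (\<Union>i\<in>J. C \<inter> \<phi> -` {i})" by auto
    have "finite J" using that \<open>finite I\<close> finite_subset by blast
    then show "C \<inter> \<phi> -` J \<in> sets borel"
      unfolding J using that assms(3) by (intro sets.finite_UN) auto
    have "emeasure lborel (C \<inter> \<phi> -` {i}) \<noteq> \<infinity>" for i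
    proof -
      have "emeasure lborel (C \<inter> \<phi> -` {i}) \<le> emeasure lborel C" by (intro emeasure_mono) auto
      also have "\<dots> < \<infinity>" using emeasure_compact_finite[OF C_compact] .
      finally show ?thesis by simp
    qed
    then show "measure lborel (C \<inter> \<phi> -` J) = (\<Sum>i\<in>J. measure lborel (C \<inter> \<phi> -` {i}))"
      unfolding J using that assms(3) \<open>finite J\<close>
      by (intro measure_finite_Union) (auto simp: disjoint_family_on_def)
  qed
  show "C \<inter> \<phi> -` J \<in> sets borel"
    "measure lborel (C \<inter> \<phi> -` J) = (\<Sum>i\<in>J. measure lborel (C \<inter> \<phi> -` {i}))"
    using *[OF \<open>J \<subseteq> I\<close>] by auto
  have "C \<inter> \<phi> -` I = C" using assms(2) by auto
  then show "(\<Sum>i\<in>I. measure lborel (C \<inter> \<phi> -` {i})) = measure lborel C"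
    using *[of I] by simp
qed

text \<open>Each excess is at most \<mu>_i^2; one factor is at most \<rho>\<epsilon> and the others
  add up to \<rho>|C|, so the sum vanishes with the cell size.\<close>

lemma sum_multiplicity_excess:
  assumes I: "finite I" "\<phi> ` C \<subseteq> I" "\<And>i. i \<in> I \<Longrightarrow> C \<inter> \<phi> -` {i} \<in> sets borel"
    and small: "\<And>i. i \<in> I \<Longrightarrow> measure lborel (C \<inter> \<phi> -` {i}) \<le> \<epsilon>"
  defines "\<mu> \<equiv> \<lambda>i. \<rho> * measure lborel (C \<inter> \<phi> -` {i})"
  shows "(\<Sum>i\<in>I. \<mu> i - 1 + exp (- \<mu> i)) \<le> \<rho>\<^sup>2 * \<epsilon> * measure lborel C"
proof -
  have "\<mu> i - 1 + exp (- \<mu> i) \<le> \<rho>\<^sup>2 * \<epsilon> * measure lborel (C \<inter> \<phi> -` {i})" if "i \<in> I" for i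
  proof -
    have "\<mu> i - 1 + exp (- \<mu> i) \<le> (\<mu> i)\<^sup>2"
      using \<rho>_nonneg by (intro exp_minus_le_quadratic) (simp add: \<mu>_def)
    also have "\<dots> = \<rho>\<^sup>2 * (measure lborel (C \<inter> \<phi> -` {i}) * measure lborel (C \<inter> \<phi> -` {i}))"
      by (simp add: \<mu>_def power2_eq_square)
    also have "\<dots> \<le> \<rho>\<^sup>2 * (\<epsilon> * measure lborel (C \<inter> \<phi> -` {i}))"
      using small[OF that] by (intro mult_left_mono mult_right_mono) auto
    finally show ?thesis by simp
  qed
  then have "(\<Sum>i\<in>I. \<mu> i - 1 + exp (- \<mu> i)) \<le> (\<Sum>i\<in>I. \<rho>\<^sup>2 * \<epsilon> * measure lborel (C \<inter> \<phi> -` {i}))"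
    by (rule sum_mono)
  also have "\<dots> = \<rho>\<^sup>2 * \<epsilon> * measure lborel C"
    using measure_Jordan_cells(3)[OF I order_refl] by (simp flip: sum_distrib_left)
  finally show ?thesis .
qed

text \<open>Instance of \<open>char_fn_occupancy\<close> with the cell masses as counts and an empty
  exceptional event. By additivity all cells in J are void exactly when their union is, which has a
  known probability.\<close>

lemma char_fn_integral_N:
  fixes f :: "real ^ 'd \<Rightarrow> real"
  assumes f: "continuous_on C f" "\<And>y. y \<in> C \<Longrightarrow> 0 \<le> f y"
    and I: "finite I" "\<phi> ` C \<subseteq> I" "\<And>i. i \<in> I \<Longrightarrow> C \<inter> \<phi> -` {i} \<in> sets borel"
    and b: "\<And>y. y \<in> C \<Longrightarrow> \<bar>f y - b (\<phi> y)\<bar> \<le> \<epsilon>" "\<And>i. i \<in> I \<Longrightarrow> \<bar>b i\<bar> \<le> B"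
    and small: "\<And>i. i \<in> I \<Longrightarrow> measure lborel (C \<inter> \<phi> -` {i}) \<le> \<epsilon>"
    and nonneg: "0 \<le> \<epsilon>" "0 \<le> B"
  shows "cmod ((CLINT \<omega>|M. iexp (s * (\<integral>y. f y \<partial>N \<omega>)))
      - (\<Sum>J\<in>Pow I. occupancy_coeff I b s J * exp (- (\<rho> * measure lborel (C \<inter> \<phi> -` J)))))
    \<le> \<bar>s\<bar> * (\<epsilon> * (\<rho> * measure lborel C) + B * (\<rho>\<^sup>2 * \<epsilon> * measure lborel C))"
proof -
  define Kc where "Kc i \<omega> = measure (N \<omega>) (C \<inter> \<phi> -` {i})" for i \<omega>
  define \<mu> where "\<mu> i = \<rho> * measure lborel (C \<inter> \<phi> -` {i})" for i
  have Kc: "has_bochner_integral M (Kc i) (\<mu> i)" if "i \<in> I" for i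
    unfolding Kc_def \<mu>_def by (intro N_expectation I(3) that) auto
  have fin: "AE \<omega> in M. emeasure (N \<omega>) C < \<infinity>"
    using N_finite_count[OF C_borel order_refl] by eventually_elim (auto simp: ennreal_of_nat_eq_real_of_nat)
  have Kc01: "AE \<omega> in M. Kc i \<omega> = 0 \<or> 1 \<le> Kc i \<omega>" if "i \<in> I" for i
    using N_finite_count[OF I(3)[OF that] Int_lower1] by (auto simp: Kc_def measure_def)
  have void: "\<P>(\<omega> in M. \<forall>i\<in>J. Kc i \<omega> = 0) = exp (- (\<rho> * measure lborel (C \<inter> \<phi> -` J)))"
    if "J \<subseteq> I" for J
  proof -
    have "finite J" using that I(1) finite_subset by blast
    note J = measure_Jordan_cells(1)[OF I that]
    note [measurable] = emeasure_N_measurable[OF J Int_lower1]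
    have [measurable]: "Kc i \<in> borel_measurable M" if "i \<in> J" for i
      using Kc that \<open>J \<subseteq> I\<close> by (auto simp: has_bochner_integral_iff)
    have "\<P>(\<omega> in M. \<forall>i\<in>J. Kc i \<omega> = 0) = \<P>(\<omega> in M. emeasure (N \<omega>) (C \<inter> \<phi> -` J) = of_nat 0)"
    proof (rule finite_measure_eq_AE)
      show "{\<omega> \<in> space M. \<forall>i\<in>J. Kc i \<omega> = 0} \<in> events"
        using \<open>finite J\<close> by measurable
      show "{\<omega> \<in> space M. emeasure (N \<omega>) (C \<inter> \<phi> -` J) = of_nat 0} \<in> events"
        by measurable
      show "AE \<omega> in M. \<omega> \<in> {\<omega> \<in> space M. \<forall>i\<in>J. Kc i \<omega> = 0}
          \<longleftrightarrow> \<omega> \<in> {\<omega> \<in> space M. emeasure (N \<omega>) (C \<inter> \<phi> -` J) = of_nat 0}"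
        using fin AE_space
      proof eventually_elim
        case (elim \<omega>)
        have sets: "C \<inter> \<phi> -` {i} \<in> sets (N \<omega>)" if "i \<in> I" for i
          using I(3)[OF that] elim(2) by (simp add: sets_N sets_restrict_C)
        \<comment> \<open>\<open>measure\<close> also vanishes where \<open>emeasure\<close> is
          infinite; the finite mass of C excludes this.\<close>
        have 0: "Kc i \<omega> = 0 \<longleftrightarrow> emeasure (N \<omega>) (C \<inter> \<phi> -` {i}) = 0" if "i \<in> I" for i
        proof -
          have "emeasure (N \<omega>) (C \<inter> \<phi> -` {i}) \<le> emeasure (N \<omega>) C"
            using elim(2) by (intro emeasure_mono) (auto simp: sets_N sets_restrict_C)
          then show ?thesis using elim(1) by (auto simp: Kc_def measure_def enn2real_eq_0_iff top_unique)
        qed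
        have J: "C \<inter> \<phi> -` J = (\<Union>i\<in>J. C \<inter> \<phi> -` {i})" by auto
        have "emeasure (N \<omega>) (C \<inter> \<phi> -` J) = (\<Sum>i\<in>J. emeasure (N \<omega>) (C \<inter> \<phi> -` {i}))"
          unfolding J using \<open>finite J\<close> sets that
          by (subst sum_emeasure) (auto simp: disjoint_family_on_def)
        then show ?case using elim(2) 0 that \<open>finite J\<close> by (auto simp: subset_iff)
      qed
    qed
    also have "\<dots> = exp (- (\<rho> * measure lborel (C \<inter> \<phi> -` J)))"
      using prob_N[OF J Int_lower1, of 0] by simp
    finally show ?thesis .
  qed
  have "cmod ((CLINT \<omega>|M. iexp (s * (\<integral>y. f y \<partial>N \<omega>)))
      - (\<Sum>J\<in>Pow I. occupancy_coeff I b s J * \<P>(\<omega> in M. \<forall>i\<in>J. Kc i \<omega> = 0)))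
    \<le> 2 * prob {} + \<bar>s\<bar> * (\<epsilon> * (\<Sum>i\<in>I. expectation (Kc i))
        + B * (\<Sum>i\<in>I. expectation (Kc i) - 1 + \<P>(\<omega> in M. Kc i \<omega> = 0)))"
  proof (rule char_fn_occupancy)
    show "(\<lambda>\<omega>. \<integral>y. f y \<partial>N \<omega>) \<in> borel_measurable M" by (rule integral_N_measurable[OF f])
    show "AE \<omega> in M. \<omega> \<notin> {} \<longrightarrow> \<bar>(\<integral>y. f y \<partial>N \<omega>) - (\<Sum>i\<in>I. b i * Kc i \<omega>)\<bar> \<le> \<epsilon> * (\<Sum>i\<in>I. Kc i \<omega>)"
      using fin AE_space unfolding Kc_def
      by eventually_elim (use integral_N_approx[OF f(1) I b(1)] in auto)
  qed (use I Kc Kc01 b nonneg in \<open>auto simp: has_bochner_integral_iff\<close>)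
  also have "(\<Sum>i\<in>I. expectation (Kc i)) = \<rho> * measure lborel C"
    using Kc measure_Jordan_cells(3)[OF I order_refl]
    by (simp add: has_bochner_integral_iff \<mu>_def flip: sum_distrib_left)
  also have "(\<Sum>i\<in>I. expectation (Kc i) - 1 + \<P>(\<omega> in M. Kc i \<omega> = 0))
      = (\<Sum>i\<in>I. \<mu> i - 1 + exp (- \<mu> i))"
  proof (intro sum.cong refl)
    fix i assume "i \<in> I"
    then show "expectation (Kc i) - 1 + \<P>(\<omega> in M. Kc i \<omega> = 0) = \<mu> i - 1 + exp (- \<mu> i)"
      using Kc[of i] void[of "{i}"] by (simp add: has_bochner_integral_iff \<mu>_def)
  qed
  also have "\<dots> \<le> \<rho>\<^sup>2 * \<epsilon> * measure lborel C"
    unfolding \<mu>_def by (rule sum_multiplicity_excess[OF I small])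
  finally show ?thesis
    using nonneg void by (simp add: mult_left_mono)
qed

end

subsection \<open>Clusters\<close>

text \<open>When closeness coincides with equality of labels it is already transitive on \<Phi>:
  chains of any length preserve the label, and equal labels are linked by a single step.\<close>

lemma same_cluster_iff_label:
  assumes near: "\<And>a b. a \<in> \<Phi> \<Longrightarrow> b \<in> \<Phi> \<Longrightarrow> l a = l b \<longleftrightarrow> norm (b - a) \<le> \<delta>"
    and ab: "a \<in> \<Phi>" "b \<in> \<Phi>"
  shows "same_cluster \<delta> \<Phi> a b \<longleftrightarrow> l a = l b"
proof
  assume "l a = l b"
  then have "norm (b - a) \<le> \<delta>" using near ab by blast
  \<comment> \<open>For a = b the chain has to be \<open>[a]\<close>, since \<open>[a, b]\<close>
    would not be distinct.\<close>
  then show "same_cluster \<delta> \<Phi> a b"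
    unfolding same_cluster_def using ab
    by (cases "a = b") (auto intro: exI[of _ "[a]"] exI[of _ "[a, b]"])
next
  assume "same_cluster \<delta> \<Phi> a b"
  then obtain us where us: "us \<noteq> []" "set us \<subseteq> \<Phi>" "hd us = a" "last us = b"
    "successively (\<lambda>a b. norm (b - a) \<le> \<delta>) us"
    by (auto simp: same_cluster_def)
  have "\<forall>u\<in>set us. l u = l (hd us)"
    using us(1,2,5)
  proof (induction us)
    case (Cons u us)
    show ?case
    proof (cases us)
      case (Cons w ws)
      then have "l u = l w" using Cons.prems near[of u w] by simp
      then show ?thesis using Cons Cons.prems Cons.IH by simp
    qed simp
  qed simp
  then show "l a = l b" using us by (metis last_in_set)
qed

lemma clusters_eq_labels:
  assumes "\<And>a b. a \<in> \<Phi> \<Longrightarrow> b \<in> \<Phi> \<Longrightarrow> l a = l b \<longleftrightarrow> norm (b - a) \<le> \<delta>"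
  shows "clusters \<delta> \<Phi> = (\<lambda>j. {a \<in> \<Phi>. l a = j}) ` l ` \<Phi>"
proof -
  have "{(u, u'). same_cluster \<delta> \<Phi> u u'} `` {a} = {b \<in> \<Phi>. l b = l a}" if "a \<in> \<Phi>" for a
  proof -
    have "same_cluster \<delta> \<Phi> a b \<Longrightarrow> b \<in> \<Phi>" for b
      by (auto simp: same_cluster_def)
    then have "same_cluster \<delta> \<Phi> a b \<longleftrightarrow> b \<in> \<Phi> \<and> l b = l a" for b
      using same_cluster_iff_label[OF assms that, of b] by metis
    then show ?thesis by auto
  qed
  then show ?thesis
    unfolding clusters_def quotient_def image_image by auto
qed

lemma finite_clusters: "finite \<Phi> \<Longrightarrow> finite (clusters \<delta> \<Phi>)"
  by (simp add: clusters_def quotient_def)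

lemma sum_clusters_eq_sum_labels:
  assumes "\<And>a b. a \<in> \<Phi> \<Longrightarrow> b \<in> \<Phi> \<Longrightarrow> l a = l b \<longleftrightarrow> norm (b - a) \<le> \<delta>"
  shows "(\<Sum>S\<in>clusters \<delta> \<Phi>. F S) = (\<Sum>j\<in>l ` \<Phi>. F {a \<in> \<Phi>. l a = j})"
proof -
  have "inj_on (\<lambda>j. {a \<in> \<Phi>. l a = j}) (l ` \<Phi>)"
  proof (rule inj_onI)
    fix j j' assume "j \<in> l ` \<Phi>" and eq: "{a \<in> \<Phi>. l a = j} = {a \<in> \<Phi>. l a = j'}"
    then obtain a where "a \<in> {a \<in> \<Phi>. l a = j}" by auto
    with eq show "j = j'" by auto
  qed
  moreover have "clusters \<delta> \<Phi> = (\<lambda>j. {a \<in> \<Phi>. l a = j}) ` l ` \<Phi>"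
    using assms by (rule clusters_eq_labels)
  ultimately show ?thesis by (simp only: sum.reindex o_def)
qed

lemma ctr_in_cluster:
  assumes "cluster_point_rule ctr" "finite S" "S \<noteq> {}"
  shows "ctr S \<in> S"
  using assms by (auto simp: cluster_point_rule_def is_arg_min_def)

text \<open>\<open>measure_of\<close> yields the zero measure unless its set function is a measure.
  This is secured by identifying it with the image under \<open>ctr\<close> of the counting measure
  on the clusters whose centre lies in C.\<close>

lemma integral_cluster_process:
  fixes f :: "real ^ 'd \<Rightarrow> real"
  assumes C: "closed C" and f: "continuous_on C f"
    and fin: "finite (exceedance_points C \<xi> cn kn xn \<omega>)"
  shows "(\<integral>y. f y \<partial>cluster_process C \<xi> ctr cn kn xn \<omega>)
    = (\<Sum>S\<in>clusters (sqrt (real CARD('d)) / root CARD('d) (real kn)) (exceedance_points C \<xi> cn kn xn \<omega>).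
        if ctr S \<in> C then f (ctr S) else 0)"
proof -
  let ?F = "clusters (sqrt (real CARD('d)) / root CARD('d) (real kn)) (exceedance_points C \<xi> cn kn xn \<omega>)"
  have F: "finite ?F" by (rule finite_clusters) fact
  define F' where "F' = {S \<in> ?F. ctr S \<in> C}"
  have F': "finite F'" using F by (simp add: F'_def)
  let ?C = "restrict_space borel C"
  have space: "space ?C = C" by (simp add: space_restrict_space)
  define D where "D = distr (count_space F') ?C ctr"
  have meas: "ctr \<in> count_space F' \<rightarrow>\<^sub>M ?C" by (auto simp: F'_def space)
  have em: "(\<Sum>S\<in>?F. indicator A (ctr S)) = emeasure D A" if "A \<in> sets ?C" for A
  proof -
    have AC: "A \<subseteq> C" using sets.sets_into_space[OF that] by (simp add: space)
    have "emeasure D A = emeasure (count_space F') (ctr -` A \<inter> F')"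
      unfolding D_def using meas that by (simp add: emeasure_distr)
    also have "\<dots> = of_nat (card (ctr -` A \<inter> F'))"
      using F' by (intro emeasure_count_space_finite) auto
    also have "ctr -` A \<inter> F' = {S \<in> ?F. ctr S \<in> A}" using AC by (auto simp: F'_def)
    also have "of_nat (card {S \<in> ?F. ctr S \<in> A}) = (\<Sum>S\<in>?F. indicator A (ctr S) :: ennreal)"
      using F by (simp add: indicator_def sum.If_cases Int_def flip: of_nat_sum)
    finally show ?thesis by simp
  qed
  have "cluster_process C \<xi> ctr cn kn xn \<omega> = measure_of C (sets ?C) (emeasure D)"
    unfolding cluster_process_def
  proof (rule measure_of_eq)
    show "sets ?C \<subseteq> Pow C" using sets.space_closed[of ?C] by (simp add: space)
    show "(\<Sum>S\<in>?F. indicator A (ctr S)) = emeasure D A" if "A \<in> sigma_sets C (sets ?C)" for A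
      using that sets.sigma_sets_eq[of ?C] em by (simp add: space)
  qed
  also have "\<dots> = D" using measure_of_of_measure[of D] by (simp add: D_def space)
  finally have "(\<integral>y. f y \<partial>cluster_process C \<xi> ctr cn kn xn \<omega>) = (\<integral>S. f (ctr S) \<partial>count_space F')"
    unfolding D_def using meas borel_measurable_continuous_on_restrict[OF f] by (simp add: integral_distr)
  also have "\<dots> = (\<Sum>S\<in>F'. f (ctr S))" by (rule lebesgue_integral_count_space_finite) fact
  also have "\<dots> = (\<Sum>S\<in>?F. if ctr S \<in> C then f (ctr S) else 0)"
    using F by (simp add: F'_def sum.If_cases Int_def)
  finally show ?thesis .
qed

text \<open>The random set takes finitely many values, each on an event, so F may be arbitrary. In
  particular no measurability of the tie-breaking rule is required.\<close>

lemma measurable_function_of_finite_set: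
  assumes "finite D" "\<And>v. v \<in> D \<Longrightarrow> {\<omega> \<in> space M. P v \<omega>} \<in> sets M"
  shows "(\<lambda>\<omega>. F {v \<in> D. P v \<omega>} :: real) \<in> borel_measurable M"
proof -
  have "(\<lambda>\<omega>. {v \<in> D. P v \<omega>}) \<in> M \<rightarrow>\<^sub>M count_space (Pow D)"
  proof (subst measurable_count_space_eq2)
    show "finite (Pow D)" using assms(1) by simp
    have "(\<lambda>\<omega>. {v \<in> D. P v \<omega>}) -` {E} \<inter> space M \<in> sets M" if "E \<subseteq> D" for E
    proof -
      have "(\<lambda>\<omega>. {v \<in> D. P v \<omega>}) -` {E} \<inter> space M
          = {\<omega> \<in> space M. \<forall>v\<in>D. P v \<omega> \<longleftrightarrow> v \<in> E}"
        using that by auto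
      also have "\<dots> \<in> sets M"
      proof (rule sets.sets_Collect_finite_All[OF _ assms(1)])
        fix v assume "v \<in> D"
        have "{\<omega> \<in> space M. P v \<omega> = (v \<in> E)} = (if v \<in> E then {\<omega> \<in> space M. P v \<omega>} else space M - {\<omega> \<in> space M. P v \<omega>})"
          by auto
        then show "{\<omega> \<in> space M. P v \<omega> = (v \<in> E)} \<in> sets M"
          using assms(2)[OF \<open>v \<in> D\<close>] by auto
      qed
      finally show ?thesis .
    qed
    then show "(\<lambda>\<omega>. {v \<in> D. P v \<omega>}) \<in> space M \<rightarrow> Pow D \<and>
        (\<forall>a\<in>Pow D. (\<lambda>\<omega>. {v \<in> D. P v \<omega>}) -` {a} \<inter> space M \<in> sets M)"
      by auto
  qed
  then show ?thesis
    by (rule measurable_compose) simp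
qed

text \<open>For z in \<open>Q_minus\<close> the lower corner of the block belongs to the half-open
  block and to the scaled set C_n.\<close>

lemma D_tilde_subset_D_plus:
  assumes "\<And>i. 0 < cn $ i"
  shows "D_tilde C cn kn \<subseteq> D_plus C cn kn"
proof
  fix v assume "v \<in> D_tilde C cn kn"
  then obtain z where z: "vec_quot (of_int_vec z * block_side cn kn) cn \<in> C" "v \<in> block_J cn kn z"
    by (auto simp: D_tilde_def Q_minus_def)
  have "of_int_vec z * block_side cn kn = cn * vec_quot (of_int_vec z * block_side cn kn) cn"
    using assms by (simp add: vec_eq_iff vec_quot_def less_imp_neq[symmetric])
  then have "of_int_vec z * block_side cn kn \<in> scale_set cn C"
    using z(1) unfolding scale_set_def by (metis imageI)
  moreover have "of_int_vec z * block_side cn kn \<in> block_I cn kn z"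
    unfolding block_I_def scale_set_def image_image
    by (intro image_eqI[of _ _ 0]) (auto simp: mult.commute)
  ultimately show "v \<in> D_plus C cn kn"
    using z(2) by (auto simp: D_plus_def)
qed

lemma finite_K_box:
  assumes "\<And>i. 0 < cn $ i"
  shows "finite (K_box \<kappa> cn)"
proof (rule finite_subset)
  show "K_box \<kappa> cn \<subseteq> {(\<chi> i. \<lfloor>- \<kappa> * cn $ i\<rfloor>)..(\<chi> i. \<lceil>\<kappa> * cn $ i\<rceil>)}"
  proof
    fix v assume "v \<in> K_box \<kappa> cn"
    then obtain u where u: "of_int_vec v = cn * u" "\<And>i. - \<kappa> \<le> u $ i \<and> u $ i \<le> \<kappa>"
      by (auto simp: K_box_def lattice_points_def scale_set_def)
    have "\<lfloor>- \<kappa> * cn $ i\<rfloor> \<le> v $ i \<and> v $ i \<le> \<lceil>\<kappa> * cn $ i\<rceil>" for i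
    proof -
      have "of_int (v $ i) = u $ i * cn $ i"
        using u(1) by (simp add: vec_eq_iff of_int_vec_def mult.commute)
      moreover have "- \<kappa> * cn $ i \<le> u $ i * cn $ i" "u $ i * cn $ i \<le> \<kappa> * cn $ i"
        using u(2) by (intro mult_right_mono less_imp_le[OF assms]; simp)+
      ultimately show ?thesis by linarith
    qed
    then show "v \<in> {(\<chi> i. \<lfloor>- \<kappa> * cn $ i\<rfloor>)..(\<chi> i. \<lceil>\<kappa> * cn $ i\<rceil>)}"
      by (simp add: less_eq_vec_def)
  qed
qed (rule finite_int_vec_interval)

lemma integral_cluster_process_measurable:
  fixes f :: "real ^ 'd \<Rightarrow> real"
  assumes "closed C" "continuous_on C f" "finite (D_tilde C cn kn)"
    and \<xi>: "\<And>v. \<xi> v \<in> borel_measurable M"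
  shows "(\<lambda>\<omega>. \<integral>y. f y \<partial>cluster_process C \<xi> ctr cn kn xn \<omega>) \<in> borel_measurable M"
proof -
  have eq: "exceedance_points C \<xi> cn kn xn \<omega>
      = (\<lambda>v. vec_quot (of_int_vec v) cn) ` {v \<in> D_tilde C cn kn. xn < \<xi> v \<omega>}" for \<omega>
    by (auto simp: exceedance_points_def)
  have fin: "finite (exceedance_points C \<xi> cn kn xn \<omega>)" for \<omega>
    unfolding eq using assms(3) by simp
  show ?thesis
    unfolding integral_cluster_process[OF assms(1,2) fin] unfolding eq
    by (rule measurable_function_of_finite_set[OF assms(3)]) (use \<xi> in measurable)
qed

section \<open>Hit blocks and clusters for a fixed n\<close>

locale cluster_blocks = mixing_blocks M \<xi> x K \<gamma> \<alpha> T g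
  for M :: "'w measure" and \<xi> :: "int ^ 'd \<Rightarrow> 'w \<Rightarrow> real" and x K \<gamma> \<alpha> T g +
  fixes C :: "(real ^ 'd) set" and cn :: "real ^ 'd" and kn :: nat and kr :: real
  assumes cn_pos: "\<And>i. 0 < cn $ i" and kn_pos: "0 < kn"
    and kr_eq: "kr = root CARD('d) (real kn)"
    and T_eq: "T = (\<chi> i. \<lfloor>cn $ i / kr\<rfloor>)"
    and C_compact: "compact C"
    and finite_Q: "finite (Q_minus C cn kn)"
    and D_tilde_K: "D_tilde C cn kn \<subseteq> K"
begin

text \<open>Side vector of the blocks after rescaling by c_n, so that block z becomes the cell of
  index z.\<close>

definition "h = vec_quot (of_int_vec T) cn"

abbreviation "Q \<equiv> Q_minus C cn kn"

lemma h_pos: "0 < h $ i"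
  using T_pos[of i] cn_pos[of i] by (simp add: h_def vec_quot_def of_int_vec_def)

lemma kr_pos: "0 < kr"
  using kn_pos by (simp add: kr_eq)

lemma h_le: "h $ i \<le> 1 / kr"
proof -
  have "of_int (T $ i) \<le> cn $ i / kr" by (simp add: T_eq)
  then show ?thesis using cn_pos[of i] kr_pos by (simp add: h_def vec_quot_def of_int_vec_def field_simps)
qed

lemma block_side_eq: "block_side cn kn = of_int_vec T"
  by (simp add: block_side_def T_eq kr_eq of_int_vec_def)

lemma Q_eq: "Q = {z. h * of_int_vec z \<in> C}"
proof -
  have "vec_quot (of_int_vec z * of_int_vec T) cn = h * of_int_vec z" for z
    by (simp add: vec_quot_def of_int_vec_def h_def vec_eq_iff)
  then show ?thesis by (simp add: Q_minus_def block_side_eq)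
qed

lemma block_J_eq: "block_J cn kn z = block z"
proof -
  have "v \<in> block_J cn kn z \<longleftrightarrow> v \<in> block z" for v
  proof
    assume "v \<in> block_J cn kn z"
    then obtain u where u: "\<And>i. 0 \<le> u $ i \<and> u $ i < 1" "of_int_vec v = of_int_vec T * (of_int_vec z + u)"
      by (auto simp: block_J_def block_I_def lattice_points_def scale_set_def block_side_eq)
    show "v \<in> block z"
      unfolding in_lattice_block_iff
    proof
      fix i
      have "real_of_int (v $ i) = of_int (T $ i * z $ i) + of_int (T $ i) * u $ i"
        using u(2) by (simp add: vec_eq_iff of_int_vec_def algebra_simps)
      moreover have "0 \<le> of_int (T $ i) * u $ i" "of_int (T $ i) * u $ i < of_int (T $ i) * 1"
        using u(1)[of i] T_pos[of i] by (simp, intro mult_strict_left_mono) auto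
      ultimately show "T $ i * z $ i \<le> v $ i \<and> v $ i < T $ i * z $ i + T $ i" by linarith
    qed
  next
    assume v: "v \<in> block z"
    define u :: "real ^ 'd" where "u = (\<chi> i. of_int (v $ i - T $ i * z $ i) / of_int (T $ i))"
    have "0 \<le> u $ i \<and> u $ i < 1" for i
    proof -
      have "0 \<le> v $ i - T $ i * z $ i" "v $ i - T $ i * z $ i < T $ i"
        using v by (auto simp: in_lattice_block_iff dest!: spec[of _ i])
      then show ?thesis
        using T_pos[of i] by (simp add: u_def del: of_int_diff of_int_mult)
    qed
    moreover have "of_int_vec v = of_int_vec T * (of_int_vec z + u)"
      using T_pos by (simp add: vec_eq_iff of_int_vec_def u_def distrib_left less_imp_neq[symmetric])
    ultimately show "v \<in> block_J cn kn z"
      unfolding block_J_def block_I_def lattice_points_def scale_set_def block_side_eq by auto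
  qed
  then show ?thesis by auto
qed

lemma later_block_eq: "later_block R cn kn 0 = later_points R T 0"
proof -
  have "of_int_vec w \<in> (\<lambda>a. of_int_vec 0 + a) ` scale_set (of_int_vec T) {u. \<forall>i. - 1 \<le> u $ i \<and> u $ i \<le> 1}
      \<longleftrightarrow> (\<forall>i. \<bar>w $ i\<bar> \<le> T $ i)" for w
  proof
    assume "of_int_vec w \<in> (\<lambda>a. of_int_vec 0 + a) ` scale_set (of_int_vec T) {u. \<forall>i. - 1 \<le> u $ i \<and> u $ i \<le> 1}"
    then obtain u where u: "\<And>i. - 1 \<le> u $ i \<and> u $ i \<le> 1" "of_int_vec w = of_int_vec 0 + of_int_vec T * u"
      by (auto simp: scale_set_def)
    show "\<forall>i. \<bar>w $ i\<bar> \<le> T $ i"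
    proof
      fix i
      have "\<bar>real_of_int (w $ i)\<bar> = of_int (T $ i) * \<bar>u $ i\<bar>"
        using u(2) T_pos[of i] by (simp add: vec_eq_iff of_int_vec_def abs_mult)
      also have "\<dots> \<le> of_int (T $ i) * 1"
        using u(1)[of i] T_pos[of i] by (intro mult_left_mono) (auto simp: abs_le_iff minus_le_iff)
      finally show "\<bar>w $ i\<bar> \<le> T $ i" by linarith
    qed
  next
    assume w: "\<forall>i. \<bar>w $ i\<bar> \<le> T $ i"
    define u :: "real ^ 'd" where "u = (\<chi> i. of_int (w $ i) / of_int (T $ i))"
    have "- 1 \<le> u $ i \<and> u $ i \<le> 1" for i
    proof -
      have "\<bar>u $ i\<bar> \<le> 1"
        using w[rule_format, of i] T_pos[of i] by (simp add: u_def abs_le_iff flip: of_int_minus)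
      then show ?thesis by linarith
    qed
    moreover have "of_int_vec w = of_int_vec 0 + of_int_vec T * u"
      using T_pos by (simp add: vec_eq_iff of_int_vec_def u_def less_imp_neq[symmetric])
    ultimately show "of_int_vec w \<in> (\<lambda>a. of_int_vec 0 + a) ` scale_set (of_int_vec T) {u. \<forall>i. - 1 \<le> u $ i \<and> u $ i \<le> 1}"
      unfolding scale_set_def by auto
  qed
  then show ?thesis
    by (auto simp: later_block_def later_points_def lattice_points_def block_side_eq)
qed

text \<open>The scale c_n cancels in the quotient by h, and the floor of v_i/T_i is integer
  division.\<close>

lemma lattice_floor_point: "v \<in> block z \<Longrightarrow> lattice_floor h (vec_quot (of_int_vec v) cn) = z"
  using T_pos cn_pos
  by (simp add: in_lattice_block_iff_div lattice_floor_def h_def vec_quot_def of_int_vec_def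
      less_imp_neq[symmetric] floor_divide_of_int_eq)

text \<open>Sides are at most 1/k_n^{1/d}, so the linking distance of the clusters bounds the
  diameter of a rescaled block.\<close>

lemma same_cell_close:
  assumes "lattice_floor h a = lattice_floor h b"
  shows "norm (b - a) \<le> sqrt (real CARD('d)) / kr"
proof -
  have "\<bar>(b - a) $ i\<bar> \<le> 1 / kr" for i
    using lattice_floor_eq_iff[OF h_pos, of a "lattice_floor h b"]
      lattice_floor_eq_iff[OF h_pos, of b "lattice_floor h b"] assms h_le[of i]
    by (auto simp: distrib_left abs_le_iff dest!: spec[of _ i])
  then have "norm (b - a) \<le> norm ((\<chi> i. 1 / kr) :: real ^ 'd)"
    using kr_pos by (intro norm_le_componentwise_cart) simp
  also have "\<dots> = sqrt (real CARD('d)) / kr"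
    using kr_pos by (simp add: norm_vec_def L2_set_constant)
  finally show ?thesis .
qed

text \<open>Origin of the constant 2d: the linking distance is at most d/k_n^{1/d} \<le> 2d h_i, so
  the indices differ by less than 2d + 1, hence by at most 2d.\<close>

lemma close_cells_near:
  assumes h: "\<And>i. 1 / (2 * kr) \<le> h $ i" and close: "norm (b - a) \<le> sqrt (real CARD('d)) / kr"
  shows "\<bar>lattice_floor h b $ i - lattice_floor h a $ i\<bar> \<le> 2 * int CARD('d)"
proof -
  define za zb where "za = lattice_floor h a $ i" and "zb = lattice_floor h b $ i"
  have a: "h $ i * of_int za \<le> a $ i" "a $ i < h $ i * (of_int za + 1)"
    and b: "h $ i * of_int zb \<le> b $ i" "b $ i < h $ i * (of_int zb + 1)"
    using lattice_floor_eq_iff[OF h_pos, of a "lattice_floor h a"]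
      lattice_floor_eq_iff[OF h_pos, of b "lattice_floor h b"]
    by (auto simp: za_def zb_def)
  have "sqrt (real CARD('d)) \<le> real CARD('d)"
    by (rule real_le_lsqrt) (auto simp: power2_eq_square Suc_le_eq)
  then have "sqrt (real CARD('d)) / kr \<le> real CARD('d) / kr"
    using kr_pos by (intro divide_right_mono) auto
  also have "\<dots> \<le> h $ i * (2 * real CARD('d))"
    using mult_right_mono[OF h[of i], of "2 * real CARD('d)"] by simp
  finally have "\<bar>b $ i - a $ i\<bar> \<le> h $ i * (2 * real CARD('d))"
    using close component_le_norm_cart[of "b - a" i] by simp
  then have "h $ i * of_int (zb - za) < h $ i * (2 * real CARD('d) + 1)"
    "h $ i * of_int (za - zb) < h $ i * (2 * real CARD('d) + 1)"
    using a b by (auto simp: algebra_simps)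
  then have "of_int (zb - za) < 2 * real CARD('d) + 1" "of_int (za - zb) < 2 * real CARD('d) + 1"
    using h_pos[of i] by (simp_all only: mult_less_cancel_left_pos)
  then show ?thesis unfolding za_def[symmetric] zb_def[symmetric] by linarith
qed

definition "hit_blocks \<omega> = {z \<in> Q. \<omega> \<in> hit (block z)}"

text \<open>Points of one block are within the clustering distance, and a chain leaving a block has to hit
  a nearby one; so without nearby pairs of hit blocks, clusters correspond to hit blocks.\<close>

lemma integral_cluster_process_hit_blocks:
  fixes f :: "real ^ 'd \<Rightarrow> real"
  assumes \<omega>: "\<omega> \<in> space M" and f: "continuous_on C f" and ctr: "cluster_point_rule ctr"
    and h: "\<And>i. 1 / (2 * kr) \<le> h $ i"
    and isolated: "\<And>z z'. z \<in> hit_blocks \<omega> \<Longrightarrow> z' \<in> hit_blocks \<omega> \<Longrightarrow>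
        (\<forall>i. \<bar>z' $ i - z $ i\<bar> \<le> 2 * int CARD('d)) \<Longrightarrow> z = z'"
    and interior: "\<And>z y. z \<in> hit_blocks \<omega> \<Longrightarrow> lattice_floor h y = z \<Longrightarrow> y \<in> C"
    and osc: "\<And>y y'. y \<in> C \<Longrightarrow> y' \<in> C \<Longrightarrow> lattice_floor h y = lattice_floor h y' \<Longrightarrow> \<bar>f y - f y'\<bar> \<le> \<epsilon>"
  shows "\<bar>(\<integral>y. f y \<partial>cluster_process C \<xi> ctr cn kn x \<omega>) - (\<Sum>z\<in>hit_blocks \<omega>. f (h * of_int_vec z))\<bar>
    \<le> \<epsilon> * real (card (hit_blocks \<omega>))"
proof -
  let ?\<Phi> = "exceedance_points C \<xi> cn kn x \<omega>"
  let ?l = "lattice_floor h"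
  have \<Phi>: "?\<Phi> = (\<lambda>v. vec_quot (of_int_vec v) cn) ` (\<Union>z\<in>Q. {v \<in> block z. x < \<xi> v \<omega>})"
    by (auto simp: exceedance_points_def D_tilde_def block_J_eq)
  have fin: "finite ?\<Phi>"
    unfolding \<Phi>
    by (intro finite_imageI finite_UN_I finite_Q) (rule finite_subset[OF _ finite_lattice_block], blast)
  have labels: "?l ` ?\<Phi> = hit_blocks \<omega>"
  proof -
    have "?l ` ?\<Phi> = (\<Union>z\<in>Q. (\<lambda>v. z) ` {v \<in> block z. x < \<xi> v \<omega>})"
      unfolding \<Phi> image_UN image_image using lattice_floor_point by (intro SUP_cong image_cong refl) auto
    also have "\<dots> = hit_blocks \<omega>" using \<omega> by (auto simp: hit_blocks_def hit_def)
    finally show ?thesis .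
  qed
  have near: "?l a = ?l b \<longleftrightarrow> norm (b - a) \<le> sqrt (real CARD('d)) / kr" if "a \<in> ?\<Phi>" "b \<in> ?\<Phi>" for a b
  proof
    assume "norm (b - a) \<le> sqrt (real CARD('d)) / kr"
    then have "\<forall>i. \<bar>?l b $ i - ?l a $ i\<bar> \<le> 2 * int CARD('d)"
      using close_cells_near[OF h] by blast
    then show "?l a = ?l b"
      using labels that by (intro isolated) auto
  qed (rule same_cell_close)
  define cell where "cell z = {a \<in> ?\<Phi>. ?l a = z}" for z
  have "(\<integral>y. f y \<partial>cluster_process C \<xi> ctr cn kn x \<omega>)
      = (\<Sum>z\<in>hit_blocks \<omega>. if ctr (cell z) \<in> C then f (ctr (cell z)) else 0)"
    using sum_clusters_eq_sum_labels[of ?\<Phi> ?l, OF near]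
    unfolding integral_cluster_process[OF compact_imp_closed[OF C_compact] f fin] cell_def labels kr_eq[symmetric] by simp
  \<comment> \<open>The cluster point is one of the points of its cluster, so it shares the cell
    with the corner h z. Thus it lies in C, is counted, and f changes by at most \<epsilon>.\<close>
  moreover have "ctr (cell z) \<in> C \<and> \<bar>f (ctr (cell z)) - f (h * of_int_vec z)\<bar> \<le> \<epsilon>" if "z \<in> hit_blocks \<omega>" for z
  proof -
    have "cell z \<noteq> {}" using that unfolding labels[symmetric] by (auto simp: cell_def)
    then have "ctr (cell z) \<in> cell z"
      using fin by (intro ctr_in_cluster ctr) (auto simp: cell_def)
    then have l: "?l (ctr (cell z)) = z" by (simp add: cell_def)
    moreover have "?l (h * of_int_vec z) = z" by (rule lattice_floor_of_int_vec) (rule h_pos)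
    ultimately show ?thesis using interior[OF that] osc by metis
  qed
  ultimately have "\<bar>(\<integral>y. f y \<partial>cluster_process C \<xi> ctr cn kn x \<omega>) - (\<Sum>z\<in>hit_blocks \<omega>. f (h * of_int_vec z))\<bar>
      = \<bar>\<Sum>z\<in>hit_blocks \<omega>. f (ctr (cell z)) - f (h * of_int_vec z)\<bar>"
    by (simp add: sum_subtractf)
  also have "\<dots> \<le> (\<Sum>z\<in>hit_blocks \<omega>. \<epsilon>)"
    by (rule order_trans[OF sum_abs sum_mono])
      (use \<open>\<And>z. z \<in> hit_blocks \<omega> \<Longrightarrow> ctr (cell z) \<in> C \<and> \<bar>f (ctr (cell z)) - f (h * of_int_vec z)\<bar> \<le> \<epsilon>\<close> in blast)
  finally show ?thesis by (simp add: mult.commute)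
qed

end

section \<open>Exceptional event and characteristic function for a fixed n\<close>

context cluster_blocks
begin

text \<open>A block is attributed to the cell of \<phi> that contains its rescaled lower corner,
  even if it straddles several cells.\<close>

definition "cells_in \<phi> J = {z \<in> Q. \<phi> (h * of_int_vec z) \<in> J}"

text \<open>Only in these blocks can a cluster point fall outside C and be discarded.\<close>

definition "boundary_cells = {z \<in> Q. \<exists>y. lattice_floor h y = z \<and> y \<notin> C}"

text \<open>The radius 2d is the one from \<open>close_cells_near\<close>.\<close>

definition "offsets = {- (\<chi> i. 2 * int CARD('d))..(\<chi> i. 2 * int CARD('d))} - {0 :: int ^ 'd}"

definition "bad_event = (\<Union>z\<in>Q. \<Union>e\<in>{e \<in> offsets. z + e \<in> Q}. hit (block z) \<inter> hit (block (z + e)))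
  \<union> (\<Union>z\<in>boundary_cells. hit (block z))"

lemma offsets: "finite offsets" "card offsets \<le> (4 * CARD('d) + 1) ^ CARD('d)"
proof -
  show "finite offsets" by (simp add: offsets_def finite_int_vec_interval)
  have "card offsets \<le> card {- (\<chi> i. 2 * int CARD('d))..(\<chi> i. 2 * int CARD('d)) :: int ^ 'd}"
    unfolding offsets_def by (intro card_mono) (auto simp: finite_int_vec_interval)
  also have "\<dots> = nat (4 * int CARD('d) + 1) ^ CARD('d)" by (simp add: card_int_vec_interval)
  also have "nat (4 * int CARD('d) + 1) = 4 * CARD('d) + 1" by linarith
  finally show "card offsets \<le> (4 * CARD('d) + 1) ^ CARD('d)" .
qed

lemma block_in_K: "z \<in> Q \<Longrightarrow> block z \<subseteq> K"
  using D_tilde_K by (auto simp: D_tilde_def block_J_eq)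

lemma finite_boundary_cells: "finite boundary_cells"
  using finite_Q by (simp add: boundary_cells_def)

lemma finite_cells_in: "finite (cells_in \<phi> J)"
  using finite_Q by (simp add: cells_in_def)

lemma bad_event_sets: "bad_event \<in> events"
  unfolding bad_event_def using finite_Q finite_boundary_cells offsets(1)
  by (intro sets.Un sets.finite_UN sets.Int) auto

text \<open>Both terms will vanish: \<open>card Q\<close> is O(k_n) against \<open>pair_err\<close>
  = o(1/k_n), and the number of boundary cells is o(k_n) against q = O(1/k_n).\<close>

lemma prob_bad_event:
  "prob bad_event \<le> real (card Q) * ((4 * real CARD('d) + 1) ^ CARD('d) * pair_err) + real (card boundary_cells) * q"
proof -
  let ?N = "\<lambda>z. {e \<in> offsets. z + e \<in> Q}"
  have N: "finite (?N z)" for z using offsets(1) by simp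
  have cardN: "real (card (?N z)) \<le> (4 * real CARD('d) + 1) ^ CARD('d)" for z
  proof -
    have "card (?N z) \<le> (4 * CARD('d) + 1) ^ CARD('d)"
      using card_mono[of offsets "?N z"] offsets by fastforce
    then have "real (card (?N z)) \<le> real ((4 * CARD('d) + 1) ^ CARD('d))" by (rule of_nat_mono)
    then show ?thesis by (simp add: add.commute)
  qed
  have 1: "prob (\<Union>e\<in>?N z. hit (block z) \<inter> hit (block (z + e))) \<le> (4 * real CARD('d) + 1) ^ CARD('d) * pair_err"
    if z: "z \<in> Q" for z
  proof -
    have "prob (\<Union>e\<in>?N z. hit (block z) \<inter> hit (block (z + e)))
        \<le> (\<Sum>e\<in>?N z. prob (hit (block z) \<inter> hit (block (z + e))))"
      using N by (intro finite_measure_subadditive_finite) auto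
    also have "\<dots> \<le> (\<Sum>e\<in>?N z. pair_err)"
      using z block_in_K by (intro sum_mono prob_two_blocks) (auto simp: offsets_def)
    also have "\<dots> \<le> (4 * real CARD('d) + 1) ^ CARD('d) * pair_err"
      using cardN[of z] pair_err_nonneg by (simp add: mult_right_mono)
    finally show ?thesis .
  qed
  have "prob (\<Union>z\<in>Q. \<Union>e\<in>?N z. hit (block z) \<inter> hit (block (z + e)))
      \<le> (\<Sum>z\<in>Q. prob (\<Union>e\<in>?N z. hit (block z) \<inter> hit (block (z + e))))"
    using finite_Q N by (intro finite_measure_subadditive_finite image_subsetI sets.finite_UN sets.Int) auto
  also have "\<dots> \<le> (\<Sum>z\<in>Q. (4 * real CARD('d) + 1) ^ CARD('d) * pair_err)"
    by (intro sum_mono 1)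
  finally have 2: "prob (\<Union>z\<in>Q. \<Union>e\<in>?N z. hit (block z) \<inter> hit (block (z + e)))
      \<le> real (card Q) * ((4 * real CARD('d) + 1) ^ CARD('d) * pair_err)" by simp
  have "prob (\<Union>z\<in>boundary_cells. hit (block z)) \<le> (\<Sum>z\<in>boundary_cells. prob (hit (block z)))"
    using finite_boundary_cells by (intro finite_measure_subadditive_finite) auto
  also have "\<dots> = (\<Sum>z\<in>boundary_cells. q)" by (intro sum.cong refl prob_block)
  finally have 3: "prob (\<Union>z\<in>boundary_cells. hit (block z)) \<le> real (card boundary_cells) * q" by simp
  have "prob bad_event \<le> prob (\<Union>z\<in>Q. \<Union>e\<in>?N z. hit (block z) \<inter> hit (block (z + e)))
      + prob (\<Union>z\<in>boundary_cells. hit (block z))"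
    unfolding bad_event_def using finite_Q finite_boundary_cells N
    by (intro measure_Un_le sets.finite_UN sets.Int) auto
  with 2 3 show ?thesis by linarith
qed

lemma not_bad_event:
  assumes "\<omega> \<notin> bad_event"
  shows "\<And>z z'. z \<in> hit_blocks \<omega> \<Longrightarrow> z' \<in> hit_blocks \<omega> \<Longrightarrow>
        (\<forall>i. \<bar>z' $ i - z $ i\<bar> \<le> 2 * int CARD('d)) \<Longrightarrow> z = z'"
    "\<And>z y. z \<in> hit_blocks \<omega> \<Longrightarrow> lattice_floor h y = z \<Longrightarrow> y \<in> C"
proof -
  fix z z' assume z: "z \<in> hit_blocks \<omega>" "z' \<in> hit_blocks \<omega>" "\<forall>i. \<bar>z' $ i - z $ i\<bar> \<le> 2 * int CARD('d)"
  show "z = z'"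
  proof (rule ccontr)
    assume "z \<noteq> z'"
    have "- (2 * int CARD('d)) \<le> z' $ i - z $ i \<and> z' $ i - z $ i \<le> 2 * int CARD('d)" for i
      using z(3)[rule_format, of i] by linarith
    then have "z' - z \<in> offsets"
      using \<open>z \<noteq> z'\<close> by (simp add: offsets_def less_eq_vec_def)
    then have "\<omega> \<in> bad_event"
      using z(1,2) unfolding bad_event_def hit_blocks_def
      by (intro UnI1 UN_I[of z] UN_I[of "z' - z"]) auto
    then show False using assms by simp
  qed
next
  fix z y assume "z \<in> hit_blocks \<omega>" "lattice_floor h y = z"
  then show "y \<in> C"
    using assms by (auto simp: bad_event_def hit_blocks_def boundary_cells_def)
qed

text \<open>The counts are numbers of hit blocks per cell, whose means are explicit multiples of q;
  the clusters have to agree with them only off \<open>bad_event\<close>. Of the two \<epsilon>, one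
  moves the cluster point to the block corner and the other replaces f by the step function.\<close>

lemma char_fn_cluster_process:
  fixes f :: "real ^ 'd \<Rightarrow> real" and \<phi> :: "real ^ 'd \<Rightarrow> 'i"
  assumes f: "continuous_on C f" and ctr: "cluster_point_rule ctr"
    and h: "\<And>i. 1 / (2 * kr) \<le> h $ i"
    and osc: "\<And>y y'. y \<in> C \<Longrightarrow> y' \<in> C \<Longrightarrow> lattice_floor h y = lattice_floor h y' \<Longrightarrow> \<bar>f y - f y'\<bar> \<le> \<epsilon>"
    and I: "finite I" "\<phi> ` C \<subseteq> I"
    and b: "\<And>y. y \<in> C \<Longrightarrow> \<bar>f y - b (\<phi> y)\<bar> \<le> \<epsilon>" "\<And>i. i \<in> I \<Longrightarrow> \<bar>b i\<bar> \<le> B" and "0 \<le> \<epsilon>"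
  defines "void \<equiv> \<lambda>J. 1 - prob (hit (\<Union>z\<in>cells_in \<phi> J. block z))"
  shows "cmod ((CLINT \<omega>|M. iexp (s * (\<integral>y. f y \<partial>cluster_process C \<xi> ctr cn kn x \<omega>)))
      - (\<Sum>J\<in>Pow I. occupancy_coeff I b s J * void J))
    \<le> 2 * (real (card Q) * ((4 * real CARD('d) + 1) ^ CARD('d) * pair_err) + real (card boundary_cells) * q)
      + \<bar>s\<bar> * (2 * \<epsilon> * (q * real (card Q)) + B * (\<Sum>i\<in>I. q * real (card (cells_in \<phi> {i})) - 1 + void {i}))"
proof -
  define Kc where "Kc i \<omega> = (\<Sum>z\<in>cells_in \<phi> {i}. indicator (hit (block z)) \<omega> :: real)" for i \<omega>
  have ind_int: "integrable M (\<lambda>\<omega>. indicator (hit (block z)) \<omega> :: real)" for z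
    by (simp add: less_top[symmetric])
  have Kc_int: "integrable M (Kc i)" for i
    unfolding Kc_def using ind_int by (intro Bochner_Integration.integrable_sum)
  have Kc_exp: "expectation (Kc i) = q * real (card (cells_in \<phi> {i}))" for i
  proof -
    have "expectation (Kc i) = (\<Sum>z\<in>cells_in \<phi> {i}. prob (hit (block z)))"
      unfolding Kc_def using ind_int by (subst Bochner_Integration.integral_sum) auto
    also have "\<dots> = (\<Sum>z\<in>cells_in \<phi> {i}. q)" by (intro sum.cong refl prob_block)
    finally show ?thesis by simp
  qed
  have Kc_0: "Kc i \<omega> = 0 \<longleftrightarrow> (\<forall>z\<in>cells_in \<phi> {i}. \<omega> \<notin> hit (block z))" for i \<omega>
    unfolding Kc_def using finite_cells_in by (subst sum_nonneg_eq_0_iff) (auto simp: indicator_def)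
  have Kc_01: "Kc i \<omega> = 0 \<or> 1 \<le> Kc i \<omega>" for i \<omega>
  proof -
    have "Kc i \<omega> = real (card (cells_in \<phi> {i} \<inter> {z. \<omega> \<in> hit (block z)}))"
      unfolding Kc_def indicator_def by (simp add: finite_cells_in)
    then show ?thesis by (auto simp: Suc_le_eq)
  qed
  have void: "\<P>(\<omega> in M. \<forall>i\<in>J. Kc i \<omega> = 0) = void J" for J
  proof -
    have "{\<omega> \<in> space M. \<forall>i\<in>J. Kc i \<omega> = 0} = space M - hit (\<Union>z\<in>cells_in \<phi> J. block z)"
      unfolding Kc_0 hit_UN by (auto simp: cells_in_def)
    then show ?thesis by (simp add: void_def prob_compl)
  qed
  have group: "(\<Sum>i\<in>I. F i * Kc i \<omega>) = (\<Sum>z\<in>hit_blocks \<omega>. F (\<phi> (h * of_int_vec z)))" for F :: "'i \<Rightarrow> real" and \<omega>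
  proof -
    have "(\<Sum>i\<in>I. F i * Kc i \<omega>)
        = (\<Sum>i\<in>I. \<Sum>z\<in>{z \<in> Q. \<phi> (h * of_int_vec z) = i}. F (\<phi> (h * of_int_vec z)) * indicator (hit (block z)) \<omega>)"
      unfolding Kc_def sum_distrib_left by (intro sum.cong) (auto simp: cells_in_def)
    also have "\<dots> = (\<Sum>z\<in>Q. F (\<phi> (h * of_int_vec z)) * indicator (hit (block z)) \<omega>)"
      using finite_Q I by (intro sum.group) (auto simp: Q_eq)
    also have "\<dots> = (\<Sum>z\<in>hit_blocks \<omega>. F (\<phi> (h * of_int_vec z)))"
      using finite_Q by (auto simp: hit_blocks_def indicator_def intro!: sum.mono_neutral_cong_right)
    finally show ?thesis .
  qed
  have finite_D: "finite (D_tilde C cn kn)"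
    unfolding D_tilde_def block_J_eq using finite_Q finite_lattice_block by auto
  have "cmod ((CLINT \<omega>|M. iexp (s * (\<integral>y. f y \<partial>cluster_process C \<xi> ctr cn kn x \<omega>)))
      - (\<Sum>J\<in>Pow I. occupancy_coeff I b s J * \<P>(\<omega> in M. \<forall>i\<in>J. Kc i \<omega> = 0)))
    \<le> 2 * prob bad_event + \<bar>s\<bar> * (2 * \<epsilon> * (\<Sum>i\<in>I. expectation (Kc i))
        + B * (\<Sum>i\<in>I. expectation (Kc i) - 1 + \<P>(\<omega> in M. Kc i \<omega> = 0)))"
  proof (rule char_fn_occupancy[OF I(1) _ bad_event_sets])
    show "(\<lambda>\<omega>. \<integral>y. f y \<partial>cluster_process C \<xi> ctr cn kn x \<omega>) \<in> borel_measurable M"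
      using C_compact f finite_D by (intro integral_cluster_process_measurable compact_imp_closed) auto
    show "AE \<omega> in M. \<omega> \<notin> bad_event \<longrightarrow>
        \<bar>(\<integral>y. f y \<partial>cluster_process C \<xi> ctr cn kn x \<omega>) - (\<Sum>i\<in>I. b i * Kc i \<omega>)\<bar> \<le> 2 * \<epsilon> * (\<Sum>i\<in>I. Kc i \<omega>)"
    proof (intro AE_I2 impI)
      fix \<omega> assume \<omega>: "\<omega> \<in> space M" "\<omega> \<notin> bad_event"
      have "\<bar>(\<Sum>z\<in>hit_blocks \<omega>. f (h * of_int_vec z)) - (\<Sum>i\<in>I. b i * Kc i \<omega>)\<bar>
          = \<bar>\<Sum>z\<in>hit_blocks \<omega>. f (h * of_int_vec z) - b (\<phi> (h * of_int_vec z))\<bar>"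
        by (simp add: group sum_subtractf)
      also have "\<dots> \<le> (\<Sum>z\<in>hit_blocks \<omega>. \<epsilon>)"
        by (rule order_trans[OF sum_abs sum_mono]) (use b(1) in \<open>auto simp: hit_blocks_def Q_eq\<close>)
      finally have "\<bar>(\<Sum>z\<in>hit_blocks \<omega>. f (h * of_int_vec z)) - (\<Sum>i\<in>I. b i * Kc i \<omega>)\<bar>
          \<le> \<epsilon> * real (card (hit_blocks \<omega>))" by (simp add: mult.commute)
      moreover have "\<bar>(\<integral>y. f y \<partial>cluster_process C \<xi> ctr cn kn x \<omega>) - (\<Sum>z\<in>hit_blocks \<omega>. f (h * of_int_vec z))\<bar>
          \<le> \<epsilon> * real (card (hit_blocks \<omega>))"
        by (rule integral_cluster_process_hit_blocks[OF \<omega>(1) f ctr h not_bad_event[OF \<omega>(2)] osc])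
      moreover have "(\<Sum>i\<in>I. Kc i \<omega>) = real (card (hit_blocks \<omega>))"
        using group[of "\<lambda>_. 1" \<omega>] by simp
      ultimately show "\<bar>(\<integral>y. f y \<partial>cluster_process C \<xi> ctr cn kn x \<omega>) - (\<Sum>i\<in>I. b i * Kc i \<omega>)\<bar>
          \<le> 2 * \<epsilon> * (\<Sum>i\<in>I. Kc i \<omega>)"
        by simp
    qed
  qed (use Kc_int Kc_01 b(2) \<open>0 \<le> \<epsilon>\<close> in auto)
  also have "(\<Sum>i\<in>I. expectation (Kc i)) = q * real (card Q)"
  proof -
    have "(\<Sum>i\<in>I. real (card (cells_in \<phi> {i}))) = real (card Q)"
      using sum.group[OF finite_Q I(1), of "\<lambda>z. \<phi> (h * of_int_vec z)" "\<lambda>_. 1::real"] I(2)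
      by (auto simp: cells_in_def Q_eq image_subset_iff)
    then show ?thesis by (simp add: Kc_exp flip: sum_distrib_left)
  qed
  also have "(\<Sum>i\<in>I. expectation (Kc i) - 1 + \<P>(\<omega> in M. Kc i \<omega> = 0))
      = (\<Sum>i\<in>I. q * real (card (cells_in \<phi> {i})) - 1 + void {i})"
  proof (intro sum.cong refl)
    fix i
    show "expectation (Kc i) - 1 + \<P>(\<omega> in M. Kc i \<omega> = 0) = q * real (card (cells_in \<phi> {i})) - 1 + void {i}"
      using void[of "{i}"] by (simp add: Kc_exp)
  qed
  finally show ?thesis
    unfolding void by (rule order_trans) (intro add_right_mono mult_left_mono prob_bad_event, simp)
qed

end

subsection \<open>Asymptotics\<close>

locale extremal_field = prob_space M for M :: "'w measure" +
  fixes C :: "(real ^ 'd) set" and p :: nat and c :: "nat \<Rightarrow> real ^ 'd"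
    and \<xi> :: "int ^ 'd \<Rightarrow> 'w \<Rightarrow> real" and x :: "nat \<Rightarrow> real" and \<kappa> :: real
    and \<gamma> :: "nat \<Rightarrow> real ^ 'd" and \<alpha> :: "nat \<Rightarrow> real" and k :: "nat \<Rightarrow> nat"
    and R :: "(int ^ 'd) rel" and \<theta> \<tau> :: real
    and kr :: "nat \<Rightarrow> real"
  assumes C_p_convex: "p_convex p C"
    and C_volume: "measure lborel C = 1"
    and c_pos: "\<And>n i. 0 < c n $ i"
    and c_unbounded: "\<And>i. filterlim (\<lambda>n. c n $ i) at_top sequentially"
    and \<xi>_stationary: "stationary_field M \<xi>"
    and k_pos: "\<And>n. 0 < k n"
    and k_unbounded: "filterlim k at_top sequentially"
    and kr_eq: "\<And>n. kr n = root CARD('d) (real (k n))"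
    and k_small: "\<And>i. (\<lambda>n. kr n / c n $ i) \<longlonglongrightarrow> 0"
    and D_plus_subset: "\<And>n. D_plus C (c n) (k n) \<subseteq> K_box \<kappa> (c n)"
    and mixing: "cond_D M \<xi> c x (\<lambda>n. K_box \<kappa> (c n)) \<gamma> \<alpha>"
    and k_\<alpha>: "(\<lambda>n. real (k n) * \<alpha> n) \<longlonglongrightarrow> 0"
    and k_\<gamma>: "\<And>i. (\<lambda>n. kr n * \<gamma> n $ i / c n $ i) \<longlonglongrightarrow> 0"
    and R_order: "translation_invariant_total_order R"
    and local_cond: "cond_D_local M \<xi> c R x k \<theta>"
    and \<theta>_pos: "0 < \<theta>" and \<tau>_pos: "0 < \<tau>"
    and exceedances:
      "(\<lambda>n. real (card (lattice_points (scale_set (c n) C))) * \<P>(\<omega> in M. \<xi> 0 \<omega> > x n)) \<longlonglongrightarrow> \<tau>"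
begin

sublocale field: random_field M \<xi> "x n" for n
  by unfold_locales (rule \<xi>_stationary)

text \<open>The following restate the quantities of the fixed-n locales as sequences, because those
  locales can be interpreted only for large n while the limits concern whole sequences.\<close>

definition "T n = (\<chi> i. \<lfloor>c n $ i / kr n\<rfloor>)"
definition "g n = (\<chi> i. \<lceil>\<bar>\<gamma> n $ i\<bar>\<rceil>)"
definition "h n = vec_quot (of_int_vec (T n)) (c n)"
definition "pr n = prob (field.hit n {0})"
definition "q n = prob (field.hit n (lattice_block (T n) 0))"
definition "gap_err n = (real (card (lattice_block (T n) 0)) - real (card (shrunk_block (T n) (g n) 0))) * pr n"
definition "pair_err n = (q n)\<^sup>2 + \<alpha> n + 2 * gap_err n"

lemma C_compact: "compact C" and C_Jordan: "negligible (frontier C)"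
  using p_convex_Jordan[OF C_p_convex] by auto

lemma kr_pos: "0 < kr n"
  using k_pos[of n] by (simp add: kr_eq)

lemma kr_power: "kr n ^ CARD('d) = real (k n)"
  using k_pos[of n] by (simp add: kr_eq real_root_pow_pos2)

lemma kr_at_top: "filterlim kr at_top sequentially"
  unfolding filterlim_at_top
proof
  fix B :: real
  have "\<forall>\<^sub>F n in sequentially. nat \<lceil>\<bar>B\<bar> ^ CARD('d)\<rceil> \<le> k n"
    using k_unbounded unfolding filterlim_at_top by blast
  then show "\<forall>\<^sub>F n in sequentially. B \<le> kr n"
  proof eventually_elim
    case (elim n)
    then have "\<bar>B\<bar> ^ CARD('d) \<le> real (k n)" by linarith
    then have "\<bar>B\<bar> ^ CARD('d) \<le> kr n ^ CARD('d)" by (simp add: kr_power)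
    then have "\<bar>B\<bar> \<le> kr n" using kr_pos[of n] by (simp add: power_mono_iff)
    then show ?case by simp
  qed
qed

lemma h_eq: "h n $ i = of_int (T n $ i) / c n $ i"
  by (simp add: h_def vec_quot_def of_int_vec_def)

lemma T_bounds: "of_int (T n $ i) \<le> c n $ i / kr n" "c n $ i / kr n < of_int (T n $ i) + 1"
  unfolding T_def by (simp_all add: of_int_floor_le)

text \<open>Rounding the side down loses less than 1, so h_i k_n^{1/d} lies between 1 -
  k_n^{1/d}/c_{n,i} and 1.\<close>

lemma h_kr_lim: "(\<lambda>n. h n $ i * kr n) \<longlonglongrightarrow> 1"
proof (rule tendsto_sandwich[OF _ _ _ tendsto_const])
  show "(\<lambda>n. 1 - kr n / c n $ i) \<longlonglongrightarrow> 1" using tendsto_diff[OF tendsto_const k_small] by force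
  show "\<forall>\<^sub>F n in sequentially. 1 - kr n / c n $ i \<le> h n $ i * kr n"
  proof (intro always_eventually allI)
    fix n
    have "c n $ i - kr n \<le> of_int (T n $ i) * kr n"
      using T_bounds(2)[of n i] kr_pos[of n] by (simp add: pos_divide_less_eq algebra_simps)
    then have "(c n $ i - kr n) / c n $ i \<le> of_int (T n $ i) * kr n / c n $ i"
      using c_pos[of n i] by (intro divide_right_mono) auto
    then show "1 - kr n / c n $ i \<le> h n $ i * kr n"
      using c_pos[of n i] by (simp add: h_eq diff_divide_distrib)
  qed
  show "\<forall>\<^sub>F n in sequentially. h n $ i * kr n \<le> 1"
    using T_bounds(1)[of _ i] c_pos[of _ i] kr_pos
    by (intro always_eventually allI) (simp add: h_eq field_simps)
qed

lemma h_lower: "\<forall>\<^sub>F n in sequentially. \<forall>i. 1 / (2 * kr n) \<le> h n $ i"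
proof (rule eventually_all_finite)
  fix i
  have "\<forall>\<^sub>F n in sequentially. 1 / 2 < h n $ i * kr n"
    by (rule order_tendstoD(1)[OF h_kr_lim]) simp
  then show "\<forall>\<^sub>F n in sequentially. 1 / (2 * kr n) \<le> h n $ i"
    by eventually_elim (use kr_pos in \<open>simp add: field_simps\<close>)
qed

lemma h_pos: "\<forall>\<^sub>F n in sequentially. \<forall>i. 0 < h n $ i"
  using h_lower
proof eventually_elim
  case (elim n)
  have "0 < 1 / (2 * kr n)" using kr_pos[of n] by simp
  then show ?case using elim less_le_trans by blast
qed

lemma T_pos: "\<forall>\<^sub>F n in sequentially. \<forall>i. 0 < T n $ i"
  using h_pos by eventually_elim (use c_pos in \<open>simp add: h_eq zero_less_divide_iff\<close>, metis less_asym)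

lemma h_lim: "(\<lambda>n. h n $ i) \<longlonglongrightarrow> 0"
proof -
  have "(\<lambda>n. h n $ i * kr n * inverse (kr n)) \<longlonglongrightarrow> 1 * 0"
    by (intro tendsto_mult h_kr_lim tendsto_inverse_0_at_top kr_at_top)
  moreover have "h n $ i * kr n * inverse (kr n) = h n $ i" for n
    using kr_pos[of n] by simp
  ultimately show ?thesis by simp
qed

lemma T_at_top: "filterlim (\<lambda>n. real_of_int (T n $ i)) at_top sequentially"
proof -
  have "filterlim (\<lambda>n. c n $ i / kr n) at_top sequentially"
  proof -
    have "filterlim (\<lambda>n. inverse (kr n / c n $ i)) at_top sequentially"
      using kr_pos c_pos by (intro filterlim_inverse_at_top k_small) simp
    then show ?thesis by simp
  qed
  then have "filterlim (\<lambda>n. - 1 + c n $ i / kr n) at_top sequentially"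
    by (rule filterlim_tendsto_add_at_top[OF tendsto_const])
  then show ?thesis
    by (rule filterlim_at_top_mono) (use T_bounds(2) in \<open>auto simp: less_imp_le algebra_simps\<close>)
qed

lemma k_prod_h_lim: "(\<lambda>n. real (k n) * (\<Prod>i\<in>UNIV. h n $ i)) \<longlonglongrightarrow> 1"
proof -
  have "(\<lambda>n. \<Prod>i\<in>(UNIV :: 'd set). h n $ i * kr n) \<longlonglongrightarrow> (\<Prod>i\<in>(UNIV :: 'd set). 1)"
    by (intro tendsto_prod h_kr_lim)
  then show ?thesis by (simp add: prod.distrib kr_power mult.commute)
qed

text \<open>By \<open>k_prod_h_lim\<close> the volume of a cell is asymptotically 1/k_n, so counts
  can be normalised by k_n.\<close>

lemma card_over_k_lim:
  assumes "(\<lambda>n. (\<Prod>i\<in>UNIV. h n $ i) * real (m n)) \<longlonglongrightarrow> l"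
  shows "(\<lambda>n. real (m n) / real (k n)) \<longlonglongrightarrow> l"
proof -
  have "(\<lambda>n. ((\<Prod>i\<in>UNIV. h n $ i) * real (m n)) / (real (k n) * (\<Prod>i\<in>UNIV. h n $ i))) \<longlonglongrightarrow> l / 1"
    by (intro tendsto_divide assms k_prod_h_lim) simp
  moreover have "\<forall>\<^sub>F n in sequentially. ((\<Prod>i\<in>UNIV. h n $ i) * real (m n)) / (real (k n) * (\<Prod>i\<in>UNIV. h n $ i)) = real (m n) / real (k n)"
    using h_pos by eventually_elim (simp add: less_imp_neq[symmetric] prod_zero_iff)
  ultimately have "(\<lambda>n. real (m n) / real (k n)) \<longlonglongrightarrow> l / 1"
    by (rule Lim_transform_eventually)
  then show ?thesis by simp
qed

lemma card_cells_lim: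
  assumes "A \<subseteq> C" "A \<in> sets borel" "negligible (frontier A)"
  shows "(\<lambda>n. real (card {z. h n * of_int_vec z \<in> A}) / real (k n)) \<longlonglongrightarrow> measure lborel A"
  using assms C_compact
  by (intro card_over_k_lim card_lattice_in_Jordan_set(2) h_pos h_lim)
    (auto intro: bounded_subset compact_imp_bounded)

lemma card_boundary_lim:
  "(\<lambda>n. real (card {z. h n * of_int_vec z \<in> C \<and> (\<exists>y. lattice_floor (h n) y = z \<and> y \<notin> C)}) / real (k n)) \<longlonglongrightarrow> 0"
  using C_compact C_Jordan
  by (intro card_over_k_lim card_boundary_cells h_pos h_lim) (auto intro: compact_imp_bounded)

text \<open>Counting with cells of sides 1/c_{n,i} gives |D_n| divided by the product of the c_{n,i}
  tending to |C| = 1, so |D_n| can be replaced by that product.\<close>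

lemma pr_prod_c_lim: "(\<lambda>n. pr n * (\<Prod>i\<in>UNIV. c n $ i)) \<longlonglongrightarrow> \<tau>"
proof -
  define w where "w n = (\<chi> i. inverse (c n $ i))" for n
  have w: "lattice_points (scale_set (c n) C) = {z. w n * of_int_vec z \<in> C}" for n
  proof -
    have "of_int_vec z \<in> scale_set (c n) C \<longleftrightarrow> w n * of_int_vec z \<in> C" for z
    proof
      assume "of_int_vec z \<in> scale_set (c n) C"
      then obtain a where a: "a \<in> C" "of_int_vec z = c n * a" by (auto simp: scale_set_def)
      have "w n * of_int_vec z = a"
        using c_pos[of n] by (simp add: a vec_eq_iff w_def less_imp_neq[symmetric] flip: mult.assoc)
      then show "w n * of_int_vec z \<in> C" using a by simp
    next
      assume "w n * of_int_vec z \<in> C"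
      moreover have "of_int_vec z = c n * (w n * of_int_vec z)"
        using c_pos[of n] by (simp add: vec_eq_iff w_def less_imp_neq[symmetric] flip: mult.assoc)
      ultimately show "of_int_vec z \<in> scale_set (c n) C" unfolding scale_set_def by (metis imageI)
    qed
    then show ?thesis by (auto simp: lattice_points_def)
  qed
  have "(\<lambda>n. (\<Prod>i\<in>UNIV. w n $ i) * real (card {z. w n * of_int_vec z \<in> C})) \<longlonglongrightarrow> measure lborel C"
  proof (rule card_lattice_in_Jordan_set(2))
    show "\<forall>\<^sub>F n in sequentially. \<forall>i. 0 < w n $ i" using c_pos by (simp add: w_def)
    show "(\<lambda>n. w n $ i) \<longlonglongrightarrow> 0" for i
      unfolding w_def by (simp add: tendsto_inverse_0_at_top c_unbounded)
  qed (use C_compact C_Jordan in \<open>auto simp: compact_imp_bounded borel_compact\<close>)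
  then have 1: "(\<lambda>n. (\<Prod>i\<in>UNIV. w n $ i) * real (card (lattice_points (scale_set (c n) C)))) \<longlonglongrightarrow> 1"
    by (simp add: w C_volume)
  have "(\<lambda>n. real (card (lattice_points (scale_set (c n) C))) * pr n) \<longlonglongrightarrow> \<tau>"
    using exceedances by (simp add: pr_def field.hit_def)
  then have "(\<lambda>n. real (card (lattice_points (scale_set (c n) C))) * pr n /
      ((\<Prod>i\<in>UNIV. w n $ i) * real (card (lattice_points (scale_set (c n) C))))) \<longlonglongrightarrow> \<tau> / 1"
    by (intro tendsto_divide 1) simp_all
  moreover have "\<forall>\<^sub>F n in sequentially. real (card (lattice_points (scale_set (c n) C))) * pr n /
      ((\<Prod>i\<in>UNIV. w n $ i) * real (card (lattice_points (scale_set (c n) C)))) = pr n * (\<Prod>i\<in>UNIV. c n $ i)"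
    using order_tendstoD(1)[OF 1, of 0, simplified]
  proof eventually_elim
    case (elim n)
    have "(\<Prod>i\<in>UNIV. w n $ i) = 1 / (\<Prod>i\<in>UNIV. c n $ i)"
      by (simp add: w_def inverse_eq_divide prod_dividef)
    moreover have "(\<Prod>i\<in>UNIV. c n $ i) \<noteq> 0" using c_pos[of n] by (simp add: less_imp_neq[symmetric])
    moreover have "real (card (lattice_points (scale_set (c n) C))) \<noteq> 0" using elim by (metis mult_zero_right less_irrefl)
    ultimately show ?case by (simp only:) (simp del: prod_zero_iff)
  qed
  ultimately have "(\<lambda>n. pr n * (\<Prod>i\<in>UNIV. c n $ i)) \<longlonglongrightarrow> \<tau> / 1"
    by (rule Lim_transform_eventually)
  then show ?thesis by simp
qed

text \<open>This is the expected number of exceedances in k_n blocks, whose total size is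
  asymptotically that of D_n.\<close>

lemma k_block_pr_lim: "(\<lambda>n. real (k n) * real (card (lattice_block (T n) 0)) * pr n) \<longlonglongrightarrow> \<tau>"
proof -
  have "(\<lambda>n. (real (k n) * (\<Prod>i\<in>UNIV. h n $ i)) * (pr n * (\<Prod>i\<in>UNIV. c n $ i))) \<longlonglongrightarrow> 1 * \<tau>"
    by (intro tendsto_mult k_prod_h_lim pr_prod_c_lim)
  moreover have "\<forall>\<^sub>F n in sequentially. (real (k n) * (\<Prod>i\<in>UNIV. h n $ i)) * (pr n * (\<Prod>i\<in>UNIV. c n $ i))
      = real (k n) * real (card (lattice_block (T n) 0)) * pr n"
    using T_pos
  proof eventually_elim
    case (elim n)
    have "(\<Prod>i\<in>UNIV. c n $ i) \<noteq> 0" using c_pos[of n] by (simp add: less_imp_neq[symmetric])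
    moreover have "real (card (lattice_block (T n) 0)) = (\<Prod>i\<in>UNIV. real_of_int (T n $ i))"
      using elim by (intro card_lattice_block) auto
    ultimately show ?case by (simp add: h_eq prod_dividef field_simps)
  qed
  ultimately have "(\<lambda>n. real (k n) * real (card (lattice_block (T n) 0)) * pr n) \<longlonglongrightarrow> 1 * \<tau>"
    by (rule Lim_transform_eventually)
  then show ?thesis by simp
qed

text \<open>Here k_n^{1/d} \<gamma>_n = o(c_n) enters: up to the factor h_i k_n^{1/d}, which tends
  to 1, it controls |\<gamma>_i|/T_i. Rounding up adds at most 1/T_i.\<close>

lemma g_over_T_lim: "(\<lambda>n. real_of_int (g n $ i) / real_of_int (T n $ i)) \<longlonglongrightarrow> 0"
proof -
  have "(\<lambda>n. \<bar>kr n * \<gamma> n $ i / c n $ i\<bar> / (h n $ i * kr n) + inverse (real_of_int (T n $ i))) \<longlonglongrightarrow> \<bar>0\<bar> / 1 + 0"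
    by (intro tendsto_add tendsto_divide tendsto_rabs k_\<gamma> h_kr_lim tendsto_inverse_0_at_top T_at_top) simp
  then have upper: "(\<lambda>n. \<bar>kr n * \<gamma> n $ i / c n $ i\<bar> / (h n $ i * kr n) + inverse (real_of_int (T n $ i))) \<longlonglongrightarrow> 0"
    by simp
  show ?thesis
  proof (rule tendsto_sandwich[OF _ _ tendsto_const upper])
    show "\<forall>\<^sub>F n in sequentially. 0 \<le> real_of_int (g n $ i) / real_of_int (T n $ i)"
      using T_pos by eventually_elim (auto simp: g_def less_imp_le intro!: divide_nonneg_nonneg)
    show "\<forall>\<^sub>F n in sequentially. real_of_int (g n $ i) / real_of_int (T n $ i)
        \<le> \<bar>kr n * \<gamma> n $ i / c n $ i\<bar> / (h n $ i * kr n) + inverse (real_of_int (T n $ i))"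
      using T_pos
    proof eventually_elim
      case (elim n)
      have T: "0 < real_of_int (T n $ i)" using elim by simp
      have "real_of_int (g n $ i) \<le> \<bar>\<gamma> n $ i\<bar> + 1" by (simp add: g_def)
      then have "real_of_int (g n $ i) / real_of_int (T n $ i) \<le> (\<bar>\<gamma> n $ i\<bar> + 1) / real_of_int (T n $ i)"
        using T by (intro divide_right_mono) auto
      also have "\<dots> = \<bar>kr n * \<gamma> n $ i / c n $ i\<bar> / (h n $ i * kr n) + inverse (real_of_int (T n $ i))"
        using T kr_pos[of n] c_pos[of n i] by (simp add: h_eq abs_mult abs_divide field_simps)
      finally show ?case .
    qed
  qed
qed

lemma g_le_T: "\<forall>\<^sub>F n in sequentially. \<forall>i. g n $ i \<le> T n $ i"
proof (rule eventually_all_finite)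
  fix i
  have "\<forall>\<^sub>F n in sequentially. real_of_int (g n $ i) / real_of_int (T n $ i) < 1"
    by (rule order_tendstoD(2)[OF g_over_T_lim]) simp
  then show "\<forall>\<^sub>F n in sequentially. g n $ i \<le> T n $ i"
    using T_pos by eventually_elim (simp add: less_imp_le)
qed

text \<open>The core has the fraction \<Prod>(1 - g_i/T_i) of the points of its block; this tends to
  1, while k_n blocks carry \<tau> exceedances on average.\<close>

lemma k_gap_err_lim: "(\<lambda>n. real (k n) * gap_err n) \<longlonglongrightarrow> 0"
proof -
  have "(\<lambda>n. \<Prod>i\<in>(UNIV :: 'd set). 1 - real_of_int (g n $ i) / real_of_int (T n $ i)) \<longlonglongrightarrow> (\<Prod>i\<in>(UNIV :: 'd set). 1 - 0)"
    by (intro tendsto_prod tendsto_diff tendsto_const g_over_T_lim)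
  then have "(\<lambda>n. real (k n) * real (card (lattice_block (T n) 0)) * pr n *
      (1 - (\<Prod>i\<in>UNIV. 1 - real_of_int (g n $ i) / real_of_int (T n $ i)))) \<longlonglongrightarrow> \<tau> * (1 - 1)"
    by (intro tendsto_mult tendsto_diff tendsto_const k_block_pr_lim) simp
  moreover have "\<forall>\<^sub>F n in sequentially. real (k n) * real (card (lattice_block (T n) 0)) * pr n *
      (1 - (\<Prod>i\<in>UNIV. 1 - real_of_int (g n $ i) / real_of_int (T n $ i))) = real (k n) * gap_err n"
    using T_pos g_le_T
  proof eventually_elim
    case (elim n)
    have T: "real_of_int (T n $ i) \<noteq> 0" for i using elim(1)[rule_format, of i] by simp
    have "(\<Prod>i\<in>UNIV. 1 - real_of_int (g n $ i) / real_of_int (T n $ i))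
        = (\<Prod>i\<in>UNIV. real_of_int (T n $ i - g n $ i) / real_of_int (T n $ i))"
      using T by (intro prod.cong) (auto simp: diff_divide_distrib)
    also have "\<dots> = real (card (shrunk_block (T n) (g n) 0)) / real (card (lattice_block (T n) 0))"
      using elim by (simp add: card_lattice_block card_shrunk_block prod_dividef)
    finally have "(\<Prod>i\<in>UNIV. 1 - real_of_int (g n $ i) / real_of_int (T n $ i))
      = real (card (shrunk_block (T n) (g n) 0)) / real (card (lattice_block (T n) 0))" .
    moreover have "real (card (lattice_block (T n) 0)) \<noteq> 0"
      using elim T by (simp add: card_lattice_block)
    ultimately show ?case by (simp add: gap_err_def field_simps)
  qed
  ultimately have "(\<lambda>n. real (k n) * gap_err n) \<longlonglongrightarrow> \<tau> * (1 - 1)"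
    by (rule Lim_transform_eventually)
  then show ?thesis by simp
qed

lemma one_over_k_lim: "(\<lambda>n. 1 / real (k n)) \<longlonglongrightarrow> 0"
  using tendsto_inverse_0_at_top[OF filterlim_compose[OF filterlim_real_sequentially k_unbounded]]
  by (simp add: inverse_eq_divide)

text \<open>Only the union bound q \<le> |block| P(\<xi>_0 > x_n) = O(1/k_n) is used: the exact
  limit of k_n q depends on \<open>pair_err\<close>, hence on this estimate.\<close>

lemma k_q_square_lim: "(\<lambda>n. real (k n) * (q n)\<^sup>2) \<longlonglongrightarrow> 0"
proof -
  have "(\<lambda>n. (real (k n) * real (card (lattice_block (T n) 0)) * pr n)\<^sup>2 * (1 / real (k n))) \<longlonglongrightarrow> \<tau>\<^sup>2 * 0"
    by (intro tendsto_mult tendsto_power k_block_pr_lim one_over_k_lim)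
  then have upper: "(\<lambda>n. (real (k n) * real (card (lattice_block (T n) 0)) * pr n)\<^sup>2 * (1 / real (k n))) \<longlonglongrightarrow> 0"
    by simp
  show ?thesis
  proof (rule tendsto_sandwich[OF _ _ tendsto_const upper])
    show "\<forall>\<^sub>F n in sequentially. 0 \<le> real (k n) * (q n)\<^sup>2" by simp
    have "real (k n) * (q n)\<^sup>2 \<le> (real (k n) * real (card (lattice_block (T n) 0)) * pr n)\<^sup>2 * (1 / real (k n))" for n
    proof -
      have "q n \<le> real (card (lattice_block (T n) 0)) * pr n"
        using field.prob_hit_le_card[OF finite_lattice_block] by (simp add: q_def pr_def)
      then have "(q n)\<^sup>2 \<le> (real (card (lattice_block (T n) 0)) * pr n)\<^sup>2"
        by (intro power_mono) (auto simp: q_def)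
      then have "real (k n) * (q n)\<^sup>2 \<le> real (k n) * (real (card (lattice_block (T n) 0)) * pr n)\<^sup>2"
        by (intro mult_left_mono) auto
      then show ?thesis using k_pos[of n] by (simp add: power2_eq_square field_simps)
    qed
    then show "\<forall>\<^sub>F n in sequentially. real (k n) * (q n)\<^sup>2
        \<le> (real (k n) * real (card (lattice_block (T n) 0)) * pr n)\<^sup>2 * (1 / real (k n))" by simp
  qed
qed

lemma k_pair_err_lim: "(\<lambda>n. real (k n) * pair_err n) \<longlonglongrightarrow> 0"
proof -
  have "(\<lambda>n. real (k n) * (q n)\<^sup>2 + real (k n) * \<alpha> n + 2 * (real (k n) * gap_err n)) \<longlonglongrightarrow> 0 + 0 + 2 * 0"
    by (intro tendsto_add tendsto_mult[OF tendsto_const] k_q_square_lim k_\<alpha> k_gap_err_lim)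
  then show ?thesis by (simp add: pair_err_def algebra_simps)
qed

end

text \<open>Taking logarithms, -q - 2q^2 \<le> ln (1 - q) \<le> -q, and m q^2 tends to 0. The
  exponents need not grow, which covers \<mu> = 0.\<close>

lemma one_minus_power_lim:
  fixes q :: "nat \<Rightarrow> real" and m :: "nat \<Rightarrow> nat"
  assumes "\<And>n. 0 \<le> q n" "q \<longlonglongrightarrow> 0" "(\<lambda>n. real (m n) * q n) \<longlonglongrightarrow> \<mu>"
  shows "(\<lambda>n. (1 - q n) ^ m n) \<longlonglongrightarrow> exp (- \<mu>)"
proof -
  have small: "\<forall>\<^sub>F n in sequentially. q n < 1 / 2"
    by (rule order_tendstoD(2)[OF assms(2)]) simp
  have "(\<lambda>n. real (m n) * ln (1 - q n)) \<longlonglongrightarrow> - \<mu>"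
  proof (rule tendsto_sandwich)
    have "(\<lambda>n. - (real (m n) * q n) - 2 * (real (m n) * q n) * q n) \<longlonglongrightarrow> - \<mu> - 2 * \<mu> * 0"
      by (intro tendsto_intros assms)
    then show "(\<lambda>n. - (real (m n) * q n) - 2 * (real (m n) * q n) * q n) \<longlonglongrightarrow> - \<mu>" by simp
    show "(\<lambda>n. - (real (m n) * q n)) \<longlonglongrightarrow> - \<mu>" by (intro tendsto_minus assms)
    show "\<forall>\<^sub>F n in sequentially. - (real (m n) * q n) - 2 * (real (m n) * q n) * q n \<le> real (m n) * ln (1 - q n)"
      using small
    proof eventually_elim
      case (elim n)
      have "- q n - 2 * (q n)\<^sup>2 \<le> ln (1 - q n)"
        using assms(1)[of n] elim by (intro ln_one_minus_pos_lower_bound) auto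
      then have "real (m n) * (- q n - 2 * (q n)\<^sup>2) \<le> real (m n) * ln (1 - q n)"
        by (intro mult_left_mono) auto
      then show ?case by (simp add: algebra_simps power2_eq_square)
    qed
    show "\<forall>\<^sub>F n in sequentially. real (m n) * ln (1 - q n) \<le> - (real (m n) * q n)"
      using small
    proof eventually_elim
      case (elim n)
      have "ln (1 - q n) \<le> - q n"
        using assms(1)[of n] elim by (intro ln_one_minus_pos_upper_bound) auto
      then have "real (m n) * ln (1 - q n) \<le> real (m n) * (- q n)"
        by (intro mult_left_mono) auto
      then show ?case by simp
    qed
  qed
  then have "(\<lambda>n. exp (real (m n) * ln (1 - q n))) \<longlonglongrightarrow> exp (- \<mu>)"
    by (rule tendsto_exp)
  moreover have "\<forall>\<^sub>F n in sequentially. exp (real (m n) * ln (1 - q n)) = (1 - q n) ^ m n"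
    using small by eventually_elim (simp add: exp_of_nat_mult)
  ultimately show ?thesis by (rule Lim_transform_eventually)
qed

section \<open>Limits of the hitting and void probabilities\<close>

context extremal_field
begin

lemma Q_eq: "{z. h n * of_int_vec z \<in> C} = Q_minus C (c n) (k n)"
proof -
  have "vec_quot (of_int_vec z * block_side (c n) (k n)) (c n) = h n * of_int_vec z" for z
    by (simp add: vec_eq_iff vec_quot_def block_side_def h_eq T_def kr_eq of_int_vec_def)
  then show ?thesis by (simp add: Q_minus_def)
qed

text \<open>Positive block sides and a finite index set are what is available only for large
  n.\<close>

lemma eventually_cluster_blocks:
  "\<forall>\<^sub>F n in sequentially.
     cluster_blocks M \<xi> (x n) (K_box \<kappa> (c n)) (\<gamma> n) (\<alpha> n) (T n) (g n) C (c n) (k n) (kr n)"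
proof -
  have "\<forall>\<^sub>F n in sequentially. finite (Q_minus C (c n) (k n))"
    using card_lattice_in_Jordan_set(1)[OF h_pos h_lim _ C_Jordan] C_compact
    by (simp add: Q_eq compact_imp_bounded borel_compact)
  then show ?thesis
    using T_pos
  proof eventually_elim
    case (elim n)
    show ?case
    proof unfold_locales
      fix A B :: "(int ^ 'd) set"
      assume "A \<subseteq> K_box \<kappa> (c n)" "B \<subseteq> K_box \<kappa> (c n)" "separated (\<gamma> n) A B" "\<exists>a b. A = {a..b}"
      then have "\<bar>\<P>(\<omega> in M. field_max \<xi> (A \<union> B) \<omega> \<le> ereal (x n))
          - \<P>(\<omega> in M. field_max \<xi> A \<omega> \<le> ereal (x n)) * \<P>(\<omega> in M. field_max \<xi> B \<omega> \<le> ereal (x n))\<bar> \<le> \<alpha> n"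
        using mixing unfolding cond_D_def by blast
      then show "\<bar>prob (field.hit n A \<inter> field.hit n B) - prob (field.hit n A) * prob (field.hit n B)\<bar> \<le> \<alpha> n"
        by (simp only: field.prob_cov_no_exceedance)
    next
      show "D_tilde C (c n) (k n) \<subseteq> K_box \<kappa> (c n)"
        using D_tilde_subset_D_plus[OF c_pos] D_plus_subset by blast
    qed (use elim c_pos k_pos C_compact in \<open>auto simp: g_def T_def kr_eq\<close>)
  qed
qed

text \<open>Supplies the block needed for \<open>q_bounds\<close>, with all its neighbours in K. A
  closed set of positive volume with null frontier has an interior point, and small cells around it
  stay inside C.\<close>

lemma reference_block:
  "\<forall>\<^sub>F n in sequentially. \<exists>z0. \<forall>e. (\<forall>i. \<bar>e $ i\<bar> \<le> 1) \<longrightarrow> h n * of_int_vec (z0 + e) \<in> C"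
proof -
  have "interior C \<noteq> {}"
  proof
    assume "interior C = {}"
    then have "negligible C"
      using C_Jordan compact_imp_closed[OF C_compact] by (simp add: frontier_def)
    then have "measure lborel C = 0"
      using negligible_imp_measure0 by (metis measure_completion C_compact borel_compact sets_lborel)
    then show False using C_volume by simp
  qed
  then obtain y0 r where r: "0 < r" "ball y0 r \<subseteq> C"
    by (metis all_not_in_conv mem_interior)
  \<comment> \<open>Per coordinate, one h comes from the distance of \<open>y0\<close> to its cell
    corner and one from the shift by e.\<close>
  have "(\<lambda>n. \<Sum>i\<in>UNIV. 2 * h n $ i) \<longlonglongrightarrow> (\<Sum>i\<in>(UNIV::'d set). 2 * 0)"
    by (intro tendsto_sum tendsto_mult tendsto_const h_lim)
  then have "\<forall>\<^sub>F n in sequentially. (\<Sum>i\<in>UNIV. 2 * h n $ i) < r"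
    using r(1) by (auto dest: order_tendstoD(2))
  then show ?thesis
    using h_pos
  proof eventually_elim
    case (elim n)
    show ?case
    proof (intro exI[of _ "lattice_floor (h n) y0"] allI impI)
      fix e :: "int ^ 'd" assume e: "\<forall>i. \<bar>e $ i\<bar> \<le> 1"
      let ?z = "lattice_floor (h n) y0"
      let ?u = "h n * of_int_vec (?z + e) - y0"
      have "\<bar>?u $ i\<bar> \<le> 2 * h n $ i" for i
      proof -
        have h: "0 < h n $ i" using elim by simp
        have "\<bar>h n $ i * of_int (e $ i)\<bar> \<le> h n $ i * 1"
          unfolding abs_mult using h e by (intro mult_mono) (auto simp flip: of_int_abs)
        moreover have "h n $ i * of_int (?z $ i) \<le> y0 $ i" "y0 $ i < h n $ i * (of_int (?z $ i) + 1)"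
          using lattice_floor_eq_iff[of "h n" y0 ?z] elim by auto
        ultimately show ?thesis by (simp add: of_int_vec_def distrib_left)
      qed
      then have "norm ?u \<le> (\<Sum>i\<in>UNIV. 2 * h n $ i)"
        by (intro order_trans[OF norm_le_l1_cart sum_mono])
      then have "h n * of_int_vec (?z + e) \<in> ball y0 r"
        using elim by (simp add: dist_norm norm_minus_commute)
      then show "h n * of_int_vec (?z + e) \<in> C" using r by blast
    qed
  qed
qed

lemma local_lim: "(\<lambda>n. prob (field.hit n {0} - field.hit n (later_block R (c n) (k n) 0)) / pr n) \<longlonglongrightarrow> \<theta>"
proof -
  have "\<P>(\<omega> in M. field_max \<xi> (later_block R (c n) (k n) 0) \<omega> \<le> ereal (x n) \<bar> \<xi> 0 \<omega> > x n)
      = prob (field.hit n {0} - field.hit n (later_block R (c n) (k n) 0)) / pr n" for n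
  proof -
    have "{\<omega> \<in> space M. field_max \<xi> (later_block R (c n) (k n) 0) \<omega> \<le> ereal (x n) \<and> x n < \<xi> 0 \<omega>}
        = field.hit n {0} - field.hit n (later_block R (c n) (k n) 0)"
      by (auto simp: field_max_def field.hit_def SUP_le_iff not_less)
    then show ?thesis by (simp add: cond_prob_def pr_def field.hit_def)
  qed
  then show ?thesis using local_cond by (simp add: cond_D_local_def)
qed

lemma k_q_lim: "(\<lambda>n. real (k n) * q n) \<longlonglongrightarrow> \<theta> * \<tau>"
proof -
  define s where "s n = prob (field.hit n {0} - field.hit n (later_block R (c n) (k n) 0))" for n
  have "(\<lambda>n. (real (k n) * real (card (lattice_block (T n) 0)) * pr n) * (s n / pr n)) \<longlonglongrightarrow> \<tau> * \<theta>"
    unfolding s_def by (intro tendsto_mult k_block_pr_lim local_lim)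
  \<comment> \<open>Cancelling \<open>pr n\<close> is legitimate: it is eventually non-zero because
    the product tends to \<tau> > 0.\<close>
  moreover have "\<forall>\<^sub>F n in sequentially. (real (k n) * real (card (lattice_block (T n) 0)) * pr n) * (s n / pr n)
      = real (k n) * (real (card (lattice_block (T n) 0)) * s n)"
    using order_tendstoD(1)[OF k_block_pr_lim \<tau>_pos]
    by eventually_elim auto
  ultimately have lower: "(\<lambda>n. real (k n) * (real (card (lattice_block (T n) 0)) * s n)) \<longlonglongrightarrow> \<tau> * \<theta>"
    by (rule Lim_transform_eventually)
  have "(\<lambda>n. real (k n) * (real (card (lattice_block (T n) 0)) * s n) + 3 ^ CARD('d) * (real (k n) * pair_err n)) \<longlonglongrightarrow> \<tau> * \<theta> + 3 ^ CARD('d) * 0"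
    by (intro tendsto_add lower tendsto_mult tendsto_const k_pair_err_lim)
  then have upper: "(\<lambda>n. real (k n) * (real (card (lattice_block (T n) 0)) * s n) + 3 ^ CARD('d) * (real (k n) * pair_err n)) \<longlonglongrightarrow> \<tau> * \<theta>"
    by simp
  have bounds: "\<forall>\<^sub>F n in sequentially. real (card (lattice_block (T n) 0)) * s n \<le> q n
      \<and> q n \<le> real (card (lattice_block (T n) 0)) * s n + 3 ^ CARD('d) * pair_err n"
    using eventually_cluster_blocks reference_block
  proof eventually_elim
    case (elim n)
    interpret cb: cluster_blocks M \<xi> "x n" "K_box \<kappa> (c n)" "\<gamma> n" "\<alpha> n" "T n" "g n" C "c n" "k n" "kr n"
      by (rule elim(1))
    obtain z0 where z0: "\<And>e. \<forall>i. \<bar>e $ i\<bar> \<le> 1 \<Longrightarrow> h n * of_int_vec (z0 + e) \<in> C"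
      using elim(2) by blast
    have "cb.block (z0 + e) \<subseteq> K_box \<kappa> (c n)" if "\<forall>i. \<bar>e $ i\<bar> \<le> 1" for e
      using z0[OF that] Q_eq[of n] cb.D_tilde_K by (auto simp: D_tilde_def cb.block_J_eq)
    note cb.q_bounds[OF R_order this]
    then show ?case
      by (simp add: s_def q_def pair_err_def gap_err_def pr_def cb.q_def cb.pair_err_def cb.gap_err_def cb.later_block_eq)
  qed
  have "(\<lambda>n. real (k n) * q n) \<longlonglongrightarrow> \<tau> * \<theta>"
  proof (rule tendsto_sandwich[OF _ _ lower upper])
    show "\<forall>\<^sub>F n in sequentially. real (k n) * (real (card (lattice_block (T n) 0)) * s n) \<le> real (k n) * q n"
      using bounds by eventually_elim (auto intro: mult_left_mono)
    show "\<forall>\<^sub>F n in sequentially. real (k n) * q n \<le>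
        real (k n) * (real (card (lattice_block (T n) 0)) * s n) + 3 ^ CARD('d) * (real (k n) * pair_err n)"
      using bounds
    proof eventually_elim
      case (elim n)
      then have "real (k n) * q n \<le> real (k n) * (real (card (lattice_block (T n) 0)) * s n + 3 ^ CARD('d) * pair_err n)"
        by (intro mult_left_mono) auto
      then show ?case by (simp add: algebra_simps)
    qed
  qed
  then show ?thesis by (simp add: mult.commute)
qed

lemma q_lim: "q \<longlonglongrightarrow> 0"
proof -
  have "(\<lambda>n. real (k n) * q n * (1 / real (k n))) \<longlonglongrightarrow> \<theta> * \<tau> * 0"
    by (intro tendsto_mult k_q_lim one_over_k_lim)
  moreover have "real (k n) * q n * (1 / real (k n)) = q n" for n
    using k_pos[of n] by simp
  ultimately show ?thesis by simp
qed

lemma q_count_lim: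
  assumes "(\<lambda>n. real (m n) / real (k n)) \<longlonglongrightarrow> v"
  shows "(\<lambda>n. q n * real (m n)) \<longlonglongrightarrow> \<theta> * \<tau> * v"
proof -
  have "(\<lambda>n. (real (k n) * q n) * (real (m n) / real (k n))) \<longlonglongrightarrow> \<theta> * \<tau> * v"
    by (intro tendsto_mult k_q_lim assms)
  moreover have "(real (k n) * q n) * (real (m n) / real (k n)) = q n * real (m n)" for n
    using k_pos[of n] by simp
  ultimately show ?thesis by simp
qed

text \<open>The number of blocks divided by k_n tends to |A|. Hence the power converges by
  \<open>one_minus_power_lim\<close>, and the mixing error is this ratio times a null
  sequence.\<close>

lemma void_probability_lim:
  assumes A: "A \<subseteq> C" "A \<in> sets borel" "negligible (frontier A)"
  shows "(\<lambda>n. 1 - prob (field.hit n (\<Union>z\<in>{z. h n * of_int_vec z \<in> A}. lattice_block (T n) z)))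
    \<longlonglongrightarrow> exp (- (\<theta> * \<tau> * measure lborel A))"
proof -
  define S where "S n = {z. h n * of_int_vec z \<in> A}" for n
  note card_lim = card_cells_lim[OF A, folded S_def]
  have "(\<lambda>n. real (card (S n)) * q n) \<longlonglongrightarrow> \<theta> * \<tau> * measure lborel A"
    using q_count_lim[OF card_lim] by (simp add: mult.commute)
  then have power: "(\<lambda>n. (1 - q n) ^ card (S n)) \<longlonglongrightarrow> exp (- (\<theta> * \<tau> * measure lborel A))"
    by (intro one_minus_power_lim q_lim) (simp add: q_def)
  have "(\<lambda>n. (real (card (S n)) / real (k n)) * (real (k n) * \<alpha> n + 2 * (real (k n) * gap_err n)))
      \<longlonglongrightarrow> measure lborel A * (0 + 2 * 0)"
    by (intro tendsto_mult card_lim tendsto_add tendsto_const k_\<alpha> k_gap_err_lim)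
  moreover have "(real (card (S n)) / real (k n)) * (real (k n) * \<alpha> n + 2 * (real (k n) * gap_err n))
      = real (card (S n)) * (\<alpha> n + 2 * gap_err n)" for n
    using k_pos[of n] by (simp add: field_simps)
  ultimately have err: "(\<lambda>n. real (card (S n)) * (\<alpha> n + 2 * gap_err n)) \<longlonglongrightarrow> 0" by simp
  have "(\<lambda>n. (1 - prob (field.hit n (\<Union>z\<in>S n. lattice_block (T n) z))) - (1 - q n) ^ card (S n)) \<longlonglongrightarrow> 0"
  proof (rule Lim_null_comparison[OF _ err])
    show "\<forall>\<^sub>F n in sequentially. norm ((1 - prob (field.hit n (\<Union>z\<in>S n. lattice_block (T n) z))) - (1 - q n) ^ card (S n))
        \<le> real (card (S n)) * (\<alpha> n + 2 * gap_err n)"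
      using eventually_cluster_blocks
    proof eventually_elim
      case (elim n)
      interpret cb: cluster_blocks M \<xi> "x n" "K_box \<kappa> (c n)" "\<gamma> n" "\<alpha> n" "T n" "g n" C "c n" "k n" "kr n"
        by (rule elim)
      have SQ: "S n \<subseteq> Q_minus C (c n) (k n)" using A(1) by (auto simp: S_def simp flip: Q_eq)
      have "\<bar>(1 - prob (field.hit n (\<Union>z\<in>S n. cb.block z))) - (1 - cb.q) ^ card (S n)\<bar>
          \<le> real (card (S n)) * (\<alpha> n + 2 * cb.gap_err)"
        using SQ cb.block_in_K by (intro cb.prob_no_hit_blocks finite_subset[OF SQ cb.finite_Q]) auto
      then show ?case by (simp add: q_def gap_err_def pr_def cb.q_def cb.gap_err_def)
    qed
  qed
  from tendsto_add[OF this power] show ?thesis by (simp add: S_def)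
qed

end

subsection \<open>Convergence of the cluster process\<close>

context extremal_field
begin

text \<open>Obtained for every n, since convergence in distribution as defined requires
  measurability for every n.\<close>

lemma finite_D_tilde: "finite (D_tilde C (c n) (k n))"
  using D_tilde_subset_D_plus[of "c n" C "k n"] D_plus_subset[of n] finite_K_box[of "c n" \<kappa>] c_pos
  by (meson finite_subset order_trans)

text \<open>The grid G stays fixed while n tends to infinity. What survives of the fixed-n bound is
  the discretisation error of f and the multiplicity excess L; one e/2 absorbs the convergence of
  that bound, the other that of the void probabilities.\<close>

lemma char_fn_limit_bound:
  fixes f :: "real ^ 'd \<Rightarrow> real" and G :: "real ^ 'd"
  defines "\<phi> \<equiv> lattice_floor G" and "\<rho> \<equiv> \<theta> * \<tau>"
  assumes f: "continuous_on C f" and ctr: "\<And>n. cluster_point_rule (ctr n)"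
    and G: "\<And>i. 0 < G $ i"
    and I: "finite I" "\<phi> ` C \<subseteq> I"
    and b: "\<And>y. y \<in> C \<Longrightarrow> \<bar>f y - b (\<phi> y)\<bar> \<le> \<epsilon>" "\<And>i. i \<in> I \<Longrightarrow> \<bar>b i\<bar> \<le> B" and "0 < \<epsilon>"
    and excess: "B * (\<Sum>i\<in>I. \<rho> * measure lborel (C \<inter> \<phi> -` {i}) - 1 + exp (- (\<rho> * measure lborel (C \<inter> \<phi> -` {i})))) \<le> L"
    and "0 < e"
  shows "\<forall>\<^sub>F n in sequentially.
    cmod ((CLINT \<omega>|M. iexp (s * (\<integral>y. f y \<partial>cluster_process C \<xi> (ctr n) (c n) (k n) (x n) \<omega>)))
      - (\<Sum>J\<in>Pow I. occupancy_coeff I b s J * exp (- (\<rho> * measure lborel (C \<inter> \<phi> -` J)))))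
    < \<bar>s\<bar> * (2 * \<epsilon> * \<rho> + L) + e"
proof -
  define A where "A J = C \<inter> \<phi> -` J" for J
  define S where "S n J = {z. h n * of_int_vec z \<in> A J}" for n J
  define void where "void n J = 1 - prob (field.hit n (\<Union>z\<in>S n J. lattice_block (T n) z))" for n J
  define bd where "bd n = {z. h n * of_int_vec z \<in> C \<and> (\<exists>y. lattice_floor (h n) y = z \<and> y \<notin> C)}" for n
  define Q where "Q n = {z. h n * of_int_vec z \<in> C}" for n
  define W where "W = (4 * real CARD('d) + 1) ^ CARD('d)"
  have A: "A J \<subseteq> C" "A J \<in> sets borel" "negligible (frontier (A J))" if "J \<subseteq> I" for J
  proof -
    show "A J \<subseteq> C" by (auto simp: A_def)
    have "lattice_floor G -` J \<in> sets borel"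
      using measurable_sets[OF lattice_floor_measurable, of J G] by simp
    then show "A J \<in> sets borel"
      unfolding A_def \<phi>_def by (rule sets.Int[OF borel_compact[OF C_compact]])
    have "finite J" using that I(1) finite_subset by blast
    then show "negligible (frontier (A J))"
      unfolding A_def \<phi>_def by (intro Jordan_Int_cells C_Jordan G)
  qed
  have void_lim: "(\<lambda>n. void n J) \<longlonglongrightarrow> exp (- (\<rho> * measure lborel (A J)))" if "J \<subseteq> I" for J
    unfolding void_def S_def \<rho>_def by (intro void_probability_lim A that)
  have count_lim: "(\<lambda>n. q n * real (card (S n {i}))) \<longlonglongrightarrow> \<rho> * measure lborel (A {i})" if "i \<in> I" for i
    unfolding S_def \<rho>_def using that by (intro q_count_lim card_cells_lim A) auto
  have Q_card_lim: "(\<lambda>n. real (card (Q n)) / real (k n)) \<longlonglongrightarrow> 1"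
    using card_cells_lim[OF order_refl _ C_Jordan] C_compact by (simp add: Q_def C_volume borel_compact)
  have Q_lim: "(\<lambda>n. q n * real (card (Q n))) \<longlonglongrightarrow> \<rho>"
    using q_count_lim[OF Q_card_lim] by (simp add: \<rho>_def)
  have pair_lim: "(\<lambda>n. real (card (Q n)) * (W * pair_err n)) \<longlonglongrightarrow> 0"
  proof -
    have "(\<lambda>n. (real (card (Q n)) / real (k n)) * (W * (real (k n) * pair_err n))) \<longlonglongrightarrow> 1 * (W * 0)"
      by (intro tendsto_mult Q_card_lim tendsto_const k_pair_err_lim)
    moreover have "(real (card (Q n)) / real (k n)) * (W * (real (k n) * pair_err n)) = real (card (Q n)) * (W * pair_err n)" for n
      using k_pos[of n] by simp
    ultimately show ?thesis by simp
  qed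
  have bd_lim: "(\<lambda>n. real (card (bd n)) * q n) \<longlonglongrightarrow> 0"
    using q_count_lim[OF card_boundary_lim] by (simp add: bd_def mult.commute)
  define rhs where "rhs n = 2 * (real (card (Q n)) * (W * pair_err n) + real (card (bd n)) * q n)
      + \<bar>s\<bar> * (2 * \<epsilon> * (q n * real (card (Q n))) + B * (\<Sum>i\<in>I. q n * real (card (S n {i})) - 1 + void n {i}))" for n
  define Sn where "Sn n = (\<Sum>J\<in>Pow I. occupancy_coeff I b s J * void n J)" for n
  define Sl where "Sl = (\<Sum>J\<in>Pow I. occupancy_coeff I b s J * exp (- (\<rho> * measure lborel (A J))))"
  define X where "X n = (CLINT \<omega>|M. iexp (s * (\<integral>y. f y \<partial>cluster_process C \<xi> (ctr n) (c n) (k n) (x n) \<omega>)))" for n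
  have "rhs \<longlonglongrightarrow> 2 * (0 + 0) + \<bar>s\<bar> * (2 * \<epsilon> * \<rho>
      + B * (\<Sum>i\<in>I. \<rho> * measure lborel (A {i}) - 1 + exp (- (\<rho> * measure lborel (A {i})))))"
    unfolding rhs_def[abs_def]
    by (intro tendsto_add tendsto_mult tendsto_diff tendsto_sum tendsto_const pair_lim bd_lim Q_lim count_lim void_lim) auto
  moreover have "2 * (0 + 0) + \<bar>s\<bar> * (2 * \<epsilon> * \<rho>
      + B * (\<Sum>i\<in>I. \<rho> * measure lborel (A {i}) - 1 + exp (- (\<rho> * measure lborel (A {i})))))
      < \<bar>s\<bar> * (2 * \<epsilon> * \<rho> + L) + e / 2"
  proof -
    have "\<bar>s\<bar> * (2 * \<epsilon> * \<rho> + B * (\<Sum>i\<in>I. \<rho> * measure lborel (A {i}) - 1 + exp (- (\<rho> * measure lborel (A {i})))))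
        \<le> \<bar>s\<bar> * (2 * \<epsilon> * \<rho> + L)"
      using excess by (intro mult_left_mono add_left_mono) (auto simp: A_def)
    then show ?thesis using \<open>0 < e\<close> by simp
  qed
  ultimately have rhs_small: "\<forall>\<^sub>F n in sequentially. rhs n < \<bar>s\<bar> * (2 * \<epsilon> * \<rho> + L) + e / 2"
    by (rule order_tendstoD(2))
  have "Sn \<longlonglongrightarrow> Sl"
    unfolding Sn_def[abs_def] Sl_def
    by (intro tendsto_sum tendsto_mult tendsto_const tendsto_of_real void_lim) auto
  then have Sn_close: "\<forall>\<^sub>F n in sequentially. cmod (Sn n - Sl) < e / 2"
    using \<open>0 < e\<close> tendstoD[of Sn Sl sequentially "e / 2"] by (simp add: dist_norm)
  \<comment> \<open>Makes the oscillation of f on one rescaled block at most \<epsilon> once the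
    blocks are small.\<close>
  have "uniformly_continuous_on C f" by (rule compact_uniformly_continuous[OF f C_compact])
  then obtain \<delta> where \<delta>: "0 < \<delta>" "\<And>y y'. y \<in> C \<Longrightarrow> y' \<in> C \<Longrightarrow> dist y' y < \<delta> \<Longrightarrow> dist (f y') (f y) < \<epsilon>"
    using \<open>0 < \<epsilon>\<close> unfolding uniformly_continuous_on_def by metis
  have "\<forall>\<^sub>F n in sequentially. cmod (X n - Sn n) \<le> rhs n"
    using eventually_cluster_blocks h_lower cells_eventually_small[OF h_pos h_lim \<delta>(1)]
  proof eventually_elim
    case (elim n)
    interpret cb: cluster_blocks M \<xi> "x n" "K_box \<kappa> (c n)" "\<gamma> n" "\<alpha> n" "T n" "g n" C "c n" "k n" "kr n"
      by (rule elim(1))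
    have h: "cb.h = h n" by (simp add: cb.h_def h_def)
    have S: "cb.cells_in \<phi> J = S n J" for J
      by (auto simp: cb.cells_in_def cb.Q_eq S_def A_def h)
    have Q: "Q_minus C (c n) (k n) = Q n" by (simp add: Q_def Q_eq)
    have bd: "cb.boundary_cells = bd n" by (auto simp: cb.boundary_cells_def bd_def h Q Q_def)
    have q: "cb.q = q n" by (simp add: cb.q_def q_def)
    have pe: "cb.pair_err = pair_err n"
      by (simp add: cb.pair_err_def pair_err_def q cb.gap_err_def gap_err_def pr_def)
    have osc: "\<bar>f y - f y'\<bar> \<le> \<epsilon>" if "y \<in> C" "y' \<in> C" "lattice_floor cb.h y = lattice_floor cb.h y'" for y y'
    proof -
      have "dist y y' < \<delta>" using elim(3) that(3) by (simp add: h)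
      then show ?thesis using \<delta>(2)[OF that(2,1)] by (simp add: dist_real_def)
    qed
    have "1 / (2 * kr n) \<le> cb.h $ i" for i using elim(2) by (simp add: h)
    from cb.char_fn_cluster_process[OF f ctr this osc I b less_imp_le[OF \<open>0 < \<epsilon>\<close>], where s = s]
    show ?case
      unfolding S Q bd q pe X_def Sn_def rhs_def W_def void_def .
  qed
  then have "\<forall>\<^sub>F n in sequentially. cmod (X n - Sl) < \<bar>s\<bar> * (2 * \<epsilon> * \<rho> + L) + e"
    using rhs_small Sn_close
  proof eventually_elim
    case (elim n)
    have "cmod (X n - Sl) \<le> cmod (X n - Sn n) + cmod (Sn n - Sl)"
      using norm_triangle_ineq[of "X n - Sn n" "Sn n - Sl"] by simp
    then show ?case using elim by linarith
  qed
  then show ?thesis by (simp add: X_def Sl_def A_def)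
qed

lemma char_fn_lim:
  fixes f :: "real ^ 'd \<Rightarrow> real" and M' :: "'v measure"
  assumes N: "poisson_measure M' C (\<theta> * \<tau>) N"
    and f: "continuous_on C f" "\<And>y. y \<in> C \<Longrightarrow> 0 \<le> f y" and ctr: "\<And>n. cluster_point_rule (ctr n)"
  shows "(\<lambda>n. CLINT \<omega>|M. iexp (s * (\<integral>y. f y \<partial>cluster_process C \<xi> (ctr n) (c n) (k n) (x n) \<omega>)))
    \<longlonglongrightarrow> (CLINT \<omega>|M'. iexp (s * (\<integral>y. f y \<partial>N \<omega>)))"
proof (rule tendstoI)
  fix e :: real assume "0 < e"
  interpret N: poisson_measure M' C "\<theta> * \<tau>" N by (rule N)
  define \<rho> where "\<rho> = \<theta> * \<tau>"
  have \<rho>: "0 \<le> \<rho>" using \<theta>_pos \<tau>_pos by (simp add: \<rho>_def)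
  obtain B where B: "\<And>y. y \<in> C \<Longrightarrow> \<bar>f y\<bar> \<le> B" "0 \<le> B"
  proof -
    have "bounded (f ` C)" using compact_continuous_image[OF f(1) C_compact] compact_imp_bounded by blast
    then obtain B where "\<And>y. y \<in> C \<Longrightarrow> \<bar>f y\<bar> \<le> B" by (auto simp: bounded_iff)
    then show thesis using that[of "max B 0"] by (simp add: le_max_iff_disj)
  qed
  \<comment> \<open>Sum of the coefficients of \<epsilon> in the two error bounds: 2\<rho> +
    B\<rho>^2 from the cluster process and \<rho> + B\<rho>^2 from the Poisson measure. The summand
    1 keeps D positive when s = 0, and \<epsilon> = e/(2D) leaves e/2 for the limit in n.\<close>
  define D where "D = \<bar>s\<bar> * (3 * \<rho> + 2 * B * \<rho>\<^sup>2) + 1"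
  have D: "0 < D" using \<rho> B(2) by (simp add: D_def add_nonneg_pos)
  define \<epsilon> where "\<epsilon> = e / (2 * D)"
  have \<epsilon>: "0 < \<epsilon>" using \<open>0 < e\<close> D by (simp add: \<epsilon>_def)
  obtain G :: "real ^ 'd" where G: "\<And>i. 0 < G $ i" "(\<Prod>i\<in>UNIV. G $ i) \<le> \<epsilon>"
    "\<And>y y'. y \<in> C \<Longrightarrow> y' \<in> C \<Longrightarrow> lattice_floor G y = lattice_floor G y' \<Longrightarrow> \<bar>f y - f y'\<bar> \<le> \<epsilon>"
    using fine_cells_exist[OF C_compact f(1) \<epsilon>] by metis
  define \<phi> where "\<phi> = lattice_floor G"
  define I where "I = \<phi> ` C"
  \<comment> \<open>Sampling f at a point of C in the cell keeps the weights within the bound B of f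
    and within \<epsilon> of f on that cell.\<close>
  define b where "b i = f (SOME y. y \<in> C \<and> \<phi> y = i)" for i
  have I: "finite I" "\<phi> ` C \<subseteq> I"
    using finite_lattice_floor_image[OF compact_imp_bounded[OF C_compact] G(1)] by (simp_all add: I_def \<phi>_def)
  have cells: "C \<inter> \<phi> -` {i} \<in> sets borel" for i
    using measurable_sets[OF lattice_floor_measurable, of "{i}" G]
    unfolding \<phi>_def by (intro sets.Int[OF borel_compact[OF C_compact]]) simp
  have some: "(SOME y. y \<in> C \<and> \<phi> y = i) \<in> C \<and> \<phi> (SOME y. y \<in> C \<and> \<phi> y = i) = i" if "i \<in> I" for i
    by (rule someI_ex) (use that in \<open>auto simp: I_def\<close>)
  have b: "\<bar>f y - b (\<phi> y)\<bar> \<le> \<epsilon>" if "y \<in> C" for y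
    unfolding b_def using some[of "\<phi> y"] that by (intro G(3)) (auto simp: I_def \<phi>_def)
  have bB: "\<bar>b i\<bar> \<le> B" if "i \<in> I" for i
    unfolding b_def using some[OF that] by (intro B(1)) auto
  have small: "measure lborel (C \<inter> \<phi> -` {i}) \<le> \<epsilon>" for i
  proof -
    have "measure lborel (C \<inter> \<phi> -` {i}) \<le> measure lborel (\<phi> -` {i})"
      using measurable_sets[OF lattice_floor_measurable, of "{i}" G] cells emeasure_lattice_floor_vimage[OF G(1), of i]
      by (intro measure_mono_fmeasurable) (auto simp: \<phi>_def fmeasurable_def)
    also have "\<dots> = (\<Prod>i\<in>UNIV. G $ i)"
      using emeasure_lattice_floor_vimage[OF G(1), of i] G(1)
      by (simp add: measure_def \<phi>_def prod_nonneg less_imp_le)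
    finally show ?thesis using G(2) by simp
  qed
  have "B * (\<Sum>i\<in>I. \<rho> * measure lborel (C \<inter> \<phi> -` {i}) - 1 + exp (- (\<rho> * measure lborel (C \<inter> \<phi> -` {i})))) \<le> B * (\<rho>\<^sup>2 * \<epsilon>)"
    using N.sum_multiplicity_excess[OF I cells small] B(2) by (intro mult_left_mono) (auto simp: C_volume \<rho>_def)
  from char_fn_limit_bound[OF f(1) ctr G(1) I[unfolded \<phi>_def] b[unfolded \<phi>_def] bB \<epsilon> this[unfolded \<phi>_def \<rho>_def],
      where e = "e / 2" and s = s]
  have lim: "\<forall>\<^sub>F n in sequentially.
    cmod ((CLINT \<omega>|M. iexp (s * (\<integral>y. f y \<partial>cluster_process C \<xi> (ctr n) (c n) (k n) (x n) \<omega>)))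
      - (\<Sum>J\<in>Pow I. occupancy_coeff I b s J * exp (- (\<rho> * measure lborel (C \<inter> \<phi> -` J)))))
    < \<bar>s\<bar> * (2 * \<epsilon> * \<rho> + B * (\<rho>\<^sup>2 * \<epsilon>)) + e / 2"
    using \<open>0 < e\<close> unfolding \<phi>_def \<rho>_def by simp
  have 2: "cmod ((CLINT \<omega>|M'. iexp (s * (\<integral>y. f y \<partial>N \<omega>)))
      - (\<Sum>J\<in>Pow I. occupancy_coeff I b s J * exp (- (\<rho> * measure lborel (C \<inter> \<phi> -` J)))))
    \<le> \<bar>s\<bar> * (\<epsilon> * \<rho> + B * (\<rho>\<^sup>2 * \<epsilon>))"
    using N.char_fn_integral_N[OF f I cells b bB small less_imp_le[OF \<epsilon>] B(2), of s] by (simp add: C_volume \<rho>_def)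
  have 3: "\<bar>s\<bar> * (2 * \<epsilon> * \<rho> + B * (\<rho>\<^sup>2 * \<epsilon>)) + \<bar>s\<bar> * (\<epsilon> * \<rho> + B * (\<rho>\<^sup>2 * \<epsilon>)) \<le> e / 2"
  proof -
    have "\<bar>s\<bar> * (2 * \<epsilon> * \<rho> + B * (\<rho>\<^sup>2 * \<epsilon>)) + \<bar>s\<bar> * (\<epsilon> * \<rho> + B * (\<rho>\<^sup>2 * \<epsilon>)) = (D - 1) * \<epsilon>"
      by (simp add: D_def algebra_simps)
    also have "\<dots> \<le> D * \<epsilon>" using \<epsilon> by (simp add: left_diff_distrib)
    also have "\<dots> = e / 2" using D by (simp add: \<epsilon>_def)
    finally show ?thesis .
  qed
  show "\<forall>\<^sub>F n in sequentially.
      dist (CLINT \<omega>|M. iexp (s * (\<integral>y. f y \<partial>cluster_process C \<xi> (ctr n) (c n) (k n) (x n) \<omega>)))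
        (CLINT \<omega>|M'. iexp (s * (\<integral>y. f y \<partial>N \<omega>))) < e"
    using lim
  proof (rule eventually_mono)
    fix n
    let ?S = "\<Sum>J\<in>Pow I. occupancy_coeff I b s J * exp (- (\<rho> * measure lborel (C \<inter> \<phi> -` J)))"
    let ?X = "CLINT \<omega>|M. iexp (s * (\<integral>y. f y \<partial>cluster_process C \<xi> (ctr n) (c n) (k n) (x n) \<omega>))"
    let ?Y = "CLINT \<omega>|M'. iexp (s * (\<integral>y. f y \<partial>N \<omega>))"
    assume 1: "cmod (?X - ?S) < \<bar>s\<bar> * (2 * \<epsilon> * \<rho> + B * (\<rho>\<^sup>2 * \<epsilon>)) + e / 2"
    have "cmod (?X - ?Y) \<le> cmod (?X - ?S) + cmod (?Y - ?S)"
      using norm_triangle_ineq4[of "?X - ?S" "?Y - ?S"] by simp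
    then show "dist ?X ?Y < e" unfolding dist_norm using 1 2 3 by linarith
  qed
qed

text \<open>For each test function f, weak convergence of the integrals follows from
  \<open>char_fn_lim\<close> by Levy's continuity theorem.\<close>

theorem cluster_process_converges:
  fixes M' :: "'v measure"
  assumes ctr: "\<And>n. cluster_point_rule (ctr n)" and M': "prob_space M'"
    and N: "homogeneous_poisson_measure M' C (\<theta> * \<tau>) N"
  shows "conv_vd C M (\<lambda>n. cluster_process C \<xi> (ctr n) (c n) (k n) (x n)) M' N"
  unfolding conv_vd_def
proof (intro allI impI, elim conjE)
  fix f :: "real ^ 'd \<Rightarrow> real"
  assume f: "continuous_on C f" "\<forall>y\<in>C. 0 \<le> f y"
  have pm: "poisson_measure M' C (\<theta> * \<tau>) N"
    using M' N C_compact \<theta>_pos \<tau>_pos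
    by (simp add: poisson_measure_def poisson_measure_axioms_def)
  interpret N: poisson_measure M' C "\<theta> * \<tau>" N by (rule pm)
  let ?X = "\<lambda>n \<omega>. \<integral>y. f y \<partial>cluster_process C \<xi> (ctr n) (c n) (k n) (x n) \<omega>"
  let ?Y = "\<lambda>\<omega>. \<integral>y. f y \<partial>N \<omega>"
  have X [measurable]: "?X n \<in> borel_measurable M" for n
    using C_compact f(1) finite_D_tilde
    by (intro integral_cluster_process_measurable compact_imp_closed field.\<xi>_measurable) auto
  have Y [measurable]: "?Y \<in> borel_measurable M'"
    using f by (intro N.integral_N_measurable) auto
  have "char (distr M borel (?X n)) s = (CLINT \<omega>|M. iexp (s * ?X n \<omega>))" for n s
    unfolding char_def by (subst integral_distr) auto
  moreover have "char (distr M' borel ?Y) s = (CLINT \<omega>|M'. iexp (s * ?Y \<omega>))" for s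
    unfolding char_def by (subst integral_distr) auto
  ultimately have "(\<lambda>n. char (distr M borel (?X n)) s) \<longlonglongrightarrow> char (distr M' borel ?Y) s" for s
    using char_fn_lim[OF pm f(1) _ ctr, of s] f(2) by simp
  then have "weak_conv_m (\<lambda>n. distr M borel (?X n)) (distr M' borel ?Y)"
    by (intro levy_continuity real_distribution_distr N.real_distribution_distr) auto
  then show "conv_in_distr M ?X M' ?Y"
    unfolding conv_in_distr_def using X Y by blast
qed

end

theorem theorem4p2:
  fixes C :: "(real ^ 'd) set"
    and p :: nat
    and c :: "nat \<Rightarrow> real ^ 'd"
    and M :: "'w measure"
    and \<xi> :: "int ^ 'd \<Rightarrow> 'w \<Rightarrow> real"
    and x :: "nat \<Rightarrow> real"
    and \<kappa> :: real
    and \<gamma> :: "nat \<Rightarrow> real ^ 'd"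
    and \<alpha> :: "nat \<Rightarrow> real"
    and k :: "nat \<Rightarrow> nat"
    and R :: "(int ^ 'd) rel"
    and \<theta> \<tau> :: real
    and ctr :: "nat \<Rightarrow> (real ^ 'd) set \<Rightarrow> real ^ 'd"
    and M' :: "'v measure"
    and N :: "'v \<Rightarrow> (real ^ 'd) measure"
  assumes C_p_convex: "p_convex p C"
    and C_volume: "measure lborel C = 1"
    and c_pos: "\<And>n i. 0 < c n $ i"
    and c_unbounded: "\<And>i. filterlim (\<lambda>n. c n $ i) at_top sequentially"
    and M_prob: "prob_space M"
    and \<xi>_stationary: "stationary_field M \<xi>"
    and k_pos: "\<And>n. 0 < k n"
    and k_unbounded: "filterlim k at_top sequentially"
    and k_small: "vec_small_o (\<lambda>n. \<chi> i. root CARD('d) (real (k n))) c"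
    and \<kappa>_pos: "0 < \<kappa>"
    and D_plus_subset: "\<And>n. D_plus C (c n) (k n) \<subseteq> K_box \<kappa> (c n)"
    and mixing: "cond_D M \<xi> c x (\<lambda>n. K_box \<kappa> (c n)) \<gamma> \<alpha>"
    and k_\<alpha>: "(\<lambda>n. real (k n) * \<alpha> n) \<longlonglongrightarrow> 0"
    and k_\<gamma>: "vec_small_o (\<lambda>n. root CARD('d) (real (k n)) *\<^sub>R \<gamma> n) c"
    and R_order: "translation_invariant_total_order R"
    and local_cond: "cond_D_local M \<xi> c R x k \<theta>"
    and \<theta>_range: "0 < \<theta>" "\<theta> \<le> 1"
    and \<tau>_pos: "0 < \<tau>"
    and exceedances:
      "(\<lambda>n. real (card (lattice_points (scale_set (c n) C))) * \<P>(\<omega> in M. \<xi> 0 \<omega> > x n)) \<longlonglongrightarrow> \<tau>"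
    and ctr_rule: "\<And>n. cluster_point_rule (ctr n)"
    and M'_prob: "prob_space M'"
    and N_poisson: "homogeneous_poisson_measure M' C (\<theta> * \<tau>) N"
  shows "conv_vd C M (\<lambda>n. cluster_process C \<xi> (ctr n) (c n) (k n) (x n)) M' N"
proof -
  interpret prob_space M by (rule M_prob)
  interpret extremal_field M C p c \<xi> x \<kappa> \<gamma> \<alpha> k R \<theta> \<tau> "\<lambda>n. root CARD('d) (real (k n))"
    by unfold_locales
      (use assms in \<open>auto simp: vec_small_o_def\<close>)
  show ?thesis
    by (rule cluster_process_converges[OF ctr_rule M'_prob N_poisson])
qed

end
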